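(* Let $k\in 2\mathbb{Z}$, let $m\neq 0$ be an integer and let $r\geq 0$ be an integer, and put $F_{k,m,r}(z)=G_{k,m,r}(z)=0$ for every $r<0$. If $k\le 0$, then \[ \xi_k F_{k,m,r}(z)=(4\pi)^{1-k}\bigl\{(1-k)G_{2-k,-m,r}(z)+G_{2-k,-m,r-1}(z)\bigr\} \] and \[ \Delta_k F_{k,m,r}(z)=(k-1)F_{k,m,r-1}(z)-F_{k,m,r-2}(z). \] If $k\ge 2$, then \[ \xi_k G_{k,m,r}(z)=(4\pi)^{1-k}F_{2-k,-m,r-1}(z) \] and \[ \Delta_k G_{k,m,r}(z)=(1-k)G_{k,m,r-1}(z)-G_{k,m,r-2}(z). \]
   Context: Let $\mathfrak{H}=\{z=x+iy:\,y>0\}$ and $q=e^{2\pi i z}$. For $k\in 2\mathbb{Z}$, the weight $k$ hyperbolic Laplacian is \[ \Delta_k=-y^2\Bigl(\tfrac{\partial^2}{\partial x^2}+\tfrac{\partial^2}{\partial y^2}\Bigr)+iky\Bigl(\tfrac{\partial}{\partial x}+i\tfrac{\partial}{\partial y}\Bigr), \] and $\xi_k:=2iy^k\,\overline{\tfrac{\partial}{\partial\bar z}}$, i.e. $\xi_k f=2iy^k\overline{\partial f/\partial \bar z}$. The slash operator is $(f|_k\gamma)(z)=(cz+d)^{-k}f(\gamma z)$ for $\gamma=\left(\begin{smallmatrix}a&b\\c&d\end{smallmatrix}\right)\in\Gamma=\mathrm{SL}_2(\mathbb{Z})$. Let $\Gamma_\infty$ be the stabilizer of $\infty$ in $\Gamma$,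 and let $M_{\mu,\nu}$ be the M-Whittaker function. For $k\in2\mathbb{Z}$ and an integer $m\neq0$, put $\phi_{k,m}(z,s)=(4\pi y)^{-k/2}M_{\mathrm{sgn}(m)\frac{k}{2},s-\frac12}(4\pi|m|y)e^{2\pi imx}$. The Maass–Poincaré series is $P_{k,m}(z,s)=\sum_{\gamma\in\Gamma_\infty\backslash\Gamma}\phi_{k,m}(z,s)|_k\gamma$. It converges for $\mathrm{Re}(s)>1$. For $k=0,2$ it is analytically continued to a neighborhood of $s=1$ via its Fourier expansion (Duke–Imamoḡlu–Tóth). The Taylor coefficients $F_{k,m,r}$ (for $k\le0$) and $G_{k,m,r}$ (for $k\ge2$) are defined by \[ P_{k,m}(z,s)=\sum_{r\ge0}F_{k,m,r}(z)\bigl(s+\tfrac k2-1\bigr)^r \quad (k\le0), \] \[ P_{k,m}(z,s)=\sum_{r\ge0}G_{k,m,r}(z)\bigl(s-\tfrac k2\bigr)^r \quad (k\ge2). \] *)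

theory Defs
  imports "HOL-Complex_Analysis.Complex_Analysis" "HOL-Algebra.Coset"
begin

no_notation fps_nth (infixl "$" 75)

section \<open>Differential operators on the upper half-plane\<close>

definition dx :: "(complex \<Rightarrow> complex) \<Rightarrow> complex \<Rightarrow> complex" where
  "dx f z = vector_derivative (\<lambda>t. f (Complex t (Im z))) (at (Re z))"

definition dy :: "(complex \<Rightarrow> complex) \<Rightarrow> complex \<Rightarrow> complex" where
  "dy f z = vector_derivative (\<lambda>t. f (Complex (Re z) t)) (at (Im z))"

definition dzbar :: "(complex \<Rightarrow> complex) \<Rightarrow> complex \<Rightarrow> complex" where
  "dzbar f z = (dx f z + \<i> * dy f z) / 2"

definition xi :: "int \<Rightarrow> (complex \<Rightarrow> complex) \<Rightarrow> complex \<Rightarrow> complex" where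
  "xi k f z = 2 * \<i> * of_real (Im z) powi k * cnj (dzbar f z)"

definition hyp_laplacian :: "int \<Rightarrow> (complex \<Rightarrow> complex) \<Rightarrow> complex \<Rightarrow> complex" where
  "hyp_laplacian k f z =
     - (of_real (Im z))\<^sup>2 * (dx (dx f) z + dy (dy f) z)
     + \<i> * of_int k * of_real (Im z) * (dx f z + \<i> * dy f z)"


section \<open>The modular group and the slash operator\<close>

definition SL2Z :: "(int^2^2) monoid" where
  "SL2Z = \<lparr>carrier = {A. det A = 1}, monoid.mult = (**), one = mat 1\<rparr>"

text \<open>A matrix sends \<open>\<infinity>\<close> to \<open>a / c\<close>, so it fixes \<open>\<infinity>\<close> iff its lower left entry vanishes. In
  particular \<open>-1\<close> belongs to the stabilizer.\<close>
definition Gamma_inf :: "(int^2^2) set" where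
  "Gamma_inf = {A \<in> carrier SL2Z. A $ 2 $ 1 = 0}"

definition moebius_action :: "int^2^2 \<Rightarrow> complex \<Rightarrow> complex" where
  "moebius_action A z =
     (of_int (A $ 1 $ 1) * z + of_int (A $ 1 $ 2)) / (of_int (A $ 2 $ 1) * z + of_int (A $ 2 $ 2))"

definition slash :: "int \<Rightarrow> (complex \<Rightarrow> complex) \<Rightarrow> int^2^2 \<Rightarrow> complex \<Rightarrow> complex" where
  "slash k f A z = (of_int (A $ 2 $ 1) * z + of_int (A $ 2 $ 2)) powi (- k) * f (moebius_action A z)"


section \<open>Maass--Poincare series\<close>

text \<open>\<open>M\<^bsub>\<mu>,\<nu>\<^esub>(z) = e\<^bsup>-z/2\<^esup> z\<^bsup>\<nu>+1/2\<^esup> \<^sub>1F\<^sub>1(\<nu> - \<mu> + 1/2; 1 + 2\<nu>; z)\<close>, with the principal power.\<close>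
definition whittaker_M :: "complex \<Rightarrow> complex \<Rightarrow> complex \<Rightarrow> complex" where
  "whittaker_M \<mu> \<nu> z =
     exp (- z / 2) * z powr (\<nu> + 1/2) *
     eval_fps (fps_hypergeo [\<nu> - \<mu> + 1/2] [1 + 2 * \<nu>] 1) z"

definition phi :: "int \<Rightarrow> int \<Rightarrow> complex \<Rightarrow> complex \<Rightarrow> complex" where
  "phi k m z s =
     of_real ((4 * pi * Im z) powr (- of_int k / 2)) *
     whittaker_M (of_int (sgn m) * of_int k / 2) (s - 1/2) (of_real (4 * pi * \<bar>of_int m\<bar> * Im z)) *
     exp (2 * of_real pi * \<i> * of_int m * of_real (Re z))"

text \<open>The sum over \<open>\<Gamma>\<^sub>\<infinity> \ \<Gamma>\<close>. For even \<open>k\<close> the summand does not depend on the representative of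
  the coset, see \<open>phi_slash_Gamma_inf\<close> below.\<close>
definition poincare_series :: "int \<Rightarrow> int \<Rightarrow> complex \<Rightarrow> complex \<Rightarrow> complex" where
  "poincare_series k m z s =
     (\<Sum>\<^sub>\<infinity>C\<in>rcosets\<^bsub>SL2Z\<^esub> Gamma_inf. slash k (\<lambda>w. phi k m w s) (SOME A. A \<in> C) z)"

definition continues_to_one :: "(complex \<Rightarrow> complex) \<Rightarrow> (complex \<Rightarrow> complex) \<Rightarrow> bool" where
  "continues_to_one f g \<longleftrightarrow>
     (\<exists>\<epsilon>>0. g holomorphic_on {s. Re s > 1} \<union> ball 1 \<epsilon>) \<and> (\<forall>s. Re s > 1 \<longrightarrow> g s = f s)"

text \<open>The series itself for \<open>k \<noteq> 0, 2\<close>; its analytic continuation to a neighbourhood of \<open>s = 1\<close> for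
  \<open>k = 0, 2\<close>. The germ of the continuation at \<open>1\<close>, hence every Taylor coefficient there, does not
  depend on the choice made by \<open>SOME\<close>, see \<open>continues_to_one_unique\<close> below.\<close>
definition maass_poincare :: "int \<Rightarrow> int \<Rightarrow> complex \<Rightarrow> complex \<Rightarrow> complex" where
  "maass_poincare k m z =
     (if k = 0 \<or> k = 2 then SOME g. continues_to_one (poincare_series k m z) g
      else poincare_series k m z)"


section \<open>Taylor coefficients\<close>

text \<open>\<open>F\<close> is used for \<open>k \<le> 0\<close> (expansion at \<open>1 - k/2\<close>), \<open>G\<close> for \<open>k \<ge> 2\<close> (expansion at \<open>k/2\<close>);
  both vanish for negative indices.\<close>
definition F_coeff :: "int \<Rightarrow> int \<Rightarrow> int \<Rightarrow> complex \<Rightarrow> complex" where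
  "F_coeff k m r z =
     (if r < 0 then 0
      else fps_nth (fps_expansion (maass_poincare k m z) (1 - of_int k / 2)) (nat r))"

definition G_coeff :: "int \<Rightarrow> int \<Rightarrow> int \<Rightarrow> complex \<Rightarrow> complex" where
  "G_coeff k m r z =
     (if r < 0 then 0
      else fps_nth (fps_expansion (maass_poincare k m z) (of_int k / 2)) (nat r))"


section \<open>Well-definedness\<close>

lemma continues_to_one_unique:
  assumes "continues_to_one f g" "continues_to_one f h"
  shows "eventually (\<lambda>s. g s = h s) (nhds 1)"
proof -
  from assms obtain d e where d: "d > 0" "g holomorphic_on {s. Re s > 1} \<union> ball 1 d"
    and e: "e > 0" "h holomorphic_on {s. Re s > 1} \<union> ball 1 e"
    and eq: "\<And>s. Re s > 1 \<Longrightarrow> g s = f s" "\<And>s. Re s > 1 \<Longrightarrow> h s = f s"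
    unfolding continues_to_one_def by blast
  define \<epsilon> where "\<epsilon> = min d e"
  have eps: "\<epsilon> > 0" using d e by (simp add: \<epsilon>_def)
  let ?B = "ball (1::complex) \<epsilon>"
  let ?S = "?B \<inter> {s. Re s > 1}"
  have op: "open ?S" by (intro open_Int open_ball open_halfspace_Re_gt)
  have mem: "complex_of_real (1 + \<epsilon> / 2) \<in> ?S"
    using eps by (simp add: dist_norm norm_divide)
  have hol: "(\<lambda>s. g s - h s) holomorphic_on ?B"
    by (intro holomorphic_on_diff; rule holomorphic_on_subset[OF d(2)] holomorphic_on_subset[OF e(2)])
       (auto simp: \<epsilon>_def)
  have "g s - h s = 0" if "s \<in> ?B" for s
  proof (rule analytic_continuation[OF hol, of ?S "complex_of_real (1 + \<epsilon> / 2)" s])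
    show "complex_of_real (1 + \<epsilon> / 2) islimpt ?S"
      using op mem interior_limit_point interior_open by blast
  qed (use mem that eq in auto)
  then show ?thesis
    unfolding eventually_nhds using eps by (intro exI[of _ ?B]) auto
qed

lemma phi_slash_Gamma_inf:
  assumes "even k" "A \<in> carrier SL2Z" "T \<in> Gamma_inf" "Im z > 0"
  shows "slash k (\<lambda>w. phi k m w s) (T ** A) z = slash k (\<lambda>w. phi k m w s) A z"
proof -
  have detT: "T $ 1 $ 1 * T $ 2 $ 2 = 1" and c: "T $ 2 $ 1 = 0"
    using assms(3) by (auto simp: Gamma_inf_def SL2Z_def det_2)
  define a b where "a = T $ 1 $ 1" and "b = T $ 1 $ 2"
  have ad: "a = 1 \<and> T $ 2 $ 2 = 1 \<or> a = -1 \<and> T $ 2 $ 2 = -1"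
    using detT unfolding a_def by (metis zmult_eq_1_iff)
  define n where "n = a * b"
  define u v where "u = of_int (A $ 1 $ 1) * z + of_int (A $ 1 $ 2)"
    and "v = of_int (A $ 2 $ 1) * z + of_int (A $ 2 $ 2)"
  have v0: "v \<noteq> 0"
  proof
    assume "v = 0"
    then have "Im v = 0" "Re v = 0" by auto
    then have "A $ 2 $ 1 = 0" "A $ 2 $ 2 = 0" using assms(4) by (auto simp: v_def)
    then show False using assms(2) by (auto simp: SL2Z_def det_2)
  qed
  have rows: "of_int ((T ** A) $ 1 $ 1) * z + of_int ((T ** A) $ 1 $ 2) = of_int a * u + of_int b * v"
    "of_int ((T ** A) $ 2 $ 1) * z + of_int ((T ** A) $ 2 $ 2) = of_int a * v"
    using ad c by (auto simp: matrix_matrix_mult_def sum_2 u_def v_def a_def b_def algebra_simps)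
  have aa: "a = 1 \<or> a = -1" using ad by auto
  have moeb: "moebius_action (T ** A) z = moebius_action A z + of_int n"
  proof -
    have "moebius_action A z = u / v" by (simp add: moebius_action_def u_def v_def)
    moreover have "moebius_action (T ** A) z = (of_int a * u + of_int b * v) / (of_int a * v)"
      unfolding moebius_action_def rows ..
    ultimately show ?thesis
      using v0 aa by (auto simp: n_def field_simps)
  qed
  have per: "phi k m (w + of_int n) s = phi k m w s" for w
  proof -
    have "exp (2 * of_real pi * \<i> * of_int m * of_real (Re w + of_int n)) =
          exp (2 * of_real pi * \<i> * of_int m * of_real (Re w) + of_int (2 * (m * n)) * of_real pi * \<i>)"
      by (simp add: algebra_simps)
    also have "\<dots> = exp (2 * of_real pi * \<i> * of_int m * of_real (Re w))"
      by (subst exp_eq) (rule exI[of _ "m * n"], simp add: algebra_simps)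
    finally show ?thesis by (simp add: phi_def)
  qed
  have pw: "(of_int a * v) powi (- k) = v powi (- k)"
    using aa assms(1) by (auto simp: power_int_minus power_int_minus_left)
  show ?thesis
    unfolding slash_def rows moeb per pw by (simp add: v_def)
qed

end

theory Submission
  imports Defs "HOL-Number_Theory.Cong"
begin

text \<open>Every \<open>z\<close>-dependent function here extends holomorphically to complex values of \<open>x = Re z\<close> and
  \<open>y = Im z\<close>. A bounded separately holomorphic function of \<open>(x, y, s)\<close> may be differentiated in \<open>x\<close>, \<open>y\<close>
  and expanded in \<open>s\<close> in any order, so all identities reduce to identities for a single summand. The
  contiguous relations of \<open>\<^sub>1F\<^sub>1\<close> give \<open>\<xi>\<^sub>k P\<^sub>k\<^sub>,\<^sub>m(z,s) = (4\<pi>)\<^bsup>1-k\<^esup> (cnj s - k/2) P\<^sub>2\<^sub>-\<^sub>k\<^sub>,\<^sub>-\<^sub>m(z, cnj s)\<close> termwise;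
  applying this twice yields the eigenvalue equation for \<open>\<Delta>\<^sub>k = -\<xi>\<^sub>2\<^sub>-\<^sub>k \<xi>\<^sub>k\<close>, and comparing Taylor
  coefficients gives the theorem.

  For \<open>k = 0\<close> the expansion point \<open>s = 1\<close> lies on the boundary of convergence. Up to an absolutely
  convergent series, \<open>P\<^sub>0\<^sub>,\<^sub>m\<close> is a constant to the power \<open>s\<close> times \<open>\<Sum>\<^sub>c c\<^bsup>-2s\<^esup> \<Sum>\<^sub>d e(m d'/c) g\<^sub>s(x + d/c)\<close>, where \<open>d\<close>
  runs over the units modulo \<open>c\<close>, \<open>d'\<close> is the inverse of \<open>d\<close>, and \<open>g\<^sub>s\<close> is smooth of period 1. Kloosterman's
  fourth moment argument saves a power of \<open>c\<close> in the inner sum, and the series converges for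
  \<open>Re s > 15/16\<close>. The case \<open>k = 2\<close> follows by applying \<open>\<xi>\<^sub>0\<close>.\<close>

section \<open>Families of holomorphic functions\<close>

text \<open>The expansion points explain the shape of the formulas. F in weight k and G in weight 2
  - k are expanded at the same real point 1 - k/2, so the conjugated parameter in the relation for
  \<open>xi\<close> returns to that point. The factor s - k/2 equals 1 - k there and contributes two
  coefficients; at the other point k/2 it vanishes and only shifts the index.

  The obstacle is weight 0. At s = 1 absolute convergence fails, and bounding the sum over the
  residues d by the number of units never gets past Re s = 1. Any power saving suffices, because the
  germ of a continuation at 1 is unique, so its Taylor coefficients can be read from whatever
  formula continues the series. The fourth moment is chosen because it reduces to an elementary
  count of congruences. It gives |K(m,n;c)|^4 <= |m| c^(7/2) d_3(c), hence the exponent 7/8, and a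
  Dirichlet series with terms c^(7/8 - 2s) d_3(c) converges when 2 Re s - 7/8 > 1, that is Re s >
  15/16.\<close>

lemma infsum_holomorphic:
  fixes f :: "'j \<Rightarrow> complex \<Rightarrow> complex"
  assumes "open A" and hol: "\<And>j. j \<in> J \<Longrightarrow> f j holomorphic_on A"
    and bd: "\<And>j z. j \<in> J \<Longrightarrow> z \<in> A \<Longrightarrow> norm (f j z) \<le> M j" and "M summable_on J"
  shows "(\<lambda>z. \<Sum>\<^sub>\<infinity>j\<in>J. f j z) holomorphic_on A"
    and "z \<in> A \<Longrightarrow> ((\<lambda>j. deriv (f j) z) has_sum deriv (\<lambda>z. \<Sum>\<^sub>\<infinity>j\<in>J. f j z) z) J"
proof -
  let ?g = "\<lambda>z. \<Sum>\<^sub>\<infinity>j\<in>J. f j z"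
  have *: "\<exists>D. (?g has_field_derivative D) (at z) \<and> ((\<lambda>j. deriv (f j) z) has_sum D) J" if z: "z \<in> A" for z
  proof -
    obtain r where r: "r > 0" "cball z r \<subseteq> A"
      using \<open>open A\<close> z open_contains_cball by blast
    \<comment> \<open>The M-test along the filter of finite subsets gives uniform convergence on a
      closed disc, and a locally uniform limit of holomorphic functions may be differentiated term
      by term.\<close>
    have ul: "uniform_limit (cball z r) (\<lambda>X y. \<Sum>j\<in>X. f j y) ?g (finite_subsets_at_top J)"
      by (rule Weierstrass_m_test_general[OF _ \<open>M summable_on J\<close>]) (use bd r in auto)
    have fin: "eventually (\<lambda>X. finite X \<and> X \<subseteq> J) (finite_subsets_at_top J)"
      by (auto simp: eventually_finite_subsets_at_top)
    have ev: "eventually (\<lambda>X. continuous_on (cball z r) (\<lambda>y. \<Sum>j\<in>X. f j y) \<and>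
       (\<forall>w\<in>ball z r. ((\<lambda>y. \<Sum>j\<in>X. f j y) has_field_derivative (\<Sum>j\<in>X. deriv (f j) w)) (at w)))
       (finite_subsets_at_top J)"
      using fin
    proof eventually_elim
      case (elim X)
      then have "f j holomorphic_on A" if "j \<in> X" for j using hol that by auto
      then have "continuous_on (cball z r) (f j)" "\<forall>w\<in>ball z r. (f j has_field_derivative deriv (f j) w) (at w)"
        if "j \<in> X" for j
        using that r \<open>open A\<close> by (meson holomorphic_on_imp_continuous_on continuous_on_subset,
            meson ball_subset_cball holomorphic_derivI subsetD)
      then show ?case
        by (auto intro!: continuous_on_sum DERIV_sum)
    qed
    obtain g' where g': "\<And>w. w \<in> ball z r \<Longrightarrow> (?g has_field_derivative (g' w)) (at w) \<and>
        ((\<lambda>X. \<Sum>j\<in>X. deriv (f j) w) \<longlongrightarrow> g' w) (finite_subsets_at_top J)"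
      by (rule has_complex_derivative_uniform_limit[OF ev ul finite_subsets_at_top_neq_bot r(1)]) blast
    have "((\<lambda>j. deriv (f j) z) has_sum g' z) J"
      using g'[of z] r by (auto simp: has_sum_def)
    then show ?thesis using g'[of z] r by auto
  qed
  show "?g holomorphic_on A"
    using * \<open>open A\<close> by (fastforce simp: holomorphic_on_open)
  show "z \<in> A \<Longrightarrow> ((\<lambda>j. deriv (f j) z) has_sum deriv ?g z) J"
    using *[of z] DERIV_imp_deriv by blast
qed

lemma Cauchy_bound_cball:
  assumes "f holomorphic_on A" "open A" "cball u r \<subseteq> A" "r > 0" "\<And>z. z \<in> A \<Longrightarrow> norm (f z) \<le> M"
  shows "norm ((deriv ^^ n) f u) \<le> fact n * M / r ^ n"
proof (rule Cauchy_inequality)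
  show "f holomorphic_on ball u r" "continuous_on (cball u r) f"
    using assms by (meson ball_subset_cball holomorphic_on_subset order_trans,
        meson holomorphic_on_imp_continuous_on continuous_on_subset)
  show "norm (f x) \<le> M" if "norm (u - x) = r" for x
    using that assms by (intro assms(5)) (auto simp: dist_norm subset_iff)
qed fact

text \<open>The error bound sees \<open>f\<close> only through \<open>M\<close>, so it is uniform in
  any further parameter; \<open>partial_deriv_holomorphic\<close> depends on that. Cauchy's
  inequality for the second derivative on discs of radius r/2 gives 2M/(r/2)^2 = 8M/r^2, and
  Taylor's formula does the rest.\<close>

lemma quadratic_remainder:
  assumes hol: "f holomorphic_on A" and "open A" "cball u r \<subseteq> A" "r > 0"
    and M: "\<And>z. z \<in> A \<Longrightarrow> norm (f z) \<le> M" and h: "norm h \<le> r / 2"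
  shows "norm (f (u + h) - f u - h * deriv f u) \<le> 8 * M / r\<^sup>2 * (norm h)\<^sup>2"
proof -
  let ?S = "cball u (r / 2)"
  have 1: "norm ((deriv ^^ 2) f w) \<le> 8 * M / r\<^sup>2" if "w \<in> ?S" for w
  proof -
    have "cball w (r/2) \<subseteq> cball u r"
      using that by (intro subsetI) (auto simp: dist_commute intro: dist_triangle_half_l order.trans[OF dist_triangle[of _ _ w]])
    then have "norm ((deriv ^^ 2) f w) \<le> fact 2 * M / (r/2)^2"
      using assms by (intro Cauchy_bound_cball[where A=A]) auto
    then show ?thesis by (simp add: power_divide mult.commute)
  qed
  have sub: "?S \<subseteq> A" using assms(3,4) by (force simp: subset_iff)
  have "norm ((deriv ^^ 0) f (u + h) - (\<Sum>i\<le>1. (deriv ^^ i) f u * ((u + h) - u) ^ i / fact i))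
      \<le> 8 * M / r\<^sup>2 * norm ((u + h) - u) ^ Suc 1 / fact 1"
  proof (rule complex_Taylor[where S = ?S and f = "\<lambda>i. (deriv ^^ i) f"])
    show "((deriv ^^ i) f has_field_derivative (deriv ^^ Suc i) f x) (at x within ?S)" if "x \<in> ?S" "i \<le> 1" for i x
      using holomorphic_derivI[OF holomorphic_higher_deriv[OF hol \<open>open A\<close>] \<open>open A\<close>, of x i] sub that
      by (auto intro: DERIV_subset)
    show "norm ((deriv ^^ Suc 1) f x) \<le> 8 * M / r\<^sup>2" if "x \<in> ?S" for x
      using 1[OF that] by (simp add: numeral_2_eq_2)
  qed (use h assms in \<open>auto simp: dist_norm\<close>)
  then show ?thesis by (simp add: algebra_simps power2_eq_square)
qed

text \<open>By \<open>quadratic_remainder\<close> the difference quotients in u converge at a rate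
  uniform in v. Their limit is therefore holomorphic in v, and Cauchy's inequality in v carries the
  O(|h|^2) error over to the n-th v-derivative. A uniform bound thus does the work of joint
  continuity.\<close>

lemma partial_deriv_holomorphic:
  fixes V :: "complex \<Rightarrow> complex \<Rightarrow> complex"
  assumes "open A" "open B"
    and h1: "\<And>v. v \<in> B \<Longrightarrow> (\<lambda>u. V u v) holomorphic_on A"
    and h2: "\<And>u. u \<in> A \<Longrightarrow> V u holomorphic_on B"
    and bd: "\<And>u v. u \<in> A \<Longrightarrow> v \<in> B \<Longrightarrow> norm (V u v) \<le> M"
    and u: "u \<in> A"
  shows "(\<lambda>v. deriv (\<lambda>u. V u v) u) holomorphic_on B"
    and "v \<in> B \<Longrightarrow> ((\<lambda>u. (deriv ^^ n) (V u) v) has_field_derivative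
           (deriv ^^ n) (\<lambda>v. deriv (\<lambda>u. V u v) u) v) (at u)"
proof -
  obtain r where r: "r > 0" "cball u r \<subseteq> A"
    using \<open>open A\<close> u open_contains_cball by blast
  define K where "K = 8 * M / r\<^sup>2"
  let ?D = "\<lambda>v. deriv (\<lambda>u. V u v) u"
  have rem: "norm (V (u + h) v - V u v - h * ?D v) \<le> K * (norm h)\<^sup>2" if "norm h \<le> r/2" "v \<in> B" for h v
    unfolding K_def using h1[OF that(2)] \<open>open A\<close> r bd that
    by (intro quadratic_remainder[where A=A and f="\<lambda>u. V u v"]) auto
  have inA: "u + h \<in> A" if "norm h \<le> r/2" for h
    using r that by (force simp: dist_norm subset_iff)
  have rem': "norm ((V (u + h) v - V u v) / h - ?D v) \<le> K * norm h" if "h \<noteq> 0" "norm h \<le> r/2" "v \<in> B" for h v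
  proof -
    have "(V (u + h) v - V u v) / h - ?D v = (V (u + h) v - V u v - h * ?D v) / h"
      using that by (simp add: field_simps)
    then show ?thesis using rem[OF that(2,3)] that(1)
      by (simp add: norm_divide divide_le_eq power2_eq_square mult.assoc)
  qed
  show hol: "?D holomorphic_on B"
  proof -
    define h where "h = (\<lambda>k::nat. complex_of_real (r/2 / Suc k))"
    have h0: "h k \<noteq> 0" "norm (h k) \<le> r/2" "norm (h k) = r/2/Suc k" for k
      using r by (auto simp: h_def norm_divide divide_simps simp del: of_nat_Suc)
    have ul: "uniform_limit B (\<lambda>k v. (V (u + h k) v - V u v) / h k) ?D sequentially"
    proof (rule uniform_limitI)
      fix e :: real assume e: "e > 0"
      have "(\<lambda>k. K * norm (h k)) \<longlonglongrightarrow> K * 0"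
        unfolding h0(3) by (intro tendsto_intros LIMSEQ_Suc[OF lim_const_over_n])
      then have "eventually (\<lambda>k. K * norm (h k) < e) sequentially"
        using e by (intro order_tendstoD) auto
      then show "\<forall>\<^sub>F k in sequentially. \<forall>v\<in>B. dist ((V (u + h k) v - V u v) / h k) (?D v) < e"
      proof eventually_elim
        case (elim k)
        then show ?case using rem'[OF h0(1,2)] by (auto simp: dist_norm intro: le_less_trans)
      qed
    qed
    show ?thesis
    proof (rule holomorphic_uniform_sequence[OF \<open>open B\<close>])
      show "(\<lambda>v. (V (u + h k) v - V u v) / h k) holomorphic_on B" for k
        using h2[OF inA[OF h0(2)]] h2[OF u] h0 by (intro holomorphic_intros) auto
      show "\<exists>d>0. cball x d \<subseteq> B \<and> uniform_limit (cball x d) (\<lambda>k v. (V (u + h k) v - V u v) / h k) ?D sequentially"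
        if "x \<in> B" for x
        using \<open>open B\<close> that ul by (meson open_contains_cball uniform_limit_on_subset)
    qed
  qed
  assume v: "v \<in> B"
  obtain \<rho> where \<rho>: "\<rho> > 0" "cball v \<rho> \<subseteq> B"
    using \<open>open B\<close> v open_contains_cball by blast
  define L where "L = fact n * K / \<rho> ^ n"
  have key: "norm (((deriv ^^ n) (V (u + h)) v - (deriv ^^ n) (V u) v) / h - (deriv ^^ n) ?D v) \<le> L * norm h"
    if h: "h \<noteq> 0" "norm h \<le> r/2" for h
  proof -
    let ?R = "\<lambda>v. V (u + h) v - V u v - h * ?D v"
    have R: "?R holomorphic_on B"
      using h2[OF inA[OF h(2)]] h2[OF u] hol by (intro holomorphic_intros) auto
    have "norm ((deriv ^^ n) ?R v) \<le> fact n * (K * (norm h)\<^sup>2) / \<rho> ^ n"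
      using rem[OF h(2)] \<rho> by (intro Cauchy_bound_cball[OF R \<open>open B\<close>]) auto
    also have "(deriv ^^ n) ?R v = (deriv ^^ n) (V (u + h)) v - (deriv ^^ n) (V u) v - h * (deriv ^^ n) ?D v"
      using h2[OF inA[OF h(2)]] h2[OF u] hol v \<open>open B\<close>
      by (simp add: higher_deriv_diff[where S=B] higher_deriv_cmult[where A=B] holomorphic_on_diff holomorphic_on_mult)
    also have "\<dots> = (((deriv ^^ n) (V (u + h)) v - (deriv ^^ n) (V u) v) / h - (deriv ^^ n) ?D v) * h"
      using h by (simp add: field_simps)
    finally have "norm (((deriv ^^ n) (V (u + h)) v - (deriv ^^ n) (V u) v) / h - (deriv ^^ n) ?D v) * norm h
        \<le> (L * norm h) * norm h"
      by (simp add: L_def norm_mult power2_eq_square mult_ac)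
    then show ?thesis
      using h by (subst (asm) mult_le_cancel_right) auto
  qed
  have "((\<lambda>h. ((deriv ^^ n) (V (u + h)) v - (deriv ^^ n) (V u) v) / h - (deriv ^^ n) ?D v) \<longlongrightarrow> 0) (at 0)"
  proof (rule Lim_null_comparison)
    show "\<forall>\<^sub>F h in at 0. norm (((deriv ^^ n) (V (u + h)) v - (deriv ^^ n) (V u) v) / h - (deriv ^^ n) ?D v) \<le> L * norm h"
      unfolding eventually_at using r key by (intro exI[of _ "r/2"]) (auto simp: dist_norm)
    show "((\<lambda>h. L * norm h) \<longlongrightarrow> 0) (at (0::complex))"
      by (intro tendsto_eq_intros | simp)+
  qed
  then show "((\<lambda>u. (deriv ^^ n) (V u) v) has_field_derivative (deriv ^^ n) ?D v) (at u)"
    unfolding DERIV_def by (simp add: LIM_zero_iff)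
qed

text \<open>The single bound \<open>M\<close> is part of the notion because, with separate
  holomorphy, it passes through sums, products and (on a smaller disc) derivatives, so no joint
  regularity has to be carried along.\<close>

definition hol3 where
  "hol3 A B C U M \<longleftrightarrow> open A \<and> open B \<and> open C \<and>
     (\<forall>x\<in>A. \<forall>y\<in>B. \<forall>s\<in>C. norm (U x y s :: complex) \<le> (M :: real)) \<and>
     (\<forall>y\<in>B. \<forall>s\<in>C. (\<lambda>x::complex. U x y s) holomorphic_on A) \<and>
     (\<forall>x\<in>A. \<forall>s\<in>C. (\<lambda>y::complex. U x y s) holomorphic_on B) \<and>
     (\<forall>x\<in>A. \<forall>y\<in>B. (\<lambda>s::complex. U x y s) holomorphic_on C)"

lemma hol3_swap: "hol3 A B C U M \<Longrightarrow> hol3 B A C (\<lambda>x y. U y x) M"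
  by (auto simp: hol3_def)

lemma hol3_subset:
  assumes "hol3 A B C U M" "open A'" "open B'" "open C'" "A' \<subseteq> A" "B' \<subseteq> B" "C' \<subseteq> C"
  shows "hol3 A' B' C' U M"
  using assms unfolding hol3_def by (blast intro: holomorphic_on_subset)

lemma hol3_deriv:
  assumes U: "hol3 A B C U M" and "cball x0 r \<subseteq> A" "r > 0"
  shows "hol3 (ball x0 (r/2)) B C (\<lambda>x y s. deriv (\<lambda>x. U x y s) x) (2 * M / r)"
proof -
  have op: "open A" "open B" "open C" using U by (auto simp: hol3_def)
  have sub: "ball x0 (r/2) \<subseteq> A" using assms(2,3) by (force simp: subset_iff)
  have "norm (deriv (\<lambda>x. U x y s) x) \<le> 2 * M / r" if "x \<in> ball x0 (r/2)" "y \<in> B" "s \<in> C" for x y s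
  proof -
    \<comment> \<open>Points within r/2 of the centre keep a disc of radius r/2 inside the old one,
      whence the bound M/(r/2).\<close>
    have "cball x (r/2) \<subseteq> cball x0 r"
      using that(1) by (intro subsetI) (auto simp: dist_commute intro: order.trans[OF dist_triangle[of _ _ x]])
    then have "norm ((deriv ^^ 1) (\<lambda>x. U x y s) x) \<le> fact 1 * M / (r/2)^1"
      using U assms(2,3) that(2,3) by (intro Cauchy_bound_cball[where A=A]) (auto simp: hol3_def)
    then show ?thesis by (simp add: mult.commute)
  qed
  moreover have "(\<lambda>x. deriv (\<lambda>x. U x y s) x) holomorphic_on ball x0 (r/2)" if "y \<in> B" "s \<in> C" for y s
    using U that op sub by (auto simp: hol3_def intro!: holomorphic_on_subset[OF _ sub] holomorphic_deriv)
  moreover have "(\<lambda>y. deriv (\<lambda>x. U x y s) x) holomorphic_on B" if "x \<in> ball x0 (r/2)" "s \<in> C" for x s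
    by (rule partial_deriv_holomorphic(1)[where A=A and M=M]) (use U op sub that in \<open>auto simp: hol3_def\<close>)
  moreover have "(\<lambda>s. deriv (\<lambda>x. U x y s) x) holomorphic_on C" if "x \<in> ball x0 (r/2)" "y \<in> B" for x y
    by (rule partial_deriv_holomorphic(1)[where A=A and M=M]) (use U op sub that in \<open>auto simp: hol3_def\<close>)
  ultimately show ?thesis using op by (simp add: hol3_def)
qed

lemma hol3_infsum:
  assumes "\<And>j. j \<in> J \<Longrightarrow> hol3 A B C (U j) (M j)" and "M summable_on J" "open A" "open B" "open C"
  shows "hol3 A B C (\<lambda>x y s. \<Sum>\<^sub>\<infinity>j\<in>J. U j x y s) (\<Sum>\<^sub>\<infinity>j\<in>J. M j)"
proof -
  have "norm (\<Sum>\<^sub>\<infinity>j\<in>J. U j x y s) \<le> (\<Sum>\<^sub>\<infinity>j\<in>J. M j)" if "x \<in> A" "y \<in> B" "s \<in> C" for x y s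
  proof -
    have le: "norm (U j x y s) \<le> M j" if "j \<in> J" for j
      using assms(1)[OF that] \<open>x \<in> A\<close> \<open>y \<in> B\<close> \<open>s \<in> C\<close> unfolding hol3_def by blast
    have "(\<lambda>j. U j x y s) summable_on J"
      by (rule abs_summable_summable, rule summable_on_comparison_test[OF assms(2)]) (use le in auto)
    then show ?thesis
      by (rule norm_infsum_le[OF has_sum_infsum has_sum_infsum[OF assms(2)]]) (use le in auto)
  qed
  moreover have "(\<lambda>x. \<Sum>\<^sub>\<infinity>j\<in>J. U j x y s) holomorphic_on A" if "y \<in> B" "s \<in> C" for y s
    by (rule infsum_holomorphic(1)[where M=M, OF assms(3) _ _ assms(2)])
      (use assms(1) that in \<open>auto simp: hol3_def\<close>)
  moreover have "(\<lambda>y. \<Sum>\<^sub>\<infinity>j\<in>J. U j x y s) holomorphic_on B" if "x \<in> A" "s \<in> C" for x s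
    by (rule infsum_holomorphic(1)[where M=M, OF assms(4) _ _ assms(2)])
      (use assms(1) that in \<open>auto simp: hol3_def\<close>)
  moreover have "(\<lambda>s. \<Sum>\<^sub>\<infinity>j\<in>J. U j x y s) holomorphic_on C" if "x \<in> A" "y \<in> B" for x y
    by (rule infsum_holomorphic(1)[where M=M, OF assms(5) _ _ assms(2)])
      (use assms(1) that in \<open>auto simp: hol3_def\<close>)
  ultimately show ?thesis
    using assms(3-5) by (simp add: hol3_def)
qed

section \<open>Functions real-analytic in \<open>z\<close> and holomorphic in a parameter\<close>

lemma has_vector_derivative_real_restrict:
  assumes "f holomorphic_on A" "open A" "of_real x \<in> A" "\<And>t. of_real t \<in> A \<Longrightarrow> g t = f (of_real t)"
  shows "(g has_vector_derivative deriv f (of_real x)) (at x)"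
proof (rule has_vector_derivative_transform_within_open)
  show "((\<lambda>t. f (of_real t)) has_vector_derivative deriv f (of_real x)) (at x)"
    by (rule has_vector_derivative_real_field) (use assms in \<open>auto intro: holomorphic_derivI\<close>)
  show "open (of_real -` A :: real set)"
    by (rule open_vimage[OF assms(2)]) (intro continuous_intros)
qed (use assms in auto)

text \<open>Regularity is stated through local complexifications: the neighbourhoods, the extension
  \<open>U\<close> and its bound may change from point to point.\<close>

definition analytic_family :: "complex set \<Rightarrow> (complex \<Rightarrow> complex \<Rightarrow> complex) \<Rightarrow> bool" where
  "analytic_family S p \<longleftrightarrow> (\<forall>z0 s0. Im z0 > 0 \<longrightarrow> s0 \<in> S \<longrightarrow> (\<exists>A B C U M. hol3 A B C U M \<and>
     of_real (Re z0) \<in> A \<and> of_real (Im z0) \<in> B \<and> s0 \<in> C \<and> C \<subseteq> S \<and>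
     (\<forall>x y s. of_real x \<in> A \<longrightarrow> of_real y \<in> B \<longrightarrow> s \<in> C \<longrightarrow> p (Complex x y) s = U (of_real x) (of_real y) s)))"

lemma analytic_familyE:
  assumes "analytic_family S p" "Im z > 0" "s \<in> S"
  obtains A B C U M where "hol3 A B C U M" "of_real (Re z) \<in> A" "of_real (Im z) \<in> B" "s \<in> C" "C \<subseteq> S"
    "\<And>x y s. of_real x \<in> A \<Longrightarrow> of_real y \<in> B \<Longrightarrow> s \<in> C \<Longrightarrow> p (Complex x y) s = U (of_real x) (of_real y) s"
  using assms unfolding analytic_family_def by meson

lemma analytic_familyI:
  assumes "\<And>z s. Im z > 0 \<Longrightarrow> s \<in> S \<Longrightarrow> \<exists>A B C U M. hol3 A B C U M \<and>
     of_real (Re z) \<in> A \<and> of_real (Im z) \<in> B \<and> s \<in> C \<and> C \<subseteq> S \<and>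
     (\<forall>x y s. of_real x \<in> A \<longrightarrow> of_real y \<in> B \<longrightarrow> s \<in> C \<longrightarrow> p (Complex x y) s = U (of_real x) (of_real y) s)"
  shows "analytic_family S p"
  using assms unfolding analytic_family_def by blast

lemma hol3_dx:
  assumes U: "hol3 A B C U M" and xys: "of_real x \<in> A" "of_real y \<in> B" "s \<in> C"
    and eq: "\<And>x y s. of_real x \<in> A \<Longrightarrow> of_real y \<in> B \<Longrightarrow> s \<in> C \<Longrightarrow> p (Complex x y) s = U (of_real x) (of_real y) s"
  shows "((\<lambda>t. p (Complex t y) s) has_vector_derivative deriv (\<lambda>x. U x (of_real y) s) (of_real x)) (at x)"
    and "dx (\<lambda>w. p w s) (Complex x y) = deriv (\<lambda>x. U x (of_real y) s) (of_real x)"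
proof -
  show *: "((\<lambda>t. p (Complex t y) s) has_vector_derivative deriv (\<lambda>x. U x (of_real y) s) (of_real x)) (at x)"
    by (rule has_vector_derivative_real_restrict[where A=A]) (use assms in \<open>auto simp: hol3_def\<close>)
  then show "dx (\<lambda>w. p w s) (Complex x y) = deriv (\<lambda>x. U x (of_real y) s) (of_real x)"
    by (simp add: dx_def vector_derivative_at)
qed

lemma hol3_dy:
  assumes U: "hol3 A B C U M" and xys: "of_real x \<in> A" "of_real y \<in> B" "s \<in> C"
    and eq: "\<And>x y s. of_real x \<in> A \<Longrightarrow> of_real y \<in> B \<Longrightarrow> s \<in> C \<Longrightarrow> p (Complex x y) s = U (of_real x) (of_real y) s"
  shows "((\<lambda>t. p (Complex x t) s) has_vector_derivative deriv (\<lambda>y. U (of_real x) y s) (of_real y)) (at y)"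
    and "dy (\<lambda>w. p w s) (Complex x y) = deriv (\<lambda>y. U (of_real x) y s) (of_real y)"
proof -
  show *: "((\<lambda>t. p (Complex x t) s) has_vector_derivative deriv (\<lambda>y. U (of_real x) y s) (of_real y)) (at y)"
    by (rule has_vector_derivative_real_restrict[where A=B]) (use assms in \<open>auto simp: hol3_def\<close>)
  then show "dy (\<lambda>w. p w s) (Complex x y) = deriv (\<lambda>y. U (of_real x) y s) (of_real y)"
    by (simp add: dy_def vector_derivative_at)
qed

lemma analytic_family_holomorphic:
  assumes "analytic_family S p" "Im z > 0"
  shows "p z holomorphic_on S"
proof -
  have "p z field_differentiable at s" if sS: "s \<in> S" for s
  proof -
    obtain A B C U M where *: "hol3 A B C U M" "of_real (Re z) \<in> A" "of_real (Im z) \<in> B" "s \<in> C"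
      "\<And>x y s. of_real x \<in> A \<Longrightarrow> of_real y \<in> B \<Longrightarrow> s \<in> C \<Longrightarrow> p (Complex x y) s = U (of_real x) (of_real y) s"
      using analytic_familyE[OF assms sS] by metis
    have "p z holomorphic_on C \<longleftrightarrow> U (of_real (Re z)) (of_real (Im z)) holomorphic_on C"
      by (rule holomorphic_cong) (use *(5)[of "Re z" "Im z"] *(2-4) in auto)
    then have "p z holomorphic_on C" "open C" using *(1-3) by (auto simp: hol3_def)
    then show ?thesis using *(4) holomorphic_on_imp_differentiable_at by blast
  qed
  then show ?thesis
    using field_differentiable_at_within holomorphic_on_def by blast
qed

lemma analytic_family_dx:
  assumes "analytic_family S p"
  shows "analytic_family S (\<lambda>z s. dx (\<lambda>w. p w s) z)"
proof (rule analytic_familyI)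
  fix z s assume zs: "Im z > 0" "s \<in> S"
  obtain A B C U M where *: "hol3 A B C U M" "of_real (Re z) \<in> A" "of_real (Im z) \<in> B" "s \<in> C" "C \<subseteq> S"
    "\<And>x y s. of_real x \<in> A \<Longrightarrow> of_real y \<in> B \<Longrightarrow> s \<in> C \<Longrightarrow> p (Complex x y) s = U (of_real x) (of_real y) s"
    using analytic_familyE[OF assms zs] by metis
  obtain r where r: "r > 0" "cball (of_real (Re z)) r \<subseteq> A"
    using *(1,2) unfolding hol3_def by (meson open_contains_cball)
  have sub: "ball (of_real (Re z)) (r/2) \<subseteq> A" using r by (force simp: subset_iff)
  show "\<exists>A B C U M. hol3 A B C U M \<and>
     of_real (Re z) \<in> A \<and> of_real (Im z) \<in> B \<and> s \<in> C \<and> C \<subseteq> S \<and>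
     (\<forall>x y s. of_real x \<in> A \<longrightarrow> of_real y \<in> B \<longrightarrow> s \<in> C \<longrightarrow> dx (\<lambda>w. p w s) (Complex x y) = U (of_real x) (of_real y) s)"
    using hol3_deriv[OF *(1) r(2,1)] * r hol3_dx(2)[OF *(1) _ _ _ *(6)] sub
    by (intro exI[of _ "ball (of_real (Re z)) (r/2)"] exI[of _ B] exI[of _ C]
        exI[of _ "\<lambda>x y s. deriv (\<lambda>x. U x y s) x"] exI[of _ "2 * M / r"]) (auto simp: subset_iff)
qed

lemma analytic_family_dy:
  assumes "analytic_family S p"
  shows "analytic_family S (\<lambda>z s. dy (\<lambda>w. p w s) z)"
proof (rule analytic_familyI)
  fix z s assume zs: "Im z > 0" "s \<in> S"
  obtain A B C U M where *: "hol3 A B C U M" "of_real (Re z) \<in> A" "of_real (Im z) \<in> B" "s \<in> C" "C \<subseteq> S"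
    "\<And>x y s. of_real x \<in> A \<Longrightarrow> of_real y \<in> B \<Longrightarrow> s \<in> C \<Longrightarrow> p (Complex x y) s = U (of_real x) (of_real y) s"
    using analytic_familyE[OF assms zs] by metis
  obtain r where r: "r > 0" "cball (of_real (Im z)) r \<subseteq> B"
    using *(1,3) unfolding hol3_def by (meson open_contains_cball)
  have sub: "ball (of_real (Im z)) (r/2) \<subseteq> B" using r by (force simp: subset_iff)
  show "\<exists>A B C U M. hol3 A B C U M \<and>
     of_real (Re z) \<in> A \<and> of_real (Im z) \<in> B \<and> s \<in> C \<and> C \<subseteq> S \<and>
     (\<forall>x y s. of_real x \<in> A \<longrightarrow> of_real y \<in> B \<longrightarrow> s \<in> C \<longrightarrow> dy (\<lambda>w. p w s) (Complex x y) = U (of_real x) (of_real y) s)"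
    using hol3_swap[OF hol3_deriv[OF hol3_swap[OF *(1)] r(2,1)]] * r hol3_dy(2)[OF *(1) _ _ _ *(6)] sub
    by (intro exI[of _ "ball (of_real (Im z)) (r/2)"] exI[of _ A] exI[of _ C]
        exI[of _ "\<lambda>x y s. deriv (\<lambda>y. U x y s) y"] exI[of _ "2 * M / r"]) (auto simp: subset_iff)
qed

lemma analytic_family_has_dx:
  assumes "analytic_family S p" "Im z > 0" "s \<in> S"
  shows "((\<lambda>t. p (Complex t (Im z)) s) has_vector_derivative dx (\<lambda>w. p w s) z) (at (Re z))"
proof -
  obtain A B C U M where *: "hol3 A B C U M" "of_real (Re z) \<in> A" "of_real (Im z) \<in> B" "s \<in> C" "C \<subseteq> S"
    "\<And>x y s. of_real x \<in> A \<Longrightarrow> of_real y \<in> B \<Longrightarrow> s \<in> C \<Longrightarrow> p (Complex x y) s = U (of_real x) (of_real y) s"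
    using analytic_familyE[OF assms] by metis
  show ?thesis using hol3_dx[OF *(1-4) *(6)] by simp
qed

lemma analytic_family_has_dy:
  assumes "analytic_family S p" "Im z > 0" "s \<in> S"
  shows "((\<lambda>t. p (Complex (Re z) t) s) has_vector_derivative dy (\<lambda>w. p w s) z) (at (Im z))"
proof -
  obtain A B C U M where *: "hol3 A B C U M" "of_real (Re z) \<in> A" "of_real (Im z) \<in> B" "s \<in> C" "C \<subseteq> S"
    "\<And>x y s. of_real x \<in> A \<Longrightarrow> of_real y \<in> B \<Longrightarrow> s \<in> C \<Longrightarrow> p (Complex x y) s = U (of_real x) (of_real y) s"
    using analytic_familyE[OF assms] by metis
  show ?thesis using hol3_dy[OF *(1-4) *(6)] by simp
qed

text \<open>For the complexification the mixed derivatives agree by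
  \<open>partial_deriv_holomorphic\<close> with n = 1, and restriction to real coordinates preserves
  this.\<close>

lemma analytic_family_dx_dy:
  assumes "analytic_family S p" "Im z > 0" "s \<in> S"
  shows "dx (\<lambda>w. dy (\<lambda>v. p v s) w) z = dy (\<lambda>w. dx (\<lambda>v. p v s) w) z"
proof -
  obtain A B C U M where *: "hol3 A B C U M" "of_real (Re z) \<in> A" "of_real (Im z) \<in> B" "s \<in> C" "C \<subseteq> S"
    and eq: "\<And>x y s. of_real x \<in> A \<Longrightarrow> of_real y \<in> B \<Longrightarrow> s \<in> C \<Longrightarrow> p (Complex x y) s = U (of_real x) (of_real y) s"
    using analytic_familyE[OF assms] by metis
  let ?x = "complex_of_real (Re z)" and ?y = "complex_of_real (Im z)"
  have op: "open A" "open B" "open C" using *(1) by (auto simp: hol3_def)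
  have D: "((\<lambda>x. (deriv ^^ 1) (\<lambda>y. U x y s) ?y) has_field_derivative
      (deriv ^^ 1) (\<lambda>y. deriv (\<lambda>x. U x y s) ?x) ?y) (at x)" if "x = ?x" for x
    unfolding that
    by (rule partial_deriv_holomorphic(2)[where A=A and B=B and M=M]) (use * in \<open>auto simp: hol3_def\<close>)
  have "((\<lambda>t. (deriv ^^ 1) (\<lambda>y. U (of_real t) y s) ?y) has_vector_derivative
      (deriv ^^ 1) (\<lambda>y. deriv (\<lambda>x. U x y s) ?x) ?y) (at (Re z))"
    by (rule has_vector_derivative_real_field) (use D in auto)
  then have "((\<lambda>t. dy (\<lambda>v. p v s) (Complex t (Im z))) has_vector_derivative
      (deriv ^^ 1) (\<lambda>y. deriv (\<lambda>x. U x y s) ?x) ?y) (at (Re z))"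
    by (rule has_vector_derivative_transform_within_open[where S="of_real -` A"])
      (use * op eq in \<open>auto intro!: open_vimage continuous_intros simp: hol3_dy(2)[OF *(1) _ _ _ eq]\<close>)
  then have 1: "dx (\<lambda>w. dy (\<lambda>v. p v s) w) z = deriv (\<lambda>y. deriv (\<lambda>x. U x y s) ?x) ?y"
    by (simp add: dx_def vector_derivative_at)
  have hol: "(\<lambda>y. deriv (\<lambda>x. U x y s) ?x) holomorphic_on B"
    by (rule partial_deriv_holomorphic(1)[where A=A and M=M]) (use * op in \<open>auto simp: hol3_def\<close>)
  have "((\<lambda>t. dx (\<lambda>v. p v s) (Complex (Re z) t)) has_vector_derivative
      deriv (\<lambda>y. deriv (\<lambda>x. U x y s) ?x) ?y) (at (Im z))"
    by (rule has_vector_derivative_real_restrict[OF hol op(2)])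
      (use * hol3_dx(2)[OF *(1) _ _ _ eq] in auto)
  then show ?thesis unfolding 1
    by (simp add: dy_def vector_derivative_at)
qed

text \<open>Applied to the pair (x, s), \<open>partial_deriv_holomorphic\<close> lets an
  s-derivative of any order pass through the x-derivative. This is how an identity between functions
  of s becomes one between Taylor coefficients.\<close>

lemma analytic_family_higher_deriv_dx:
  assumes "analytic_family S p" "Im z > 0" "s \<in> S"
  shows "((\<lambda>t. (deriv ^^ n) (p (Complex t (Im z))) s) has_vector_derivative
            (deriv ^^ n) (\<lambda>s. dx (\<lambda>w. p w s) z) s) (at (Re z))"
proof -
  obtain A B C U M where *: "hol3 A B C U M" "of_real (Re z) \<in> A" "of_real (Im z) \<in> B" "s \<in> C" "C \<subseteq> S"
    and eq: "\<And>x y s. of_real x \<in> A \<Longrightarrow> of_real y \<in> B \<Longrightarrow> s \<in> C \<Longrightarrow> p (Complex x y) s = U (of_real x) (of_real y) s"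
    using analytic_familyE[OF assms] by metis
  let ?x = "complex_of_real (Re z)" and ?y = "complex_of_real (Im z)"
  have op: "open A" "open B" "open C" using *(1) by (auto simp: hol3_def)
  have "((\<lambda>x. (deriv ^^ n) (U x ?y) s) has_field_derivative
      (deriv ^^ n) (\<lambda>s. deriv (\<lambda>x. U x ?y s) ?x) s) (at ?x)"
    by (rule partial_deriv_holomorphic(2)[where A=A and B=C and M=M]) (use * in \<open>auto simp: hol3_def\<close>)
  then have "((\<lambda>t. (deriv ^^ n) (U (of_real t) ?y) s) has_vector_derivative
      (deriv ^^ n) (\<lambda>s. deriv (\<lambda>x. U x ?y s) ?x) s) (at (Re z))"
    by (rule has_vector_derivative_real_field)
  also have "(deriv ^^ n) (\<lambda>s. deriv (\<lambda>x. U x ?y s) ?x) s = (deriv ^^ n) (\<lambda>s. dx (\<lambda>w. p w s) z) s"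
  proof (rule higher_deriv_cong_ev)
    show "\<forall>\<^sub>F s in nhds s. deriv (\<lambda>x. U x ?y s) ?x = dx (\<lambda>w. p w s) z"
      unfolding eventually_nhds
      using * op hol3_dx(2)[OF *(1-3) _ eq] by (intro exI[of _ C]) auto
  qed simp
  finally show ?thesis
  proof (rule has_vector_derivative_transform_within_open)
    show "open (of_real -` A :: real set)"
      using op by (auto intro!: open_vimage continuous_intros)
    show "(deriv ^^ n) (U (of_real t) ?y) s = (deriv ^^ n) (p (Complex t (Im z))) s" if "t \<in> of_real -` A" for t
      using that * op eq
      by (intro higher_deriv_cong_ev) (auto simp: eventually_nhds intro!: exI[of _ C])
  qed (use * in auto)
qed

lemma analytic_family_higher_deriv_dy:
  assumes "analytic_family S p" "Im z > 0" "s \<in> S"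
  shows "((\<lambda>t. (deriv ^^ n) (p (Complex (Re z) t)) s) has_vector_derivative
            (deriv ^^ n) (\<lambda>s. dy (\<lambda>w. p w s) z) s) (at (Im z))"
proof -
  obtain A B C U M where *: "hol3 A B C U M" "of_real (Re z) \<in> A" "of_real (Im z) \<in> B" "s \<in> C" "C \<subseteq> S"
    and eq: "\<And>x y s. of_real x \<in> A \<Longrightarrow> of_real y \<in> B \<Longrightarrow> s \<in> C \<Longrightarrow> p (Complex x y) s = U (of_real x) (of_real y) s"
    using analytic_familyE[OF assms] by metis
  let ?x = "complex_of_real (Re z)" and ?y = "complex_of_real (Im z)"
  have op: "open A" "open B" "open C" using *(1) by (auto simp: hol3_def)
  have "((\<lambda>y. (deriv ^^ n) (U ?x y) s) has_field_derivative
      (deriv ^^ n) (\<lambda>s. deriv (\<lambda>y. U ?x y s) ?y) s) (at ?y)"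
    by (rule partial_deriv_holomorphic(2)[where A=B and B=C and M=M]) (use * in \<open>auto simp: hol3_def\<close>)
  then have "((\<lambda>t. (deriv ^^ n) (U ?x (of_real t)) s) has_vector_derivative
      (deriv ^^ n) (\<lambda>s. deriv (\<lambda>y. U ?x y s) ?y) s) (at (Im z))"
    by (rule has_vector_derivative_real_field)
  also have "(deriv ^^ n) (\<lambda>s. deriv (\<lambda>y. U ?x y s) ?y) s = (deriv ^^ n) (\<lambda>s. dy (\<lambda>w. p w s) z) s"
  proof (rule higher_deriv_cong_ev)
    show "\<forall>\<^sub>F s in nhds s. deriv (\<lambda>y. U ?x y s) ?y = dy (\<lambda>w. p w s) z"
      unfolding eventually_nhds
      using * op hol3_dy(2)[OF *(1-3) _ eq] by (intro exI[of _ C]) auto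
  qed simp
  finally show ?thesis
  proof (rule has_vector_derivative_transform_within_open)
    show "open (of_real -` B :: real set)"
      using op by (auto intro!: open_vimage continuous_intros)
    show "(deriv ^^ n) (U ?x (of_real t)) s = (deriv ^^ n) (p (Complex (Re z) t)) s" if "t \<in> of_real -` B" for t
      using that * op eq
      by (intro higher_deriv_cong_ev) (auto simp: eventually_nhds intro!: exI[of _ C])
  qed (use * in auto)
qed

lemma analytic_family_binop:
  assumes p: "analytic_family S p" and q: "analytic_family S q"
    and hol: "\<And>f g A. f holomorphic_on A \<Longrightarrow> g holomorphic_on A \<Longrightarrow> (\<lambda>x. F (f x) (g x)) holomorphic_on A"
    and bd: "\<And>M N. \<exists>K. \<forall>a b. norm a \<le> M \<longrightarrow> norm b \<le> N \<longrightarrow> norm (F a b) \<le> K"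
  shows "analytic_family S (\<lambda>z s. F (p z s) (q z s))"
proof (rule analytic_familyI)
  fix z s assume zs: "Im z > 0" "s \<in> S"
  obtain A B C U M where 1: "hol3 A B C U M" "of_real (Re z) \<in> A" "of_real (Im z) \<in> B" "s \<in> C" "C \<subseteq> S"
    "\<And>x y s. of_real x \<in> A \<Longrightarrow> of_real y \<in> B \<Longrightarrow> s \<in> C \<Longrightarrow> p (Complex x y) s = U (of_real x) (of_real y) s"
    using analytic_familyE[OF p zs] by metis
  obtain A' B' C' U' M' where 2: "hol3 A' B' C' U' M'" "of_real (Re z) \<in> A'" "of_real (Im z) \<in> B'" "s \<in> C'" "C' \<subseteq> S"
    "\<And>x y s. of_real x \<in> A' \<Longrightarrow> of_real y \<in> B' \<Longrightarrow> s \<in> C' \<Longrightarrow> q (Complex x y) s = U' (of_real x) (of_real y) s"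
    using analytic_familyE[OF q zs] by metis
  obtain K where K: "\<And>a b. norm a \<le> M \<Longrightarrow> norm b \<le> M' \<Longrightarrow> norm (F a b) \<le> K"
    using bd[of M M'] by blast
  let ?A = "A \<inter> A'" and ?B = "B \<inter> B'" and ?C = "C \<inter> C'"
  have op: "open ?A" "open ?B" "open ?C" using 1(1) 2(1) by (auto simp: hol3_def)
  have h: "hol3 ?A ?B ?C U M" "hol3 ?A ?B ?C U' M'"
    using hol3_subset[OF 1(1) op] hol3_subset[OF 2(1) op] by auto
  have "hol3 ?A ?B ?C (\<lambda>x y s. F (U x y s) (U' x y s)) K"
    using h K hol unfolding hol3_def by auto
  then show "\<exists>A B C U M. hol3 A B C U M \<and>
     of_real (Re z) \<in> A \<and> of_real (Im z) \<in> B \<and> s \<in> C \<and> C \<subseteq> S \<and>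
     (\<forall>x y s. of_real x \<in> A \<longrightarrow> of_real y \<in> B \<longrightarrow> s \<in> C \<longrightarrow>
        F (p (Complex x y) s) (q (Complex x y) s) = U (of_real x) (of_real y) s)"
    using 1 2 by (intro exI[of _ ?A] exI[of _ ?B] exI[of _ ?C]
        exI[of _ "\<lambda>x y s. F (U x y s) (U' x y s)"] exI[of _ K]) auto
qed

lemma analytic_family_add:
  assumes "analytic_family S p" "analytic_family S q"
  shows "analytic_family S (\<lambda>z s. p z s + q z s)"
proof (rule analytic_family_binop[OF assms])
  show "\<exists>K. \<forall>a b. norm a \<le> M \<longrightarrow> norm b \<le> N \<longrightarrow> norm (a + b :: complex) \<le> K" for M N
    by (intro exI[of _ "M + N"] allI impI norm_triangle_le add_mono)
qed (intro holomorphic_intros)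

lemma analytic_family_mult:
  assumes "analytic_family S p" "analytic_family S q"
  shows "analytic_family S (\<lambda>z s. p z s * q z s)"
proof (rule analytic_family_binop[OF assms])
  show "\<exists>K. \<forall>a b. norm a \<le> M \<longrightarrow> norm b \<le> N \<longrightarrow> norm (a * b :: complex) \<le> K" for M N
    by (intro exI[of _ "M * N"] allI impI) (auto simp: norm_mult intro!: mult_mono intro: order.trans[OF norm_ge_zero])
qed (intro holomorphic_intros)

lemma analytic_family_param:
  assumes "f holomorphic_on S" "open S"
  shows "analytic_family S (\<lambda>z s. f s)"
proof (rule analytic_familyI)
  fix z :: complex and s assume "s \<in> S"
  then obtain r where r: "r > 0" "cball s r \<subseteq> S"
    using assms(2) open_contains_cball by blast
  have "compact (f ` cball s r)"
    using assms(1) r by (intro compact_continuous_image) (auto intro: holomorphic_on_imp_continuous_on holomorphic_on_subset)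
  then obtain M where M: "\<And>t. t \<in> cball s r \<Longrightarrow> norm (f t) \<le> M"
    by (meson bounded_iff compact_imp_bounded imageI)
  have "f holomorphic_on ball s r" using assms(1) r by (meson ball_subset_cball holomorphic_on_subset order_trans)
  then have "hol3 UNIV UNIV (ball s r) (\<lambda>x y. f) M"
    using M by (auto simp: hol3_def)
  then show "\<exists>A B C U M. hol3 A B C U M \<and>
     of_real (Re z) \<in> A \<and> of_real (Im z) \<in> B \<and> s \<in> C \<and> C \<subseteq> S \<and>
     (\<forall>x y s. of_real x \<in> A \<longrightarrow> of_real y \<in> B \<longrightarrow> s \<in> C \<longrightarrow> f s = U (of_real x) (of_real y) s)"
    using r by (intro exI[of _ UNIV] exI[of _ "ball s r"] exI[of _ "\<lambda>x y. f"] exI[of _ M]) (auto simp: subset_iff)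
qed

lemma open_image_cnj: "open A \<Longrightarrow> open (cnj ` A)"
proof -
  assume "open A"
  then have "open (cnj -` A)" by (rule open_vimage) (intro continuous_intros)
  moreover have "cnj -` A = cnj ` A" by (auto simp: image_iff) (metis complex_cnj_cnj)
  ultimately show ?thesis by simp
qed

lemma holomorphic_on_cnj_cnj:
  assumes "f holomorphic_on A" "open A"
  shows "(\<lambda>x. cnj (f (cnj x))) holomorphic_on (cnj ` A)"
proof -
  have "(cnj \<circ> f \<circ> cnj) holomorphic_on (cnj ` A)"
    using assms by (intro holomorphic_on_compose_cnj_cnj) (auto simp: image_image open_image_cnj)
  then show ?thesis by (simp add: o_def)
qed

text \<open>Conjugation alone destroys holomorphy; conjugating the arguments of the extension as
  well restores it and leaves real x and y fixed. Hence the conjugate of s in the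
  conclusion.\<close>

lemma analytic_family_cnj:
  assumes "analytic_family S p" and S: "cnj ` S \<subseteq> S"
  shows "analytic_family S (\<lambda>z s. cnj (p z (cnj s)))"
proof (rule analytic_familyI)
  fix z s assume zs: "Im z > 0" "s \<in> S"
  then have "cnj s \<in> S" using S by auto
  then obtain A B C U M where 1: "hol3 A B C U M" "of_real (Re z) \<in> A" "of_real (Im z) \<in> B" "cnj s \<in> C" "C \<subseteq> S"
    "\<And>x y s. of_real x \<in> A \<Longrightarrow> of_real y \<in> B \<Longrightarrow> s \<in> C \<Longrightarrow> p (Complex x y) s = U (of_real x) (of_real y) s"
    using analytic_familyE[OF assms(1) zs(1)] by metis
  have op: "open A" "open B" "open C" using 1(1) by (auto simp: hol3_def)
  let ?U = "\<lambda>x y s. cnj (U (cnj x) (cnj y) (cnj s))"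
  have h: "hol3 (cnj ` A) (cnj ` B) (cnj ` C) ?U M"
    using 1(1) op unfolding hol3_def
    by (auto simp: open_image_cnj intro!: holomorphic_on_cnj_cnj)
  have mem: "w \<in> cnj ` X \<longleftrightarrow> cnj w \<in> X" for w X
    by (metis complex_cnj_cnj image_iff)
  have "cnj ` C \<subseteq> S" using 1(5) S by blast
  then show "\<exists>A B C U M. hol3 A B C U M \<and>
     of_real (Re z) \<in> A \<and> of_real (Im z) \<in> B \<and> s \<in> C \<and> C \<subseteq> S \<and>
     (\<forall>x y s. of_real x \<in> A \<longrightarrow> of_real y \<in> B \<longrightarrow> s \<in> C \<longrightarrow> cnj (p (Complex x y) (cnj s)) = U (of_real x) (of_real y) s)"
    using 1 h by (intro exI[of _ "cnj ` A"] exI[of _ "cnj ` B"] exI[of _ "cnj ` C"] exI[of _ ?U] exI[of _ M])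
      (simp add: mem)
qed

lemma dx_cong: "Im z > 0 \<Longrightarrow> (\<And>w. Im w > 0 \<Longrightarrow> f w = g w) \<Longrightarrow> dx f z = dx g z"
  by (simp add: dx_def)

text \<open>A vertical line leaves the upper half-plane, so here, unlike for \<open>dx\<close>, the
  two restrictions agree only near Im z and the locality of the derivative is used.\<close>

lemma dy_cong:
  assumes "Im z > 0" "\<And>w. Im w > 0 \<Longrightarrow> f w = g w"
  shows "dy f z = dy g z"
  unfolding dy_def
proof (rule vector_derivative_cong_eq)
  have "eventually (\<lambda>t. t > 0) (nhds (Im z))"
    using assms(1) by (intro eventually_nhds_in_open[of "{0<..}", simplified]) auto
  then show "\<forall>\<^sub>F t in nhds (Im z). t \<in> UNIV \<longrightarrow> f (Complex (Re z) t) = g (Complex (Re z) t)"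
    by eventually_elim (use assms in auto)
qed auto

section \<open>Kloosterman sums\<close>

definition add_char :: "nat \<Rightarrow> int \<Rightarrow> complex" where
  "add_char c n = cis (2 * pi * of_int n / of_nat c)"

lemma norm_add_char [simp]: "norm (add_char c n) = 1"
  by (simp add: add_char_def)

lemma add_char_add: "add_char c (m + n) = add_char c m * add_char c n"
  by (simp add: add_char_def cis_mult ring_distribs add_divide_distrib)

lemma cnj_add_char: "cnj (add_char c n) = add_char c (- n)"
  by (simp add: add_char_def cis_cnj)

lemma add_char_of_nat_mult: "add_char c (int k * n) = add_char c n ^ k"
  by (simp add: add_char_def Complex.DeMoivre mult_ac)

lemma add_char_eq_1:
  assumes "c > 0"
  shows "add_char c n = 1 \<longleftrightarrow> int c dvd n"
proof -
  have "add_char c n = 1 \<longleftrightarrow> (\<exists>k::int. 2 * pi * of_int n / of_nat c = of_int (2 * k) * pi)"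
    by (simp add: add_char_def cis_conv_exp exp_eq_1)
  also have "\<dots> \<longleftrightarrow> (\<exists>k::int. real_of_int n = real_of_int (k * int c))"
    using assms by (simp add: field_simps)
  also have "\<dots> \<longleftrightarrow> int c dvd n"
    by (auto simp: dvd_def mult.commute simp del: of_int_mult)
  finally show ?thesis .
qed

lemma add_char_cong:
  assumes "c > 0" "[m = n] (mod int c)"
  shows "add_char c m = add_char c n"
proof -
  have "add_char c (m - n) = 1"
    using assms by (simp add: add_char_eq_1 cong_iff_dvd_diff)
  then show ?thesis using add_char_add[of c "m - n" n] by simp
qed

lemma sum_residues_eq: "(\<Sum>u\<in>{0..<int c}. f u) = (\<Sum>k<c. f (int k))"
  by (rule sum.reindex_bij_witness[of _ int nat]) auto

lemma sum_add_char:
  assumes "c > 0"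
  shows "(\<Sum>u\<in>{0..<int c}. add_char c (u * n)) = (if int c dvd n then of_nat c else 0)"
proof (cases "int c dvd n")
  case True
  then have "add_char c (u * n) = 1" for u
    using assms by (simp add: add_char_eq_1)
  then show ?thesis using True by simp
next
  case False
  have "(\<Sum>u\<in>{0..<int c}. add_char c (u * n)) = (\<Sum>k<c. add_char c n ^ k)"
    by (simp add: sum_residues_eq add_char_of_nat_mult)
  also have "\<dots> = (add_char c n ^ c - 1) / (add_char c n - 1)"
    using False assms by (intro geometric_sum) (simp add: add_char_eq_1)
  also have "add_char c n ^ c = 1"
    using assms by (simp flip: add_char_of_nat_mult add: add_char_eq_1)
  finally show ?thesis using False by simp
qed

text \<open>Carrying the inverse along as a second component makes the symmetry between x and its
  inverse a swap of coordinates. For c = 1 the set is {(0, 0)}.\<close>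

definition unit_pairs :: "nat \<Rightarrow> (int \<times> int) set" where
  "unit_pairs c = {(x, x'). x \<in> {0..<int c} \<and> x' \<in> {0..<int c} \<and> [x * x' = 1] (mod int c)}"

definition kloosterman :: "nat \<Rightarrow> int \<Rightarrow> int \<Rightarrow> complex" where
  "kloosterman c u v = (\<Sum>(x, x')\<in>unit_pairs c. add_char c (u * x' + v * x))"

lemma finite_unit_pairs [simp, intro]: "finite (unit_pairs c)"
  by (rule finite_subset[of _ "{0..<int c} \<times> {0..<int c}"]) (auto simp: unit_pairs_def)

lemma unit_pairs_swap: "(x, x') \<in> unit_pairs c \<Longrightarrow> (x', x) \<in> unit_pairs c"
  by (auto simp: unit_pairs_def mult.commute)

lemma unit_pairs_cong: "(x, x') \<in> unit_pairs c \<Longrightarrow> [x * x' = 1] (mod int c)"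
  by (auto simp: unit_pairs_def)

lemma cong_residue_eq:
  "[x = y] (mod int c) \<Longrightarrow> x \<in> {0..<int c} \<Longrightarrow> y \<in> {0..<int c} \<Longrightarrow> x = y"
  by (auto simp: cong_def)

lemma unit_pairs_unique:
  assumes "(x, x') \<in> unit_pairs c" "(x, y') \<in> unit_pairs c"
  shows "x' = y'"
proof (rule cong_residue_eq[of _ _ c])
  have 1: "[x * x' = 1] (mod int c)" "[x * y' = 1] (mod int c)"
    using assms by (auto simp: unit_pairs_def)
  have "[x' * (x * y') = x' * 1] (mod int c)" "[y' * (x * x') = y' * 1] (mod int c)"
    by (rule cong_scalar_left, fact)+
  then show "[x' = y'] (mod int c)"
    by (metis cong_sym_eq cong_trans mult.assoc mult.commute mult.right_neutral)
qed (use assms in \<open>auto simp: unit_pairs_def\<close>)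

lemma inj_on_fst_unit_pairs: "inj_on fst (unit_pairs c)"
  by (auto intro!: inj_onI dest: unit_pairs_unique)

lemma unit_pairs_nonempty: "c > 0 \<Longrightarrow> unit_pairs c \<noteq> {}"
proof -
  assume "c > 0"
  then have "(1 mod int c, 1 mod int c) \<in> unit_pairs c"
    by (auto simp: unit_pairs_def cong_def mod_mult_eq)
  then show ?thesis by blast
qed

lemma unit_pairs_act_in:
  assumes "(a, a') \<in> unit_pairs c" "(x, x') \<in> unit_pairs c" "c > 0"
  shows "((a * x) mod int c, (a' * x') mod int c) \<in> unit_pairs c"
proof -
  have "[(a * a') * (x * x') = 1 * 1] (mod int c)"
    using assms by (intro cong_mult) (auto simp: unit_pairs_def)
  then have "[(a * x) * (a' * x') = 1] (mod int c)" by (simp add: mult_ac)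
  then have "[((a * x) mod int c) * ((a' * x') mod int c) = 1] (mod int c)"
    by (simp add: cong_def mod_mult_eq)
  then show ?thesis using assms(3) by (auto simp: unit_pairs_def)
qed

lemma unit_pairs_act_inverse:
  assumes "(a, a') \<in> unit_pairs c" "(x, x') \<in> unit_pairs c"
  shows "(a' * ((a * x) mod int c)) mod int c = x"
proof -
  have "[(a * a') * x = 1 * x] (mod int c)"
    using assms by (intro cong_mult) (auto simp: unit_pairs_def)
  then have "[a' * ((a * x) mod int c) = x] (mod int c)"
    by (simp add: cong_def mod_mult_right_eq mult_ac)
  then show ?thesis using assms by (auto simp: cong_def unit_pairs_def)
qed

lemma bij_betw_unit_pairs_act:
  assumes "(a, a') \<in> unit_pairs c" "c > 0"
  shows "bij_betw (\<lambda>(x, x'). ((a * x) mod int c, (a' * x') mod int c)) (unit_pairs c) (unit_pairs c)"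
proof (rule bij_betwI[where g = "\<lambda>(x, x'). ((a' * x) mod int c, (a * x') mod int c)"])
  have sw: "(a', a) \<in> unit_pairs c" using assms(1) by (rule unit_pairs_swap)
  note inv = unit_pairs_act_inverse[OF assms(1)] unit_pairs_act_inverse[OF sw]
    unit_pairs_act_inverse[OF assms(1) unit_pairs_swap] unit_pairs_act_inverse[OF sw unit_pairs_swap]
  show "(case (case p of (x, x') \<Rightarrow> ((a * x) mod int c, (a' * x') mod int c)) of
      (x, x') \<Rightarrow> ((a' * x) mod int c, (a * x') mod int c)) = p" if "p \<in> unit_pairs c" for p
    using inv that by (cases p) simp
  show "(case (case p of (x, x') \<Rightarrow> ((a' * x) mod int c, (a * x') mod int c)) of
      (x, x') \<Rightarrow> ((a * x) mod int c, (a' * x') mod int c)) = p" if "p \<in> unit_pairs c" for p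
    using inv that by (cases p) simp
qed (use assms unit_pairs_swap[OF assms(1)] in \<open>auto simp: unit_pairs_act_in\<close>)

text \<open>Substitute x by a' x. The Kloosterman sum is thus constant along the orbit of its
  parameters under the unit group, so a moment over all parameters can bound a single sum.\<close>

lemma kloosterman_twist:
  assumes "(a, a') \<in> unit_pairs c" "c > 0"
  shows "kloosterman c (u * a) (v * a') = kloosterman c u v"
proof -
  have "kloosterman c u v = (\<Sum>p\<in>unit_pairs c. case p of (x, x') \<Rightarrow> add_char c (u * x' + v * x))"
    by (simp add: kloosterman_def)
  also have "\<dots> = (\<Sum>p\<in>unit_pairs c. case (case p of (x, x') \<Rightarrow> ((a' * x) mod int c, (a * x') mod int c)) of
       (x, x') \<Rightarrow> add_char c (u * x' + v * x))"
    by (rule sum.reindex_bij_betw[symmetric], rule bij_betw_unit_pairs_act)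
      (use assms unit_pairs_swap in auto)
  also have "\<dots> = (\<Sum>(x, x')\<in>unit_pairs c. add_char c (u * a * x' + v * a' * x))"
  proof (intro sum.cong refl, clarify)
    fix x x' :: int
    have "[u * (a * x' mod int c) + v * (a' * x mod int c) = u * a * x' + v * a' * x] (mod int c)"
      unfolding mult.assoc by (intro cong_add cong_scalar_left) (auto simp: cong_def)
    then show "add_char c (u * (a * x' mod int c) + v * (a' * x mod int c)) = add_char c (u * a * x' + v * a' * x)"
      using assms(2) by (rule add_char_cong[rotated])
  qed
  also have "\<dots> = kloosterman c (u * a) (v * a')" by (simp add: kloosterman_def)
  finally show ?thesis ..
qed

lemma kloosterman_mod:
  assumes "c > 0"
  shows "kloosterman c (u mod int c) (v mod int c) = kloosterman c u v"
  unfolding kloosterman_def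
  by (intro sum.cong refl, clarify, rule add_char_cong[OF assms])
    (rule cong_add; rule cong_scalar_right; simp add: cong_def)

section \<open>The fourth moment and a count of congruences\<close>

definition quad_set :: "nat \<Rightarrow> ((int \<times> int) \<times> (int \<times> int) \<times> (int \<times> int) \<times> (int \<times> int)) set" where
  "quad_set c = {(p1, p2, p3, p4) \<in> unit_pairs c \<times> unit_pairs c \<times> unit_pairs c \<times> unit_pairs c.
     int c dvd (fst p1 + fst p2 - fst p3 - fst p4) \<and> int c dvd (snd p1 + snd p2 - snd p3 - snd p4)}"

text \<open>Expand |K|^4 over four units. Summing over u and v, orthogonality of characters leaves
  exactly the quadruples that satisfy both congruences, each with weight c^2.\<close>

lemma kloosterman_fourth_moment:
  assumes c: "c > 0"
  shows "(\<Sum>u\<in>{0..<int c}. \<Sum>v\<in>{0..<int c}. norm (kloosterman c u v) ^ 4) = real c ^ 2 * card (quad_set c)"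
proof -
  let ?V = "unit_pairs c" and ?R = "{0..<int c}"
  let ?Q = "?V \<times> ?V \<times> ?V \<times> ?V"
  define a :: "(int \<times> int) \<times> (int \<times> int) \<times> (int \<times> int) \<times> (int \<times> int) \<Rightarrow> int" where "a = (\<lambda>(p1, p2, p3, p4). snd p1 + snd p2 - snd p3 - snd p4 :: int)"
  define b :: "(int \<times> int) \<times> (int \<times> int) \<times> (int \<times> int) \<times> (int \<times> int) \<Rightarrow> int" where "b = (\<lambda>(p1, p2, p3, p4). fst p1 + fst p2 - fst p3 - fst p4 :: int)"
  have finQ: "finite ?Q" by auto
  have K4: "complex_of_real (norm (kloosterman c u v) ^ 4) = (\<Sum>q\<in>?Q. add_char c (u * a q) * add_char c (v * b q))" for u v
  proof -
    have K: "kloosterman c u v = (\<Sum>p\<in>?V. add_char c (u * snd p + v * fst p))"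
      by (simp add: kloosterman_def case_prod_unfold)
    define k' where "k' = cnj (kloosterman c u v)"
    have K': "k' = (\<Sum>p\<in>?V. add_char c (- (u * snd p + v * fst p)))"
      by (simp only: k'_def K cnj_sum cnj_add_char)
    have "complex_of_real (norm (kloosterman c u v) ^ 4) = (kloosterman c u v * cnj (kloosterman c u v))\<^sup>2"
      by (simp add: complex_norm_square[symmetric] flip: power_mult)
    also have "\<dots> = kloosterman c u v * (kloosterman c u v * (k' * k'))"
      by (simp add: power2_eq_square mult_ac k'_def)
    also have "\<dots> = (\<Sum>q\<in>?Q. case q of (p1, p2, p3, p4) \<Rightarrow> add_char c (u * snd p1 + v * fst p1) *
         (add_char c (u * snd p2 + v * fst p2) * (add_char c (- (u * snd p3 + v * fst p3)) * add_char c (- (u * snd p4 + v * fst p4)))))"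
      unfolding K K' sum_product sum.cartesian_product by (simp only: case_prod_unfold)
    also have "\<dots> = (\<Sum>q\<in>?Q. add_char c (u * a q) * add_char c (v * b q))"
      by (intro sum.cong refl) (auto simp: a_def b_def algebra_simps simp flip: add_char_add)
    finally show ?thesis .
  qed
  have "complex_of_real (\<Sum>u\<in>?R. \<Sum>v\<in>?R. norm (kloosterman c u v) ^ 4) =
      (\<Sum>u\<in>?R. \<Sum>v\<in>?R. \<Sum>q\<in>?Q. add_char c (u * a q) * add_char c (v * b q))"
    by (simp only: of_real_sum K4)
  also have "\<dots> = (\<Sum>u\<in>?R. \<Sum>q\<in>?Q. \<Sum>v\<in>?R. add_char c (u * a q) * add_char c (v * b q))"
    by (intro sum.cong refl sum.swap)
  also have "\<dots> = (\<Sum>q\<in>?Q. \<Sum>u\<in>?R. \<Sum>v\<in>?R. add_char c (u * a q) * add_char c (v * b q))"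
    by (rule sum.swap)
  also have "\<dots> = (\<Sum>q\<in>?Q. (\<Sum>u\<in>?R. add_char c (u * a q)) * (\<Sum>v\<in>?R. add_char c (v * b q)))"
    by (simp only: sum_product)
  also have "\<dots> = (\<Sum>q\<in>?Q. if q \<in> quad_set c then of_nat c ^ 2 else 0)"
    unfolding sum_add_char[OF c]
    by (intro sum.cong refl) (auto simp: quad_set_def a_def b_def power2_eq_square)
  also have "\<dots> = (\<Sum>q\<in>?Q \<inter> quad_set c. of_nat c ^ 2)"
    by (rule sum.inter_restrict[symmetric, OF finQ])
  also have "?Q \<inter> quad_set c = quad_set c" by (auto simp: quad_set_def)
  finally have "complex_of_real (\<Sum>u\<in>?R. \<Sum>v\<in>?R. norm (kloosterman c u v) ^ 4) = complex_of_real (real c ^ 2 * card (quad_set c))"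
    by (simp add: mult.commute)
  then show ?thesis by (simp only: of_real_eq_iff)
qed

text \<open>Their number is the divisor function d_3(c). They index the ways in which c can divide a
  product of three factors.\<close>

definition triples :: "nat \<Rightarrow> (nat \<times> nat \<times> nat) set" where
  "triples c = {(d1, d2, d3). d1 * d2 * d3 = c}"

lemma finite_triples: "c > 0 \<Longrightarrow> finite (triples c)"
proof (rule finite_subset)
  assume "c > 0"
  then show "triples c \<subseteq> {..c} \<times> {..c} \<times> {..c}"
    by (auto simp: triples_def intro!: dvd_imp_le)
qed auto

lemma card_residue_class:
  assumes "d dvd c" "c > 0"
  shows "card {x \<in> {0..<int c}. [x = a] (mod int d)} = c div d"
proof -
  obtain k where k: "c = d * k" using assms by auto
  have d: "d > 0" using assms k by auto
  have "bij_betw (\<lambda>j. int d * int j + a mod int d) {..<k} {x \<in> {0..<int c}. [x = a] (mod int d)}"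
  proof (rule bij_betwI[where g = "\<lambda>x. nat (x div int d)"])
    show "(\<lambda>j. int d * int j + a mod int d) \<in> {..<k} \<rightarrow> {x \<in> {0..<int c}. [x = a] (mod int d)}"
    proof (rule funcsetI)
      fix j assume "j \<in> {..<k}"
      then have "int d * (int j + 1) \<le> int d * int k" using d by (intro mult_left_mono) auto
      moreover have "a mod int d < int d" using d by simp
      ultimately have "int d * int j + a mod int d < int d * int k" by (simp add: algebra_simps)
      then show "int d * int j + a mod int d \<in> {x \<in> {0..<int c}. [x = a] (mod int d)}"
        using d k by (auto simp: cong_def)
    qed
    show "(\<lambda>x. nat (x div int d)) \<in> {x \<in> {0..<int c}. [x = a] (mod int d)} \<rightarrow> {..<k}"
    proof (rule funcsetI)
      fix x assume "x \<in> {x \<in> {0..<int c}. [x = a] (mod int d)}"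
      then have x: "0 \<le> x" "x < int d * int k" using k by auto
      have "int d * (x div int d) + x mod int d = x" "x mod int d \<ge> 0" using d by auto
      then have "int d * (x div int d) < int d * int k" using x by linarith
      then have "x div int d < int k" using d by simp
      then show "nat (x div int d) \<in> {..<k}"
        using x d by (auto simp: nat_less_iff pos_imp_zdiv_nonneg_iff)
    qed
    show "nat ((int d * int j + a mod int d) div int d) = j" for j
      using d by simp
    show "int d * int (nat (x div int d)) + a mod int d = x" if "x \<in> {x \<in> {0..<int c}. [x = a] (mod int d)}" for x
      using that d by (auto simp: cong_def pos_imp_zdiv_nonneg_iff) (metis mult_div_mod_eq)
  qed
  then have "card {x \<in> {0..<int c}. [x = a] (mod int d)} = k"
    using bij_betw_same_card by fastforce
  then show ?thesis using k d by simp
qed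

text \<open>Two solutions differ by a multiple of both moduli, hence of the lcm: either there is
  none or all lie in one class modulo the lcm.\<close>

lemma card_two_residue_classes:
  assumes "d dvd c" "e dvd c" "c > 0"
  shows "card {x \<in> {0..<int c}. [x = a] (mod int d) \<and> [x = b] (mod int e)} \<le> c div lcm d e"
proof (cases "{x \<in> {0..<int c}. [x = a] (mod int d) \<and> [x = b] (mod int e)} = {}")
  case False
  then obtain y where y: "[y = a] (mod int d)" "[y = b] (mod int e)" by auto
  have sub: "{x \<in> {0..<int c}. [x = a] (mod int d) \<and> [x = b] (mod int e)} \<subseteq> {x \<in> {0..<int c}. [x = y] (mod int (lcm d e))}"
  proof
    fix x assume "x \<in> {x \<in> {0..<int c}. [x = a] (mod int d) \<and> [x = b] (mod int e)}"
    then have x: "[x = a] (mod int d)" "[x = b] (mod int e)" "x \<in> {0..<int c}" by auto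
    then have "[x = y] (mod int d)" "[x = y] (mod int e)"
      using y by (metis cong_sym cong_trans)+
    then have "int d dvd (x - y)" "int e dvd (x - y)" by (auto simp: cong_iff_dvd_diff)
    then have "lcm (int d) (int e) dvd (x - y)" by (rule lcm_least)
    then show "x \<in> {x \<in> {0..<int c}. [x = y] (mod int (lcm d e))}"
      using x by (auto simp: cong_iff_dvd_diff lcm_int_int_eq)
  qed
  have "card {x \<in> {0..<int c}. [x = a] (mod int d) \<and> [x = b] (mod int e)} \<le> card {x \<in> {0..<int c}. [x = y] (mod int (lcm d e))}"
    by (rule card_mono[OF _ sub], rule finite_subset[of _ "{0..<int c}"]) auto
  also have "\<dots> = c div lcm d e"
    using assms by (intro card_residue_class) auto
  finally show ?thesis .
qed (simp only: card.empty)

lemma gcd_le_sqrt: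
  assumes "d1 * d2 * d3 = c" "c > 0"
  shows "real (gcd d1 d3) \<le> sqrt (real c)"
proof -
  have pos: "d1 > 0" "d2 > 0" "d3 > 0" using assms by (auto intro: gr0I)
  have "gcd d1 d3 * gcd d1 d3 \<le> d1 * d3"
    using pos by (intro mult_le_mono gcd_le1_nat gcd_le2_nat) auto
  also have "\<dots> \<le> d1 * d3 * d2" using pos by simp
  also have "\<dots> = c" using assms(1) by (simp add: mult_ac)
  finally have "real (gcd d1 d3) ^ 2 \<le> real c"
    unfolding power2_eq_square by (simp flip: of_nat_mult)
  then show ?thesis by (rule real_le_rsqrt)
qed

text \<open>Choose the unit x3; then x1 has c/d2 values, and x2 lies in one class modulo d1 and one
  modulo d3, which leaves at most c/lcm(d1, d3) values. The product is c gcd(d1, d3), and gcd(d1,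
  d3)^2 <= d1 d3 <= c.\<close>

lemma card_triple_system:
  assumes "d1 * d2 * d3 = c" "c > 0"
  shows "real (card {(x1, x2, x3). x1 \<in> {0..<int c} \<and> x2 \<in> {0..<int c} \<and> x3 \<in> fst ` unit_pairs c \<and>
     int d1 dvd x1 + x2 \<and> int d2 dvd x3 - x1 \<and> int d3 dvd x2 - x3}) \<le> card (unit_pairs c) * (c * sqrt c)"
    (is "real (card ?T) \<le> _")
proof -
  let ?X3 = "fst ` unit_pairs c"
  define X1 where "X1 = (\<lambda>x3. {x \<in> {0..<int c}. [x = x3] (mod int d2)})"
  define X2 where "X2 = (\<lambda>x3 x1. {x \<in> {0..<int c}. [x = - x1] (mod int d1) \<and> [x = x3] (mod int d3)})"
  have pos: "d1 > 0" "d2 > 0" "d3 > 0" using assms by (auto intro: gr0I)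
  have dvd: "d1 dvd c" "d2 dvd c" "d3 dvd c" using assms(1) by auto
  have fin: "finite (X1 x3)" "finite (X2 x3 x1)" for x1 x3
    by (auto simp: X1_def X2_def intro!: finite_subset[OF _ finite_atLeastLessThan_int[of 0 "int c"]])
  let ?S = "SIGMA x3:?X3. SIGMA x1:X1 x3. X2 x3 x1"
  have inj: "inj_on (\<lambda>(x1, x2, x3). (x3, x1, x2)) ?T" by (auto intro!: inj_onI)
  have sub: "(\<lambda>(x1, x2, x3). (x3, x1, x2)) ` ?T \<subseteq> ?S"
    by (auto simp: X1_def X2_def cong_iff_dvd_diff add.commute dvd_diff_commute)
  have "card ?T \<le> card ?S"
    by (rule card_inj_on_le[OF inj sub]) (auto simp: fin)
  also have "card ?S = (\<Sum>x3\<in>?X3. \<Sum>x1\<in>X1 x3. card (X2 x3 x1))"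
    by (simp add: fin)
  also have "\<dots> \<le> (\<Sum>x3\<in>?X3. \<Sum>x1\<in>X1 x3. c div lcm d1 d3)"
    unfolding X2_def using dvd assms(2) by (intro sum_mono card_two_residue_classes)
  also have "\<dots> = (\<Sum>x3\<in>?X3. c div d2 * (c div lcm d1 d3))"
    using card_residue_class[OF dvd(2) assms(2)] by (simp add: X1_def)
  also have "\<dots> = card (unit_pairs c) * (c div d2 * (c div lcm d1 d3))"
    by (simp add: card_image inj_on_fst_unit_pairs)
  also have "c div d2 * (c div lcm d1 d3) = c * gcd d1 d3"
  proof -
    have 1: "c div d2 = d1 * d3" using assms(1) pos by (metis mult.assoc mult.commute nonzero_mult_div_cancel_right neq0_conv)
    have l: "lcm d1 d3 > 0" using pos by (simp add: lcm_pos_nat)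
    have "c = lcm d1 d3 * (gcd d1 d3 * d2)"
      using assms(1) prod_gcd_lcm_nat[of d1 d3] by (metis mult.assoc mult.commute)
    then have 2: "c div lcm d1 d3 = gcd d1 d3 * d2" using l by (metis nonzero_mult_div_cancel_left neq0_conv)
    show ?thesis unfolding 1 2 using assms(1) by (simp add: mult_ac)
  qed
  finally have "card ?T \<le> card (unit_pairs c) * (c * gcd d1 d3)" .
  then have "real (card ?T) \<le> real (card (unit_pairs c)) * (real c * real (gcd d1 d3))"
    by (simp flip: of_nat_mult)
  also have "\<dots> \<le> card (unit_pairs c) * (c * sqrt c)"
    using gcd_le_sqrt[OF assms] by (intro mult_left_mono) auto
  finally show ?thesis .
qed

text \<open>Clear denominators in the congruence for the inverses, then eliminate the fourth variable with the
  other congruence.\<close>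
lemma quad_set_dvd:
  assumes "(p1, p2, p3, p4) \<in> quad_set c"
  shows "int c dvd (fst p1 + fst p2) * ((fst p3 - fst p1) * (fst p2 - fst p3))"
proof -
  obtain x1 y1 x2 y2 x3 y3 x4 y4 where p: "p1 = (x1, y1)" "p2 = (x2, y2)" "p3 = (x3, y3)" "p4 = (x4, y4)"
    by (metis prod.exhaust)
  have q: "[x1 * y1 = 1] (mod int c)" "[x2 * y2 = 1] (mod int c)" "[x3 * y3 = 1] (mod int c)" "[x4 * y4 = 1] (mod int c)"
    "int c dvd x1 + x2 - x3 - x4" "int c dvd y1 + y2 - y3 - y4"
    using assms by (auto simp: quad_set_def unit_pairs_def p)
  then obtain k1 k2 k3 k4 k5 k6 where k: "x1 * y1 = 1 + int c * k1" "x2 * y2 = 1 + int c * k2"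
    "x3 * y3 = 1 + int c * k3" "x4 * y4 = 1 + int c * k4" "x1 + x2 - x3 - x4 = int c * k5" "y1 + y2 - y3 - y4 = int c * k6"
    by (auto simp: cong_iff_lin dvd_def) (metis cong_iff_lin cong_sym)
  have x4: "x4 = x1 + x2 - x3 - int c * k5" using k(5) by linarith
  have "int c dvd (x1 + x2) * (x3 * x4 - x1 * x2)"
  proof -
    have "x1 * x2 * x3 * x4 * (y1 + y2 - y3 - y4) =
      (x1 * y1) * x2 * x3 * x4 + (x2 * y2) * x1 * x3 * x4 - (x3 * y3) * x1 * x2 * x4 - (x4 * y4) * x1 * x2 * x3"
      by (simp add: algebra_simps)
    also have "\<dots> = (x1 + x2) * x3 * x4 - (x3 + x4) * (x1 * x2) + int c *
        (k1 * x2 * x3 * x4 + k2 * x1 * x3 * x4 - k3 * x1 * x2 * x4 - k4 * x1 * x2 * x3)"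
      unfolding k by (simp add: algebra_simps)
    finally have "(x1 + x2) * (x3 * x4 - x1 * x2) = int c * (x1 * x2 * x3 * x4 * k6 - k5 * (x1 * x2)
        - (k1 * x2 * x3 * x4 + k2 * x1 * x3 * x4 - k3 * x1 * x2 * x4 - k4 * x1 * x2 * x3))"
      using k(5,6) by algebra
    then show ?thesis by simp
  qed
  moreover have "(x1 + x2) * ((x3 - x1) * (x2 - x3)) = (x1 + x2) * (x3 * x4 - x1 * x2) + int c * (k5 * x3 * (x1 + x2))"
    unfolding x4 by (simp add: algebra_simps)
  ultimately show ?thesis by (simp add: p)
qed

text \<open>The congruence for the sums determines the fourth unit from the other three. Since c
  divides the product in \<open>quad_set_dvd\<close>, it splits as d1 d2 d3 with each part dividing
  one factor; \<open>card_triple_system\<close> bounds every splitting and the union bound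
  contributes d_3(c).\<close>

lemma card_quad_set:
  assumes c: "c > 0"
  shows "real (card (quad_set c)) \<le> card (unit_pairs c) * (c * sqrt c) * card (triples c)"
proof -
  let ?T = "\<lambda>(d1, d2, d3). {(x1, x2, x3). x1 \<in> {0..<int c} \<and> x2 \<in> {0..<int c} \<and> x3 \<in> fst ` unit_pairs c \<and>
     int d1 dvd x1 + x2 \<and> int d2 dvd x3 - x1 \<and> int d3 dvd x2 - x3}"
  let ?h = "\<lambda>(p1, p2, p3, p4). (fst p1, fst p2, fst p3) :: int \<times> int \<times> int"
  have inj: "inj_on ?h (quad_set c)"
  proof (rule inj_onI, clarsimp)
    fix x1 y1 x2 y2 x3 y3 x4 y4 y1' y2' y3' x4' y4'
    assume q: "((x1, y1), (x2, y2), (x3, y3), (x4, y4)) \<in> quad_set c"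
      "((x1, y1'), (x2, y2'), (x3, y3'), (x4', y4')) \<in> quad_set c"
    then have "int c dvd x1 + x2 - x3 - x4" "int c dvd x1 + x2 - x3 - x4'" by (auto simp: quad_set_def)
    then have "int c dvd (x1 + x2 - x3 - x4') - (x1 + x2 - x3 - x4)" by (rule dvd_diff[rotated])
    then have "[x4 = x4'] (mod int c)" by (simp add: cong_iff_dvd_diff)
    then have "x4 = x4'" by (rule cong_residue_eq) (use q in \<open>auto simp: quad_set_def unit_pairs_def\<close>)
    then show "y1 = y1' \<and> y2 = y2' \<and> y3 = y3' \<and> x4 = x4' \<and> y4 = y4'"
      using q by (auto simp: quad_set_def dest: unit_pairs_unique)
  qed
  have sub: "?h ` quad_set c \<subseteq> (\<Union>d\<in>triples c. ?T d)"
  proof (clarify)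
    fix x1 y1 x2 y2 x3 y3 x4 y4
    assume q: "((x1, y1), (x2, y2), (x3, y3), (x4, y4)) \<in> quad_set c"
    have "int c dvd (x1 + x2) * ((x3 - x1) * (x2 - x3))" using quad_set_dvd[OF q] by simp
    then obtain d1 e where d1: "int c = d1 * e" "d1 dvd x1 + x2" "e dvd (x3 - x1) * (x2 - x3)"
      using division_decomp by blast
    then obtain d2 d3 where d2: "e = d2 * d3" "d2 dvd x3 - x1" "d3 dvd x2 - x3"
      using division_decomp by blast
    \<comment> \<open>The splitting is into integers of unknown sign; absolute values keep the
      divisibilities and still multiply to c.\<close>
    have "nat \<bar>d1\<bar> * nat \<bar>d2\<bar> * nat \<bar>d3\<bar> = c"
      using d1(1) d2(1) by (simp add: abs_mult[symmetric] nat_abs_mult_distrib[symmetric] mult.assoc)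
    then have "(nat \<bar>d1\<bar>, nat \<bar>d2\<bar>, nat \<bar>d3\<bar>) \<in> triples c" by (simp add: triples_def)
    moreover have "(x1, y1) \<in> unit_pairs c" "(x2, y2) \<in> unit_pairs c" "(x3, y3) \<in> unit_pairs c"
      using q by (auto simp: quad_set_def)
    then have "(x1, x2, x3) \<in> ?T (nat \<bar>d1\<bar>, nat \<bar>d2\<bar>, nat \<bar>d3\<bar>)"
      using d1 d2 image_eqI[of x3 fst "(x3, y3)" "unit_pairs c"] by (auto simp: unit_pairs_def)
    ultimately show "(fst (x1, y1), fst (x2, y2), fst (x3, y3)) \<in> (\<Union>d\<in>triples c. ?T d)"
      unfolding fst_conv by (rule UN_I)
  qed
  have finT: "finite (?T d)" for d
    by (rule finite_subset[of _ "{0..<int c} \<times> {0..<int c} \<times> fst ` unit_pairs c"]) (auto split: prod.splits)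
  have "card (quad_set c) \<le> card (\<Union>d\<in>triples c. ?T d)"
    by (rule card_inj_on_le[OF inj sub]) (use finite_triples[OF c] finT in blast)
  also have "\<dots> \<le> (\<Sum>d\<in>triples c. card (?T d))"
    by (rule card_UN_le[OF finite_triples[OF c]])
  finally have "real (card (quad_set c)) \<le> real (\<Sum>d\<in>triples c. card (?T d))" by (simp only: of_nat_le_iff)
  also have "\<dots> \<le> (\<Sum>d\<in>triples c. card (unit_pairs c) * (c * sqrt c))"
    unfolding of_nat_sum
  proof (rule sum_mono)
    fix d assume "d \<in> triples c"
    then obtain d1 d2 d3 where d: "d = (d1, d2, d3)" "d1 * d2 * d3 = c" by (auto simp: triples_def)
    show "real (card (?T d)) \<le> card (unit_pairs c) * (c * sqrt c)"
      using card_triple_system[OF d(2) c] by (simp add: d(1))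
  qed
  finally show ?thesis by (simp add: mult_ac)
qed

text \<open>The solutions of m x = u modulo c lie in one class modulo c/g with g = gcd(m, c). That
  class has g residues, and g <= |m|.\<close>

lemma card_mult_fibre:
  assumes c: "c > 0" and m: "m \<noteq> 0"
  shows "card {p \<in> unit_pairs c. (m * fst p) mod int c = u} \<le> nat \<bar>m\<bar>"
proof (cases "{p \<in> unit_pairs c. (m * fst p) mod int c = u} = {}")
  case False
  then obtain a where a: "(m * a) mod int c = u" by blast
  define g where "g = gcd (nat \<bar>m\<bar>) c"
  have g: "g > 0" using c by (simp add: g_def)
  obtain e where e: "c = g * e" unfolding g_def by (metis dvdE gcd_dvd2)
  have e0: "e > 0" using e c by (auto intro: gr0I)
  have sub: "fst ` {p \<in> unit_pairs c. (m * fst p) mod int c = u} \<subseteq> {x \<in> {0..<int c}. [x = a] (mod int e)}"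
  proof (rule image_subsetI, elim CollectE conjE)
    fix p assume p: "p \<in> unit_pairs c" and "m * fst p mod int c = u"
    obtain x y where xyp: "p = (x, y)" by force
    have xy: "(x, y) \<in> unit_pairs c" "m * x mod int c = u" using p \<open>m * fst p mod int c = u\<close> xyp by auto
    then have "[m * x = m * a] (mod int c)" using a xy by (simp add: cong_def)
    then have "int c dvd m * (x - a)" by (simp add: cong_iff_dvd_diff right_diff_distrib)
    then have 1: "c dvd nat \<bar>m\<bar> * nat \<bar>x - a\<bar>"
      by (simp flip: nat_abs_mult_distrib)
    have "c dvd g * nat \<bar>x - a\<bar>"
    proof -
      have "c dvd gcd (nat \<bar>m\<bar> * nat \<bar>x - a\<bar>) (c * nat \<bar>x - a\<bar>)" using 1 by simp
      also have "\<dots> = g * nat \<bar>x - a\<bar>" by (metis g_def gcd_mult_distrib_nat mult.commute)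
      finally show ?thesis .
    qed
    then have "e dvd nat \<bar>x - a\<bar>" using e g by simp
    then have "int e dvd x - a" by simp
    then show "fst p \<in> {x \<in> {0..<int c}. [x = a] (mod int e)}"
      using xy xyp by (auto simp: cong_iff_dvd_diff unit_pairs_def)
  qed
  have inj: "inj_on fst {p \<in> unit_pairs c. (m * fst p) mod int c = u}"
    by (rule inj_on_subset[OF inj_on_fst_unit_pairs]) auto
  have "card {p \<in> unit_pairs c. (m * fst p) mod int c = u} \<le> card {x \<in> {0..<int c}. [x = a] (mod int e)}"
    by (rule card_inj_on_le[OF inj sub], rule finite_subset[of _ "{0..<int c}"]) auto
  also have "\<dots> = g"
    using card_residue_class[of e c a] e e0 c by simp
  also have "g \<le> nat \<bar>m\<bar>" unfolding g_def using m by (intro gcd_le1_nat) auto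
  finally show ?thesis .
qed (simp only: card.empty)

text \<open>By \<open>kloosterman_twist\<close> the value at (m, n) recurs at (m x, n x') for every
  unit x, and by \<open>card_mult_fibre\<close> each parameter pair is hit at most |m| times. So the
  number of units times |K|^4 is at most |m| times the fourth moment, and the number of units
  cancels against the same factor in \<open>card_quad_set\<close>.\<close>

lemma kloosterman_bound:
  assumes c: "c > 0" and m: "m \<noteq> 0"
  shows "norm (kloosterman c m n) ^ 4 \<le> \<bar>m\<bar> * (real c ^ 3 * sqrt c * card (triples c))"
proof -
  let ?V = "unit_pairs c" and ?R = "{0..<int c}"
  define F where "F = (\<lambda>(u, v). norm (kloosterman c u v) ^ 4)"
  define h where "h = (\<lambda>p::int \<times> int. ((m * fst p) mod int c, (n * snd p) mod int c))"
  have hR: "h ` ?V \<subseteq> ?R \<times> ?R" using c by (auto simp: h_def)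
  have F0: "F w \<ge> 0" for w by (auto simp: F_def split: prod.splits)
  have F: "F (h p) = norm (kloosterman c m n) ^ 4" if "p \<in> ?V" for p
    using kloosterman_twist[of "fst p" "snd p" c m n] that c
    by (simp add: F_def h_def kloosterman_mod)
  have "card ?V * norm (kloosterman c m n) ^ 4 = (\<Sum>p\<in>?V. F (h p))"
    by (simp add: F)
  also have "\<dots> = (\<Sum>w\<in>?R \<times> ?R. real (card {p \<in> ?V. h p = w}) * F w)"
    by (rule sum_fun_comp[OF _ _ hR]) auto
  also have "\<dots> \<le> (\<Sum>w\<in>?R \<times> ?R. real (nat \<bar>m\<bar>) * F w)"
  proof (intro sum_mono mult_right_mono F0)
    fix w
    have "card {p \<in> ?V. h p = w} \<le> card {p \<in> ?V. (m * fst p) mod int c = fst w}"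
      by (intro card_mono) (auto simp: h_def)
    then show "real (card {p \<in> ?V. h p = w}) \<le> real (nat \<bar>m\<bar>)"
      using card_mult_fibre[OF c m, of "fst w"] by linarith
  qed
  also have "\<dots> = \<bar>m\<bar> * (\<Sum>w\<in>?R \<times> ?R. F w)" by (simp add: sum_distrib_left)
  also have "(\<Sum>w\<in>?R \<times> ?R. F w) = real c ^ 2 * card (quad_set c)"
    unfolding F_def sum.cartesian_product[symmetric] by (rule kloosterman_fourth_moment[OF c])
  also have "real_of_int \<bar>m\<bar> * (real c ^ 2 * card (quad_set c))
     \<le> real_of_int \<bar>m\<bar> * (real c ^ 2 * (card ?V * (c * sqrt c) * card (triples c)))"
    by (intro mult_left_mono card_quad_set[OF c]) auto
  also have "\<dots> = card ?V * (\<bar>m\<bar> * (real c ^ 3 * sqrt c * card (triples c)))"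
    by (simp add: power2_eq_square power3_eq_cube)
  finally have "real (card ?V) * norm (kloosterman c m n) ^ 4 \<le> real (card ?V) * (\<bar>m\<bar> * (real c ^ 3 * sqrt c * card (triples c)))" .
  moreover have "card ?V > 0" using unit_pairs_nonempty[OF c] by (simp add: card_gt_0_iff)
  ultimately show ?thesis by simp
qed

section \<open>Completion of smooth sums over units\<close>

lemma sum_inverse_squares_le: "(\<Sum>k=1..n. 1 / (real k)\<^sup>2) \<le> 2 - 1 / real (max n 1)"
proof (induction n)
  case (Suc n)
  show ?case
  proof (cases "n = 0")
    case False
    have "1 / (real (Suc n))\<^sup>2 \<le> 1 / (real n * real (Suc n))"
      unfolding power2_eq_square using False by (intro divide_left_mono mult_right_mono) auto
    also have "\<dots> = 1 / real n - 1 / real (Suc n)" using False by (simp add: field_simps)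
    finally have "1 / (real (Suc n))\<^sup>2 \<le> 1 / real n - 1 / real (Suc n)" .
    moreover have "max n 1 = n" "max (Suc n) 1 = Suc n" using False by auto
    ultimately show ?thesis using Suc by simp
  qed auto
qed auto

text \<open>The cubic Taylor bound gives x - x^3/6 <= sin x, and x^2 <= 3 on this interval because
  pi/2 < 1.6.\<close>

lemma sin_ge_half: assumes "0 \<le> x" "x \<le> pi / 2" shows "x / 2 \<le> sin x"
proof -
  have "\<bar>sin x - (\<Sum>m<3. sin_coeff m * x ^ m)\<bar> \<le> inverse (fact 3) * \<bar>x\<bar> ^ 3"
    by (rule Maclaurin_sin_bound)
  moreover have "(\<Sum>m<3. sin_coeff m * x ^ m) = x" by (simp add: sin_coeff_def eval_nat_numeral)
  ultimately have "x - x ^ 3 / 6 \<le> sin x"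
    using assms by (simp add: abs_if fact_numeral split: if_splits)
  moreover have "x ^ 3 \<le> 3 * x"
  proof -
    have "x \<le> 1.6" using assms pi_approx by simp
    then have "x * x \<le> 1.6 * 1.6" using assms by (intro mult_mono) auto
    then have "x * (x * x) \<le> x * 3" using assms by (intro mult_left_mono) auto
    then show ?thesis by (simp add: power3_eq_cube mult_ac)
  qed
  ultimately show ?thesis by linarith
qed

text \<open>The left side is 2 sin(pi t) with t = n/c. The lower bound t (1 - t) is symmetric in t
  and 1 - t and, unlike the sine, splits into partial fractions when inverted.\<close>

lemma norm_add_char_minus_1:
  assumes "0 < n" "n < c"
  shows "norm (add_char c (int n) - 1) \<ge> 2 * (n / c) * (1 - n / c)"
proof -
  define t where "t = real n / real c"
  have t: "0 < t" "t < 1" using assms by (auto simp: t_def)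
  have "norm (add_char c (int n) - 1) ^ 2 = (2 * sin (pi * t)) ^ 2"
  proof -
    have "norm (add_char c (int n) - 1) ^ 2 = (cos (2 * (pi * t)) - 1)\<^sup>2 + (sin (2 * (pi * t)))\<^sup>2"
      by (simp add: add_char_def cmod_power2 t_def mult.assoc)
    also have "\<dots> = (2 * sin (pi * t)) ^ 2"
    proof -
      have "(cos (pi * t))\<^sup>2 = 1 - (sin (pi * t))\<^sup>2" by (simp add: cos_squared_eq)
      then show ?thesis
        unfolding sin_double cos_double by algebra
    qed
    finally show ?thesis .
  qed
  then have eq: "norm (add_char c (int n) - 1) = 2 * sin (pi * t)"
    using t by (intro power2_eq_imp_eq[OF _ norm_ge_zero]) (auto intro!: sin_ge_zero mult_left_le)
  have "sin (pi * t) \<ge> t * (1 - t)"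
  proof (cases "t \<le> 1/2")
    case True
    have "pi * t / 2 \<le> sin (pi * t)" using t True by (intro sin_ge_half) auto
    moreover have "t * (1 - t) \<le> t * 1" using t by (intro mult_left_mono) auto
    moreover have "t * 2 \<le> t * pi" using t pi_gt3 by (intro mult_left_mono) auto
    ultimately show ?thesis by (simp add: mult.commute)
  next
    case False
    have "pi * (1 - t) / 2 \<le> sin (pi * (1 - t))" using t False by (intro sin_ge_half) auto
    moreover have "sin (pi * (1 - t)) = sin (pi * t)" by (simp add: right_diff_distrib)
    moreover have "t * (1 - t) \<le> 1 * (1 - t)" using t by (intro mult_right_mono) auto
    moreover have "2 * (1 - t) \<le> pi * (1 - t)" using t pi_gt3 by (intro mult_right_mono) auto
    ultimately show ?thesis by simp
  qed
  then show ?thesis unfolding eq t_def by simp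
qed

lemma sum_periodic_shift:
  fixes f :: "int \<Rightarrow> complex"
  assumes "c > 0" "\<And>x. f (x + int c) = f x"
  shows "(\<Sum>y\<in>{0..<int c}. f (y + 1)) = (\<Sum>y\<in>{0..<int c}. f y)"
proof -
  obtain d where c: "c = Suc d" using assms(1) gr0_implies_Suc by blast
  have "(\<Sum>y\<in>{0..<int c}. f (y + 1)) = (\<Sum>k<Suc d. f (int (Suc k)))"
    unfolding sum_residues_eq c by (simp add: add.commute)
  also have "\<dots> = (\<Sum>k<d. f (int (Suc k))) + f (0 + int c)" by (simp add: c)
  also have "f (0 + int c) = f 0" by (rule assms(2))
  also have "(\<Sum>k<d. f (int (Suc k))) + f 0 = (\<Sum>k<Suc d. f (int k))"
    by (subst sum.lessThan_Suc_shift) (simp add: add.commute)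
  also have "\<dots> = (\<Sum>y\<in>{0..<int c}. f y)" by (simp only: sum_residues_eq c)
  finally show ?thesis .
qed

text \<open>Expand \<open>g\<close> into additive characters modulo \<open>c\<close>; the bound on the second difference
  makes its Fourier coefficients summable uniformly in \<open>c\<close>.\<close>
lemma twisted_unit_sum_bound:
  fixes g :: "int \<Rightarrow> complex"
  assumes c: "c > 0" and per: "\<And>x. g (x + int c) = g x"
    and M: "\<And>x. norm (g x) \<le> M"
    and B: "\<And>x. norm (g (x + 2) - 2 * g (x + 1) + g x) \<le> B / (real c)\<^sup>2"
    and K: "\<And>n. norm (kloosterman c m n) \<le> K"
  shows "norm (\<Sum>(x, x')\<in>unit_pairs c. add_char c (m * x') * g x) \<le> K * (M + 2 * B)"
proof -
  let ?R = "{0..<int c}"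
  define G where "G = (\<lambda>n. \<Sum>y\<in>?R. g y * add_char c (- (n * y)))"
  have K0: "K \<ge> 0" using K[of 0] norm_ge_zero order_trans by blast
  have B0: "B \<ge> 0" using B[of 0] c by (smt (verit) norm_ge_zero divide_neg_pos of_nat_0_less_iff zero_less_power)
  have inv: "g x = (\<Sum>n\<in>?R. G n * add_char c (n * x)) / c" if "x \<in> ?R" for x
  proof -
    have "(\<Sum>n\<in>?R. G n * add_char c (n * x)) = (\<Sum>n\<in>?R. \<Sum>y\<in>?R. g y * add_char c (n * (x - y)))"
      unfolding G_def sum_distrib_right
      by (intro sum.cong refl) (simp add: algebra_simps flip: add_char_add)
    also have "\<dots> = (\<Sum>y\<in>?R. \<Sum>n\<in>?R. g y * add_char c (n * (x - y)))" by (rule sum.swap)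
    also have "\<dots> = (\<Sum>y\<in>?R. g y * (if int c dvd x - y then of_nat c else 0))"
      by (simp only: sum_distrib_left[symmetric] sum_add_char[OF c])
    also have "\<dots> = (\<Sum>y\<in>?R. if y = x then g x * of_nat c else 0)"
    proof (intro sum.cong refl)
      fix y assume "y \<in> ?R"
      then have "int c dvd x - y \<longleftrightarrow> y = x"
        using cong_residue_eq[of x y c] that by (auto simp: cong_iff_dvd_diff)
      then show "g y * (if int c dvd x - y then of_nat c else 0) = (if y = x then g x * of_nat c else 0)" by auto
    qed
    also have "\<dots> = g x * of_nat c" using that by simp
    finally show ?thesis using c by simp
  qed
  have GM: "norm (G n) \<le> c * M" for n
    unfolding G_def by (rule order.trans[OF norm_sum]) (use sum_mono[of ?R "\<lambda>y. norm (g y * add_char c (- (n * y)))" "\<lambda>_. M"] M in \<open>simp add: norm_mult\<close>)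
  have shift: "(\<Sum>y\<in>?R. f (y + 1) * add_char c (- (n * y))) = add_char c n * (\<Sum>y\<in>?R. f y * add_char c (- (n * y)))"
    if "\<And>x. f (x + int c) = f x" for f :: "int \<Rightarrow> complex" and n
  proof -
    have p: "f (x + int c) * add_char c (- (n * (x + int c))) = f x * add_char c (- (n * x))" for x
      using that[of x] add_char_cong[OF c, of "- (n * (x + int c))" "- (n * x)"]
      by (simp add: cong_iff_dvd_diff algebra_simps)
    have "(\<Sum>y\<in>?R. f (y + 1) * add_char c (- (n * y))) = (\<Sum>y\<in>?R. add_char c n * (f (y + 1) * add_char c (- (n * (y + 1)))))"
      by (intro sum.cong refl) (simp add: algebra_simps flip: add_char_add)
    also have "\<dots> = add_char c n * (\<Sum>y\<in>?R. f (y + 1) * add_char c (- (n * (y + 1))))"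
      by (simp only: sum_distrib_left)
    also have "(\<Sum>y\<in>?R. f (y + 1) * add_char c (- (n * (y + 1)))) = (\<Sum>y\<in>?R. f y * add_char c (- (n * y)))"
      by (rule sum_periodic_shift[where f = "\<lambda>y. f y * add_char c (- (n * y))", OF c p])
    finally show ?thesis .
  qed
  \<comment> \<open>Summation by parts, twice: each difference in y multiplies the n-th Fourier
    coefficient by e(n/c) - 1.\<close>
  have G2: "(add_char c n - 1)\<^sup>2 * G n = (\<Sum>y\<in>?R. (g (y + 2) - 2 * g (y + 1) + g y) * add_char c (- (n * y)))" for n
  proof -
    have p1: "g (x + int c + 1) = g (x + 1)" for x using per[of "x + 1"] by (simp add: add_ac)
    have s1: "(\<Sum>y\<in>?R. g (y + 1) * add_char c (- (n * y))) = add_char c n * G n"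
      unfolding G_def by (rule shift) (rule per)
    have s2: "(\<Sum>y\<in>?R. g (y + 2) * add_char c (- (n * y))) = add_char c n * (add_char c n * G n)"
      using shift[of "\<lambda>y. g (y + 1)" n, OF p1] by (simp add: s1 add.assoc)
    have "(\<Sum>y\<in>?R. (g (y + 2) - 2 * g (y + 1) + g y) * add_char c (- (n * y))) =
       (\<Sum>y\<in>?R. g (y + 2) * add_char c (- (n * y))) - 2 * (\<Sum>y\<in>?R. g (y + 1) * add_char c (- (n * y))) + G n"
      by (simp add: G_def ring_distribs sum.distrib sum_subtractf sum_distrib_left mult.assoc)
    also have "\<dots> = (add_char c n - 1)\<^sup>2 * G n"
      unfolding s1 s2 by (simp add: power2_eq_square algebra_simps)
    finally show ?thesis ..
  qed
  have GB: "norm (G (int n)) \<le> B * c / 2 * (1 / (real n)\<^sup>2 + 1 / (real (c - n))\<^sup>2)" if n: "0 < n" "n < c" for n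
  proof -
    define t where "t = real n / real c"
    have t: "0 < t" "t < 1" using n by (auto simp: t_def)
    have "norm (add_char c n - 1) ^ 2 * norm (G n) = norm ((add_char c n - 1)\<^sup>2 * G n)"
      by (simp add: norm_mult norm_power)
    also have "\<dots> \<le> (\<Sum>y\<in>?R. B / (real c)\<^sup>2)"
      unfolding G2 by (rule order.trans[OF norm_sum]) (intro sum_mono, simp add: norm_mult B)
    also have "\<dots> = B / c" by (simp add: power2_eq_square)
    finally have 1: "norm (add_char c n - 1) ^ 2 * norm (G n) \<le> B / c" .
    have "(2 * t * (1 - t)) ^ 2 * norm (G n) \<le> norm (add_char c n - 1) ^ 2 * norm (G n)"
      using norm_add_char_minus_1[OF n] t unfolding t_def by (intro mult_right_mono power_mono) auto
    with 1 have "(2 * t * (1 - t)) ^ 2 * norm (G n) \<le> B / c" by linarith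
    moreover have "0 < (2 * t * (1 - t)) ^ 2" using t by simp
    ultimately have "norm (G n) \<le> B / c * (1 / (2 * t * (1 - t)) ^ 2)"
      by (subst mult_1_right[symmetric], subst times_divide_eq_right, subst pos_le_divide_eq) (simp_all only: mult_1_right mult.commute)
    \<comment> \<open>Partial fractions separate the two ends n = 0 and n = c, where the bound is
      weakest; (a + b)^2 <= 2 a^2 + 2 b^2 then removes the cross term.\<close>
    also have "1 / (2 * t * (1 - t)) ^ 2 = (1 / t + 1 / (1 - t)) ^ 2 / 4"
    proof -
      have "1 / t + 1 / (1 - t) = 1 / (t * (1 - t))" using t by (simp add: field_simps)
      then show ?thesis by (simp add: power_mult_distrib power_divide)
    qed
    also have "B / c * ((1 / t + 1 / (1 - t)) ^ 2 / 4) \<le> B / c * ((2 * (1 / t) ^ 2 + 2 * (1 / (1 - t)) ^ 2) / 4)"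
    proof (intro mult_left_mono divide_right_mono)
      have "0 \<le> (1 / t - 1 / (1 - t)) ^ 2" by simp
      then show "(1 / t + 1 / (1 - t)) ^ 2 \<le> 2 * (1 / t) ^ 2 + 2 * (1 / (1 - t)) ^ 2"
        unfolding power2_sum power2_diff by linarith
    qed (use B0 in auto)
    also have "1 / t = c * (1 / real n)" using n by (simp add: t_def)
    also have "1 / (1 - t) = c * (1 / real (c - n))" using n by (simp add: t_def of_nat_diff field_simps)
    also have "B / c * ((2 * (c * (1 / real n)) ^ 2 + 2 * (c * (1 / real (c - n))) ^ 2) / 4) =
        B * c / 2 * (1 / (real n)\<^sup>2 + 1 / (real (c - n))\<^sup>2)"
      using c by (simp add: power_mult_distrib power_divide) (simp add: power2_eq_square field_simps)
    finally show ?thesis .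
  qed
  have sumG: "(\<Sum>n\<in>?R. norm (G n)) \<le> c * (M + 2 * B)"
  proof -
    obtain d where d: "c = Suc d" using c gr0_implies_Suc by blast
    have "(\<Sum>n\<in>?R. norm (G n)) = norm (G 0) + (\<Sum>n=1..d. norm (G (int n)))"
      unfolding sum_residues_eq d sum.lessThan_Suc_shift
      by (simp add: sum.atLeast1_atMost_eq)
    also have "\<dots> \<le> c * M + (\<Sum>n=1..d. B * c / 2 * (1 / (real n)\<^sup>2 + 1 / (real (c - n))\<^sup>2))"
      by (intro add_mono GM sum_mono GB) (use d in auto)
    also have "(\<Sum>n=1..d. B * c / 2 * (1 / (real n)\<^sup>2 + 1 / (real (c - n))\<^sup>2)) =
        B * c / 2 * ((\<Sum>n=1..d. 1 / (real n)\<^sup>2) + (\<Sum>n=1..d. 1 / (real (c - n))\<^sup>2))"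
      by (simp only: sum.distrib[symmetric] sum_distrib_left)
    also have "(\<Sum>n=1..d. 1 / (real (c - n))\<^sup>2) = (\<Sum>n=1..d. 1 / (real n)\<^sup>2)"
      by (rule sum.reindex_bij_witness[of _ "\<lambda>n. c - n" "\<lambda>n. c - n"]) (use d in auto)
    also have "c * M + B * c / 2 * ((\<Sum>n=1..d. 1 / (real n)\<^sup>2) + (\<Sum>n=1..d. 1 / (real n)\<^sup>2)) \<le> c * M + B * c / 2 * (2 + 2)"
    proof -
      have "(\<Sum>n=1..d. 1 / (real n)\<^sup>2) \<le> 2"
        using sum_inverse_squares_le[of d] by (smt (verit) zero_le_divide_1_iff of_nat_0_le_iff)
      then show ?thesis using B0 by (intro add_left_mono mult_left_mono add_mono) auto
    qed
    finally show ?thesis by (simp add: algebra_simps)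
  qed
  have "(\<Sum>(x, x')\<in>unit_pairs c. add_char c (m * x') * g x) =
      (\<Sum>p\<in>unit_pairs c. \<Sum>n\<in>?R. G n / c * add_char c (m * snd p + n * fst p))"
    unfolding case_prod_unfold
  proof (intro sum.cong refl)
    fix p assume "p \<in> unit_pairs c"
    then have "fst p \<in> ?R" by (auto simp: unit_pairs_def)
    then show "add_char c (m * snd p) * g (fst p) = (\<Sum>n\<in>?R. G n / c * add_char c (m * snd p + n * fst p))"
      by (simp add: inv add_char_add sum_distrib_left sum_divide_distrib mult_ac)
  qed
  also have "\<dots> = (\<Sum>n\<in>?R. \<Sum>p\<in>unit_pairs c. G n / c * add_char c (m * snd p + n * fst p))" by (rule sum.swap)
  also have "\<dots> = (\<Sum>n\<in>?R. G n / c * kloosterman c m n)"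
    by (simp add: kloosterman_def case_prod_unfold sum_distrib_left)
  also have "norm \<dots> \<le> (\<Sum>n\<in>?R. norm (G n) / c * K)"
    by (rule order.trans[OF norm_sum], intro sum_mono)
      (simp add: norm_mult norm_divide K mult_left_mono divide_right_mono)
  also have "\<dots> = (\<Sum>n\<in>?R. norm (G n)) / c * K" by (simp add: sum_divide_distrib sum_distrib_right)
  also have "\<dots> \<le> c * (M + 2 * B) / c * K"
    using sumG K0 by (intro mult_right_mono divide_right_mono) auto
  also have "\<dots> = K * (M + 2 * B)" using c by simp
  finally show ?thesis .
qed

section \<open>The confluent hypergeometric function\<close>

definition hyp11 :: "complex \<Rightarrow> complex \<Rightarrow> complex \<Rightarrow> complex" where
  "hyp11 a b t = eval_fps (fps_hypergeo [a] [b] 1) t"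

lemma hyp11_fps_nth: "fps_nth (fps_hypergeo [a] [b] 1) n = pochhammer a n / (pochhammer b n * fact n)"
  by simp

lemma pochhammer_nonzero_Re:
  assumes "Re b \<ge> 1" shows "pochhammer b n \<noteq> 0"
proof
  assume "pochhammer b n = 0"
  then obtain k where "b = - of_nat k" by (auto simp: pochhammer_eq_0_iff)
  then show False using assms by simp
qed

text \<open>Factor by factor: |a + n| <= (|a| + 1)(n + 1), while Re b >= 1 gives |b + n| >= n + 1.
  Geometric growth of the quotient makes an exponential series dominate, uniformly in b.\<close>

lemma pochhammer_quotient_bound:
  assumes "Re b \<ge> 1"
  shows "norm (pochhammer a n / pochhammer b n) \<le> (norm a + 1) ^ n"
proof (induction n)
  case (Suc n)
  have "real n + 1 \<le> Re (b + of_nat n)" using assms by simp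
  also have "\<dots> \<le> norm (b + of_nat n)" by (rule complex_Re_le_cmod)
  finally have b: "real n + 1 \<le> norm (b + of_nat n)" .
  have "norm (a + of_nat n) \<le> norm a + real n" by (metis norm_of_nat norm_triangle_ineq)
  also have "\<dots> \<le> (norm a + 1) * (real n + 1)" by (simp add: algebra_simps)
  also have "\<dots> \<le> (norm a + 1) * norm (b + of_nat n)" using b by (intro mult_left_mono) auto
  finally have "norm ((a + of_nat n) / (b + of_nat n)) \<le> norm a + 1"
    using b by (simp add: norm_divide divide_le_eq)
  then have "norm (pochhammer a n / pochhammer b n) * norm ((a + of_nat n) / (b + of_nat n)) \<le> (norm a + 1) ^ n * (norm a + 1)"
    using Suc by (intro mult_mono) auto
  then show ?case by (simp add: pochhammer_Suc norm_mult norm_divide mult_ac)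
qed simp

lemma hyp11_term_bound:
  assumes "Re b \<ge> 1" "norm a \<le> K" "norm t \<le> L"
  shows "norm (fps_nth (fps_hypergeo [a] [b] 1) n * t ^ n) \<le> ((K + 1) * L) ^ n / fact n"
proof -
  have "K \<ge> 0" "L \<ge> 0" using assms by (metis norm_ge_zero order_trans)+
  have "norm (fps_nth (fps_hypergeo [a] [b] 1) n * t ^ n) = norm (pochhammer a n / pochhammer b n) * norm t ^ n / fact n"
    unfolding hyp11_fps_nth by (simp add: norm_mult norm_divide norm_power)
  also have "\<dots> \<le> (norm a + 1) ^ n * norm t ^ n / fact n"
    using pochhammer_quotient_bound[OF assms(1)] by (intro divide_right_mono mult_right_mono) auto
  also have "\<dots> \<le> (K + 1) ^ n * L ^ n / fact n"
    using assms \<open>K \<ge> 0\<close> by (intro divide_right_mono mult_mono power_mono) auto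
  finally show ?thesis by (simp add: power_mult_distrib)
qed

lemma exp_series_sums: "(\<lambda>n. x ^ n / fact n) sums exp (x :: real)"
  using exp_converges[of x] by (simp add: field_simps)

lemma summable_norm_hyp11:
  assumes "Re b \<ge> 1"
  shows "summable (\<lambda>n. norm (fps_nth (fps_hypergeo [a] [b] 1) n * t ^ n))"
  by (rule summable_comparison_test'[OF sums_summable[OF exp_series_sums[of "(norm a + 1) * norm t"]], of 0])
    (use hyp11_term_bound[OF assms order_refl order_refl, where a = a and t = t] in auto)

lemma hyp11_sums:
  assumes "Re b \<ge> 1"
  shows "(\<lambda>n. fps_nth (fps_hypergeo [a] [b] 1) n * t ^ n) sums hyp11 a b t"
  unfolding hyp11_def eval_fps_def
  by (rule summable_sums[OF summable_norm_cancel[OF summable_norm_hyp11[OF assms]]])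

lemma hyp11_infsum:
  assumes "Re b \<ge> 1"
  shows "hyp11 a b t = (\<Sum>\<^sub>\<infinity>n. fps_nth (fps_hypergeo [a] [b] 1) n * t ^ n)"
  by (rule infsumI[OF norm_summable_imp_has_sum[OF summable_norm_hyp11[OF assms] hyp11_sums[OF assms]], symmetric])

lemma norm_hyp11_le:
  assumes "Re b \<ge> 1" "norm a \<le> K" "norm t \<le> L"
  shows "norm (hyp11 a b t) \<le> exp ((K + 1) * L)"
  by (rule norm_sums_le[OF hyp11_sums exp_series_sums]) (use assms hyp11_term_bound in auto)

text \<open>Dropping the constant term gains, with \<open>exp_minus_1_le\<close>, a factor of the
  size of t; this feeds the gain of \<open>diff_term\<close> over the main term.\<close>

lemma norm_hyp11_minus_1_le:
  assumes "Re b \<ge> 1" "norm a \<le> K" "norm t \<le> L"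
  shows "norm (hyp11 a b t - 1) \<le> exp ((K + 1) * L) - 1"
proof (rule norm_sums_le)
  show "(\<lambda>n. fps_nth (fps_hypergeo [a] [b] 1) (Suc n) * t ^ Suc n) sums (hyp11 a b t - 1)"
    using hyp11_sums[OF assms(1), of a t] by (subst sums_Suc_iff) simp
  show "(\<lambda>n. ((K + 1) * L) ^ Suc n / fact (Suc n)) sums (exp ((K + 1) * L) - 1)"
    using exp_series_sums[of "(K + 1) * L"] by (subst sums_Suc_iff) simp
  show "norm (fps_nth (fps_hypergeo [a] [b] 1) (Suc n) * t ^ Suc n) \<le> ((K + 1) * L) ^ Suc n / fact (Suc n)" for n
    by (rule hyp11_term_bound[OF assms])
qed

lemma exp_minus_1_le: "0 \<le> x \<Longrightarrow> exp x - 1 \<le> x * exp (x :: real)"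
  using exp_ge_add_one_self[of "- x"] mult_right_mono[of "1 - x" "exp (- x)" "exp x"]
  by (simp add: exp_minus field_simps)

text \<open>All three arguments may depend on u, so one statement covers holomorphy in the variable
  and in the parameters. Locally the arguments are bounded and the M-test applies.\<close>

lemma holomorphic_hyp11 [holomorphic_intros]:
  assumes "open A" "a holomorphic_on A" "b holomorphic_on A" "t holomorphic_on A" "\<And>u. u \<in> A \<Longrightarrow> Re (b u) \<ge> 1"
  shows "(\<lambda>u. hyp11 (a u) (b u) (t u)) holomorphic_on A"
proof -
  have "(\<lambda>u. hyp11 (a u) (b u) (t u)) field_differentiable at u" if u: "u \<in> A" for u
  proof -
    obtain r where r: "r > 0" "cball u r \<subseteq> A" using assms(1) u open_contains_cball by blast
    have bdd: "\<exists>K. \<forall>w\<in>cball u r. norm (f w) \<le> K" if "f holomorphic_on A" for f :: "complex \<Rightarrow> complex"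
    proof -
      have "compact (f ` cball u r)"
        using that r by (intro compact_continuous_image) (auto intro: holomorphic_on_imp_continuous_on holomorphic_on_subset)
      then show ?thesis by (meson bounded_iff compact_imp_bounded imageI)
    qed
    obtain K L where K: "\<And>w. w \<in> cball u r \<Longrightarrow> norm (a w) \<le> K" and L: "\<And>w. w \<in> cball u r \<Longrightarrow> norm (t w) \<le> L"
      using bdd[OF assms(2)] bdd[OF assms(4)] by blast
    have sub: "ball u r \<subseteq> A" using r ball_subset_cball by blast
    have hol: "f holomorphic_on ball u r" if "f holomorphic_on A" for f
      using that sub by (rule holomorphic_on_subset)
    have sm: "(\<lambda>n. ((K + 1) * L) ^ n / fact n) summable_on UNIV"
    proof (rule norm_summable_imp_summable_on)
      show "summable (\<lambda>n. norm (((K + 1) * L) ^ n / fact n))"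
        using sums_summable[OF exp_series_sums[of "\<bar>(K + 1) * L\<bar>"]] by (simp add: power_abs)
    qed
    have "(\<lambda>w. \<Sum>\<^sub>\<infinity>n. fps_nth (fps_hypergeo [a w] [b w] 1) n * t w ^ n) holomorphic_on ball u r"
    proof (rule infsum_holomorphic(1)[OF open_ball _ _ sm])
      fix n
      have "pochhammer (b w) n \<noteq> 0" if "w \<in> ball u r" for w
        using that sub assms(5) pochhammer_nonzero_Re by blast
      then show "(\<lambda>w. fps_nth (fps_hypergeo [a w] [b w] 1) n * t w ^ n) holomorphic_on ball u r"
        unfolding hyp11_fps_nth pochhammer_prod
        using hol[OF assms(2)] hol[OF assms(3)] hol[OF assms(4)]
        by (intro holomorphic_intros) (auto simp: pochhammer_prod)
      show "norm (fps_nth (fps_hypergeo [a w] [b w] 1) n * t w ^ n) \<le> ((K + 1) * L) ^ n / fact n" if "w \<in> ball u r" for w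
        using that sub by (intro hyp11_term_bound assms(5) K L) auto
    qed
    also have "?this \<longleftrightarrow> (\<lambda>u. hyp11 (a u) (b u) (t u)) holomorphic_on ball u r"
      by (rule holomorphic_cong) (use sub assms(5) in \<open>auto simp: hyp11_infsum simp del: fps_hypergeo_nth\<close>)
    finally show ?thesis using r by (auto intro: holomorphic_on_imp_differentiable_at)
  qed
  then show ?thesis using field_differentiable_at_within holomorphic_on_def by blast
qed

lemma fps_conv_radius_hypergeo:
  assumes "Re b \<ge> 1" shows "fps_conv_radius (fps_hypergeo [a] [b] 1) = \<infinity>"
  unfolding fps_conv_radius_def
  by (rule conv_radius_inftyI'') (rule summable_norm_cancel[OF summable_norm_hyp11[OF assms]])

section \<open>Contiguous relations of the confluent series\<close>

lemma hyp11_has_derivative: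
  assumes "Re b \<ge> 1"
  shows "(hyp11 a b has_field_derivative eval_fps (fps_deriv (fps_hypergeo [a] [b] 1)) t) (at t)"
  unfolding hyp11_def[abs_def] by (rule has_field_derivative_eval_fps) (simp add: fps_conv_radius_hypergeo[OF assms])

text \<open>Coefficientwise this is a (a + 1)_n = (a + n) (a)_n, since t d/dt multiplies the n-th
  coefficient by n.\<close>

lemma hyp11_raise:
  assumes "Re b \<ge> 1"
  shows "a * hyp11 a b t + t * eval_fps (fps_deriv (fps_hypergeo [a] [b] 1)) t = a * hyp11 (a + 1) b t"
proof -
  let ?f = "\<lambda>a. fps_hypergeo [a] [b] 1"
  have nz: "pochhammer b n \<noteq> 0" for n by (rule pochhammer_nonzero_Re[OF assms])
  have R: "fps_conv_radius (fps_deriv (?f a)) = \<infinity>"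
    using fps_conv_radius_deriv[of "?f a"] fps_conv_radius_hypergeo[OF assms] by (metis ereal_infty_less_eq(1))
  have RX: "fps_conv_radius (fps_X * fps_deriv (?f a)) = \<infinity>" "fps_conv_radius (fps_const a * ?f a) = \<infinity>"
    using fps_conv_radius_mult[of fps_X "fps_deriv (?f a)"] fps_conv_radius_mult[of "fps_const a" "?f a"]
      R fps_conv_radius_hypergeo[OF assms] by auto
  have "fps_const a * ?f a + fps_X * fps_deriv (?f a) = fps_const a * ?f (a + 1)"
  proof (rule fps_ext)
    fix n
    have "a * pochhammer (a + 1) n = pochhammer a n * (a + of_nat n)"
      by (metis pochhammer_Suc pochhammer_rec)
    moreover have "fps_nth (fps_const a * ?f a + fps_X * fps_deriv (?f a)) n = (a + of_nat n) * fps_nth (?f a) n"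
      by (cases n) (simp_all add: ring_distribs del: fps_hypergeo_nth)
    ultimately show "fps_nth (fps_const a * ?f a + fps_X * fps_deriv (?f a)) n = fps_nth (fps_const a * ?f (a + 1)) n"
      by (simp add: mult.commute)
  qed
  then have "eval_fps (fps_const a * ?f a + fps_X * fps_deriv (?f a)) t = eval_fps (fps_const a * ?f (a + 1)) t" by simp
  then show ?thesis
    by (simp add: eval_fps_add eval_fps_mult RX R fps_conv_radius_hypergeo[OF assms] hyp11_def)
qed

text \<open>Multiplication by t brings in the preceding coefficient, so the check relates indices p
  and p + 1; after removing the common Pochhammer factors a polynomial identity in a, b and p
  remains.\<close>

lemma hyp11_lower:
  assumes "Re b \<ge> 1"
  shows "(b - a) * hyp11 a b t - t * hyp11 a b t + t * eval_fps (fps_deriv (fps_hypergeo [a] [b] 1)) t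
    = (b - a) * hyp11 (a - 1) b t"
proof -
  let ?f = "\<lambda>a. fps_hypergeo [a] [b] 1"
  have nz: "pochhammer b n \<noteq> 0" for n by (rule pochhammer_nonzero_Re[OF assms])
  have R: "fps_conv_radius (fps_deriv (?f a)) = \<infinity>"
    using fps_conv_radius_deriv[of "?f a"] fps_conv_radius_hypergeo[OF assms] by (metis ereal_infty_less_eq(1))
  have RX: "fps_conv_radius (fps_X * fps_deriv (?f a)) = \<infinity>" "fps_conv_radius (fps_X * ?f a) = \<infinity>"
    "fps_conv_radius (fps_const (b - a) * ?f a) = \<infinity>"
    using fps_conv_radius_mult[of fps_X "fps_deriv (?f a)"] fps_conv_radius_mult[of fps_X "?f a"]
      fps_conv_radius_mult[of "fps_const (b - a)" "?f a"] R fps_conv_radius_hypergeo[OF assms] by auto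
  have RD: "fps_conv_radius (fps_const (b - a) * ?f a - fps_X * ?f a) = \<infinity>"
    using fps_conv_radius_diff[of "fps_const (b - a) * ?f a" "fps_X * ?f a"] RX by auto
  have "fps_const (b - a) * ?f a - fps_X * ?f a + fps_X * fps_deriv (?f a) = fps_const (b - a) * ?f (a - 1)"
  proof (rule fps_ext)
    fix n
    show "fps_nth (fps_const (b - a) * ?f a - fps_X * ?f a + fps_X * fps_deriv (?f a)) n = fps_nth (fps_const (b - a) * ?f (a - 1)) n"
    proof (cases n)
      case (Suc p)
      have b: "b + of_nat p \<noteq> 0" using assms by (auto simp: complex_eq_iff)
      define P Q where "P = pochhammer a p" and "Q = pochhammer b p"
      have Q: "Q \<noteq> 0" using nz by (simp add: Q_def)
      have 1: "pochhammer (a - 1) (Suc p) = (a - 1) * P" using pochhammer_rec[of "a - 1" p] by (simp add: P_def)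
      have 2: "pochhammer a (Suc p) = P * (a + of_nat p)" "pochhammer b (Suc p) = Q * (b + of_nat p)"
        by (simp_all add: pochhammer_Suc P_def Q_def)
      have p: "complex_of_nat (Suc p) \<noteq> 0" by (rule of_nat_neq_0)
      have "(b - a + of_nat (Suc p)) * (P * (a + of_nat p)) - P * (b + of_nat p) * of_nat (Suc p) = (b - a) * ((a - 1) * P)"
        by (simp add: algebra_simps)
      then have key: "(b - a + of_nat (Suc p)) * (P * (a + of_nat p) / (Q * (b + of_nat p) * (of_nat (Suc p) * fact p))) - P / (Q * fact p)
        = (b - a) * ((a - 1) * P / (Q * (b + of_nat p) * (of_nat (Suc p) * fact p)))"
        using b Q p by (simp add: divide_simps mult.assoc del: of_nat_Suc)
      have "fps_nth (fps_const (b - a) * ?f a - fps_X * ?f a + fps_X * fps_deriv (?f a)) n =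
          (b - a + of_nat (Suc p)) * fps_nth (?f a) (Suc p) - fps_nth (?f a) p"
        unfolding Suc by (simp add: ring_distribs del: fps_hypergeo_nth of_nat_Suc)
      also have "\<dots> = (b - a) * fps_nth (?f (a - 1)) (Suc p)"
        unfolding hyp11_fps_nth 1 2 fact_Suc P_def[symmetric] Q_def[symmetric] by (rule key)
      finally show ?thesis unfolding Suc by simp
    qed simp
  qed
  then have "eval_fps (fps_const (b - a) * ?f a - fps_X * ?f a + fps_X * fps_deriv (?f a)) t = eval_fps (fps_const (b - a) * ?f (a - 1)) t" by simp
  then show ?thesis
    by (simp add: eval_fps_add eval_fps_diff eval_fps_mult RX RD R fps_conv_radius_hypergeo[OF assms] hyp11_def)
qed

lemma cnj_hyp11:
  assumes "Re b \<ge> 1"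
  shows "cnj (hyp11 a b t) = hyp11 (cnj a) (cnj b) (cnj t)"
proof -
  have "cnj (pochhammer x n) = pochhammer (cnj x) n" for x n
    by (simp add: pochhammer_prod)
  then have "(\<lambda>n. fps_nth (fps_hypergeo [cnj a] [cnj b] 1) n * cnj t ^ n) sums cnj (hyp11 a b t)"
    using hyp11_sums[OF assms, of a t, THEN sums_cnj[THEN iffD2]] by simp
  moreover have "Re (cnj b) \<ge> 1" using assms by simp
  ultimately show ?thesis using hyp11_sums sums_unique2 by blast
qed

lemma whittaker_M_hyp11:
  "whittaker_M \<kappa> (s - 1/2) t = exp (- t / 2) * t powr s * hyp11 (s - \<kappa>) (2 * s) t"
  by (simp add: whittaker_M_def hyp11_def algebra_simps)

section \<open>First order operators on the Whittaker terms\<close>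

text \<open>The Wirtinger derivative is the coefficient of the conjugate in the real differential.
  In this form the chain rule with a holomorphic map only rescales that coefficient.\<close>

lemma dzbar_has_derivative:
  assumes "(f has_derivative (\<lambda>h. \<alpha> * h + \<beta> * cnj h)) (at z)"
  shows "dzbar f z = \<beta>"
proof -
  have z: "Complex (Re z) (Im z) = z" by simp
  have d1: "((\<lambda>t. Complex t (Im z)) has_derivative (\<lambda>h. of_real h)) (at (Re z))"
    unfolding Complex_eq by (auto intro!: derivative_eq_intros)
  have "((\<lambda>t. f (Complex t (Im z))) has_derivative (\<lambda>h. \<alpha> * of_real h + \<beta> * cnj (of_real h))) (at (Re z))"
    using has_derivative_compose[OF d1, where g = f and g' = "\<lambda>h. \<alpha> * h + \<beta> * cnj h"] assms by (simp only: z)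
  then have 1: "dx f z = \<alpha> + \<beta>"
    unfolding dx_def by (intro vector_derivative_at) (simp add: has_vector_derivative_def scaleR_conv_of_real ring_distribs mult.commute)
  have d2: "((\<lambda>t. Complex (Re z) t) has_derivative (\<lambda>h. \<i> * of_real h)) (at (Im z))"
    unfolding Complex_eq by (auto intro!: derivative_eq_intros)
  have "((\<lambda>t. f (Complex (Re z) t)) has_derivative (\<lambda>h. \<alpha> * (\<i> * of_real h) + \<beta> * cnj (\<i> * of_real h))) (at (Im z))"
    using has_derivative_compose[OF d2, where g = f and g' = "\<lambda>h. \<alpha> * h + \<beta> * cnj h"] assms by (simp only: z)
  then have 2: "dy f z = \<i> * (\<alpha> - \<beta>)"
    unfolding dy_def by (intro vector_derivative_at) (simp add: has_vector_derivative_def scaleR_conv_of_real algebra_simps)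
  show ?thesis unfolding dzbar_def 1 2 by (simp add: algebra_simps)
qed

text \<open>A Whittaker M-function times a power of t: the exponent is left free so that it can
  absorb the factor (4 pi y)^(-k/2) of \<open>phi\<close>.\<close>

definition psi :: "complex \<Rightarrow> complex \<Rightarrow> complex \<Rightarrow> complex \<Rightarrow> complex" where
  "psi \<rho> a b t = exp (- t / 2) * t powr \<rho> * hyp11 a b t"

text \<open>With exponent equal to a, differentiating the power produces a F + t F', exactly the
  left side of \<open>hyp11_raise\<close>. This is the case m > 0, where a = s - k/2.\<close>

lemma psi_raise:
  assumes "Re b \<ge> 1" "t \<notin> \<real>\<^sub>\<le>\<^sub>0"
  shows "(psi a a b has_field_derivative (a * psi (a - 1) (a + 1) b t - psi a a b t / 2)) (at t)"
proof -
  let ?D = "eval_fps (fps_deriv (fps_hypergeo [a] [b] 1)) t"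
  have t: "t \<noteq> 0" using assms(2) by auto
  have "(psi a a b has_field_derivative
     (- (1/2) * exp (- t / 2) * t powr a * hyp11 a b t + exp (- t / 2) * (a * t powr (a - 1)) * hyp11 a b t
       + exp (- t / 2) * t powr a * ?D)) (at t)"
    unfolding psi_def[abs_def]
    by (rule derivative_eq_intros hyp11_has_derivative has_field_derivative_powr assms refl | simp add: algebra_simps)+
  also have "- (1/2) * exp (- t / 2) * t powr a * hyp11 a b t + exp (- t / 2) * (a * t powr (a - 1)) * hyp11 a b t
       + exp (- t / 2) * t powr a * ?D = exp (- t / 2) * t powr (a - 1) * (a * hyp11 a b t + t * ?D) - psi a a b t / 2"
  proof -
    have "t powr a = t powr (a - 1) * t" using powr_add[of t "a - 1" 1] t by simp
    then show ?thesis by (simp add: psi_def algebra_simps)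
  qed
  also have "\<dots> = a * psi (a - 1) (a + 1) b t - psi a a b t / 2"
    unfolding hyp11_raise[OF assms(1)] by (simp add: psi_def)
  finally show ?thesis .
qed

text \<open>With exponent b - a the terms assemble into the left side of \<open>hyp11_lower\<close>,
  after adding and subtracting half of \<open>psi\<close>. This is the case m < 0, where b = 2s and
  a = s + k/2, so the exponent is again s - k/2.\<close>

lemma psi_lower:
  assumes "Re b \<ge> 1" "t \<notin> \<real>\<^sub>\<le>\<^sub>0"
  shows "(psi (b - a) a b has_field_derivative ((b - a) * psi (b - a - 1) (a - 1) b t + psi (b - a) a b t / 2)) (at t)"
proof -
  let ?D = "eval_fps (fps_deriv (fps_hypergeo [a] [b] 1)) t" and ?c = "b - a"
  have t: "t \<noteq> 0" using assms(2) by auto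
  have "(psi ?c a b has_field_derivative
     (- (1/2) * exp (- t / 2) * t powr ?c * hyp11 a b t + exp (- t / 2) * (?c * t powr (?c - 1)) * hyp11 a b t
       + exp (- t / 2) * t powr ?c * ?D)) (at t)"
    unfolding psi_def[abs_def]
    by (rule derivative_eq_intros hyp11_has_derivative has_field_derivative_powr assms refl | simp add: algebra_simps)+
  also have "- (1/2) * exp (- t / 2) * t powr ?c * hyp11 a b t + exp (- t / 2) * (?c * t powr (?c - 1)) * hyp11 a b t
       + exp (- t / 2) * t powr ?c * ?D
      = exp (- t / 2) * t powr (?c - 1) * (?c * hyp11 a b t - t * hyp11 a b t + t * ?D) + psi ?c a b t / 2"
  proof -
    have p: "t powr ?c = t powr (?c - 1) * t" using powr_add[of t "?c - 1" 1] t by simp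
    show ?thesis unfolding psi_def p by (simp add: algebra_simps)
  qed
  also have "\<dots> = ?c * psi (?c - 1) (a - 1) b t + psi ?c a b t / 2"
    unfolding hyp11_lower[OF assms(1)] by (simp add: psi_def)
  finally show ?thesis .
qed

lemma cnj_psi:
  assumes "Re b \<ge> 1" "t > 0"
  shows "cnj (psi \<rho> a b (of_real t)) = psi (cnj \<rho>) (cnj a) (cnj b) (of_real t)"
proof -
  have "cnj (of_real t powr \<rho>) = of_real t powr cnj \<rho>"
    using assms(2) by (subst cnj_powr) auto
  then show ?thesis
    unfolding psi_def complex_cnj_mult cnj_hyp11[OF assms(1)] by (simp add: exp_cnj)
qed

text \<open>Both signs of m in one formula. The last term is the one that the derivative of e(mx)
  cancels in \<open>phi_has_derivative\<close>.\<close>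

lemma psi_deriv:
  fixes s :: complex and k m :: int
  defines "\<epsilon> \<equiv> complex_of_int (sgn m)"
  assumes "Re s \<ge> 1/2" "t > 0" "m \<noteq> 0"
  shows "(psi (s - of_int k/2) (s - \<epsilon> * of_int k/2) (2 * s) has_field_derivative
     ((s - of_int k/2) * psi (s - of_int k/2 - 1) (s - \<epsilon> * of_int k/2 + \<epsilon>) (2 * s) (of_real t)
       - \<epsilon> * psi (s - of_int k/2) (s - \<epsilon> * of_int k/2) (2 * s) (of_real t) / 2)) (at (of_real t))"
proof (cases "m > 0")
  case True
  then show ?thesis
    using psi_raise[of "2 * s" "of_real t" "s - of_int k/2"] assms(2-) by (simp add: \<epsilon>_def)
next
  case False
  then have "\<epsilon> = -1" using assms(4) by (simp add: \<epsilon>_def sgn_if)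
  then show ?thesis
    using psi_lower[of "2 * s" "of_real t" "s + of_int k/2"] assms(2,3) by (simp add: algebra_simps)
qed

text \<open>With t = 4 pi |m| y, the prefactor (4 pi y)^(-k/2) is |m|^(k/2) t^(-k/2) and merges with
  t^s.\<close>

lemma phi_eq_psi:
  assumes "Im z > 0" "m \<noteq> 0"
  shows "phi k m z s = of_real (\<bar>real_of_int m\<bar> powr (of_int k/2)) *
     psi (s - of_int k/2) (s - of_int (sgn m) * of_int k/2) (2 * s) (of_real (4 * pi * \<bar>real_of_int m\<bar> * Im z)) *
     exp (2 * of_real pi * \<i> * of_int m * of_real (Re z))"
proof -
  define a where "a = \<bar>real_of_int m\<bar>"
  have a: "a > 0" using assms(2) by (simp add: a_def)
  define t where "t = 4 * pi * a * Im z"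
  have t: "t > 0" using a assms(1) by (simp add: t_def)
  have "(4 * pi * Im z) powr (- of_int k / 2) = (t / a) powr (- (of_int k/2))"
    using a by (simp add: t_def mult_ac)
  also have "\<dots> = a powr (of_int k/2) * t powr (- (of_int k/2))"
    using a t by (simp add: powr_divide powr_minus field_simps)
  finally have 1: "complex_of_real ((4 * pi * Im z) powr (- of_int k / 2)) = of_real (a powr (of_int k/2)) * of_real t powr (- (of_int k/2))"
    using t by (simp add: powr_of_real[symmetric] del: powr_of_real)
  have 2: "of_real t powr (- (of_int k/2)) * of_real t powr s = of_real t powr (s - of_int k/2)"
    by (simp add: powr_add[symmetric])
  have "phi k m z s = of_real (a powr (of_int k/2)) * (exp (- of_real t / 2) * (of_real t powr (- (of_int k/2)) * of_real t powr s) *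
      hyp11 (s - of_int (sgn m) * of_int k/2) (2 * s) (of_real t)) * exp (2 * of_real pi * \<i> * of_int m * of_real (Re z))"
    unfolding phi_def 1 whittaker_M_hyp11 by (simp add: t_def a_def mult_ac)
  then show ?thesis unfolding 2 psi_def a_def[symmetric] t_def[symmetric] by (simp add: mult_ac)
qed

text \<open>The x-derivative of e(mx) cancels the part of \<open>psi_deriv\<close> proportional to
  \<open>psi\<close> itself; what remains has the hypergeometric parameter of weight 2 - k and index
  -m. The full real differential is stated, with an unspecified holomorphic part, because the slash
  operator needs the chain rule.\<close>

lemma phi_has_derivative:
  assumes z: "Im z > 0" and m: "m \<noteq> 0" and s: "Re s \<ge> 1/2"
  shows "\<exists>\<alpha>. ((\<lambda>w. phi k m w s) has_derivative (\<lambda>h. \<alpha> * h +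
     (\<i> / 2 * (4 * of_real pi) powi (1 - k) * of_real (Im z) powi (- k) * (s - of_int k/2) *
        cnj (phi (2 - k) (- m) z (cnj s))) * cnj h)) (at z)"
proof -
  define a where "a = \<bar>real_of_int m\<bar>"
  have a: "a > 0" using m by (simp add: a_def)
  define \<epsilon> where "\<epsilon> = complex_of_int (sgn m)"
  define t where "t = 4 * pi * a * Im z"
  have t: "t > 0" using a z by (simp add: t_def)
  have \<epsilon>m: "\<epsilon> * of_real a = of_int m" by (auto simp: \<epsilon>_def a_def sgn_if)
  let ?\<psi> = "psi (s - of_int k/2) (s - \<epsilon> * of_int k/2) (2 * s)"
  define e where "e = exp (2 * of_real pi * \<i> * of_int m * of_real (Re z))"
  define C where "C = complex_of_real (a powr (of_int k/2))"
  define D where "D = (s - of_int k/2) * psi (s - of_int k/2 - 1) (s - \<epsilon> * of_int k/2 + \<epsilon>) (2 * s) (of_real t) - \<epsilon> * ?\<psi> (of_real t) / 2"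
  have D: "(?\<psi> has_field_derivative D) (at (of_real t))"
    unfolding D_def \<epsilon>_def by (rule psi_deriv[OF s t m])
  have "((\<lambda>w. complex_of_real (4 * pi * a * Im w)) has_derivative (\<lambda>h. of_real (4 * pi * a * Im h))) (at z)"
    by (auto intro!: derivative_eq_intros)
  then have H1: "((\<lambda>w. ?\<psi> (of_real (4 * pi * a * Im w))) has_derivative (\<lambda>h. D * of_real (4 * pi * a * Im h))) (at z)"
    by (rule has_derivative_compose[where g = ?\<psi> and g' = "\<lambda>h. D * h"]) (use D in \<open>simp only: has_field_derivative_def t_def\<close>)
  have H2: "((\<lambda>w. exp (2 * of_real pi * \<i> * of_int m * of_real (Re w))) has_derivative
      (\<lambda>h. e * (2 * of_real pi * \<i> * of_int m * of_real (Re h)))) (at z)"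
  proof (rule has_derivative_compose[where g = exp and g' = "\<lambda>h. e * h"])
    show "((\<lambda>w. 2 * of_real pi * \<i> * of_int m * complex_of_real (Re w)) has_derivative
        (\<lambda>h. 2 * of_real pi * \<i> * of_int m * of_real (Re h))) (at z)"
      by (auto intro!: derivative_eq_intros)
    show "(exp has_derivative (\<lambda>h. e * h)) (at (2 * of_real pi * \<i> * of_int m * complex_of_real (Re z)))"
      using DERIV_exp[of "2 * of_real pi * \<i> * of_int m * complex_of_real (Re z)"]
      by (simp only: has_field_derivative_def e_def)
  qed
  have "((\<lambda>w. C * ?\<psi> (of_real (4 * pi * a * Im w)) * exp (2 * of_real pi * \<i> * of_int m * of_real (Re w))) has_derivative
      (\<lambda>h. C * ?\<psi> (of_real t) * (e * (2 * of_real pi * \<i> * of_int m * of_real (Re h))) + C * (D * of_real (4 * pi * a * Im h)) * e)) (at z)"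
    using has_derivative_mult[OF has_derivative_mult[OF has_derivative_const[of C] H1] H2]
    by (simp add: t_def e_def)
  also have "(\<lambda>h. C * ?\<psi> (of_real t) * (e * (2 * of_real pi * \<i> * of_int m * of_real (Re h))) + C * (D * of_real (4 * pi * a * Im h)) * e)
     = (\<lambda>h. (C * e * pi * \<i> * a * (\<epsilon> * ?\<psi> (of_real t) - 2 * D)) * h + (C * e * pi * \<i> * a * (\<epsilon> * ?\<psi> (of_real t) + 2 * D)) * cnj h)"
  proof
    fix h
    have re: "complex_of_real (Re h) = (h + cnj h) / 2" by (simp add: complex_add_cnj)
    have im: "complex_of_real (Im h) = - \<i> * (h - cnj h) / 2" by (simp add: complex_eq_iff)
    show "C * ?\<psi> (of_real t) * (e * (2 * of_real pi * \<i> * of_int m * of_real (Re h))) + C * (D * of_real (4 * pi * a * Im h)) * e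
     = (C * e * pi * \<i> * a * (\<epsilon> * ?\<psi> (of_real t) - 2 * D)) * h + (C * e * pi * \<i> * a * (\<epsilon> * ?\<psi> (of_real t) + 2 * D)) * cnj h"
      unfolding of_real_mult re im \<epsilon>m[symmetric] by (simp add: field_simps)
  qed
  also have "C * e * pi * \<i> * a * (\<epsilon> * ?\<psi> (of_real t) + 2 * D) =
      \<i> / 2 * (4 * of_real pi) powi (1 - k) * of_real (Im z) powi (- k) * (s - of_int k/2) * cnj (phi (2 - k) (- m) z (cnj s))"
  proof -
    let ?\<chi> = "psi (s - of_int k/2 - 1) (s - \<epsilon> * of_int k/2 + \<epsilon>) (2 * s) (of_real t)"
    let ?\<omega> = "psi (s + of_int k/2 - 1) (s - \<epsilon> * of_int k/2 + \<epsilon>) (2 * s) (of_real t)"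
    have "cnj (phi (2 - k) (- m) z (cnj s)) = of_real (a powr (1 - of_int k/2)) * ?\<omega> * e"
    proof -
      have e: "cnj (exp (2 * of_real pi * \<i> * of_int (- m) * of_real (Re z))) = e"
        by (simp add: e_def exp_cnj)
      have "phi (2 - k) (- m) z (cnj s) = of_real (a powr (1 - of_int k/2)) *
        psi (cnj s - of_int (2 - k)/2) (cnj s - (- \<epsilon>) * of_int (2 - k)/2) (2 * cnj s) (of_real t) * exp (2 * of_real pi * \<i> * of_int (- m) * of_real (Re z))"
        using phi_eq_psi[OF z, of "- m" "2 - k" "cnj s"] m
        by (simp add: a_def t_def \<epsilon>_def sgn_minus diff_divide_distrib)
      also have "cnj \<dots> = of_real (a powr (1 - of_int k/2)) * psi (s - of_int (2 - k)/2) (s - (- \<epsilon>) * of_int (2 - k)/2) (2 * s) (of_real t) * e"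
      proof -
        have "cnj (psi (cnj s - of_int (2 - k)/2) (cnj s - (- \<epsilon>) * of_int (2 - k)/2) (2 * cnj s) (of_real t)) =
            psi (s - of_int (2 - k)/2) (s - (- \<epsilon>) * of_int (2 - k)/2) (2 * s) (of_real t)"
          using s t by (subst cnj_psi) (auto simp: \<epsilon>_def)
        then show ?thesis by (simp only: complex_cnj_mult e complex_cnj_complex_of_real)
      qed
      finally show ?thesis by (simp add: diff_divide_distrib algebra_simps)
    qed
    then have "\<i> / 2 * (4 * of_real pi) powi (1 - k) * of_real (Im z) powi (- k) * (s - of_int k/2) * cnj (phi (2 - k) (- m) z (cnj s))
       = \<i> / 2 * (s - of_int k/2) * e * ((4 * of_real pi) powi (1 - k) * of_real (Im z) powi (- k) * of_real (a powr (1 - of_int k/2)) * ?\<omega>)"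
      by (simp add: mult_ac)
    \<comment> \<open>Differentiation leaves the exponent s - k/2 - 1, while weight 2 - k has s +
      k/2 - 1; the quotient t^k accounts for the powers of 4 pi and y in the constant.\<close>
    also have "?\<omega> = of_real t powr of_int k * ?\<chi>"
    proof -
      have "of_real t powr (s + of_int k/2 - 1) = of_real t powr (of_int k + (s - of_int k/2 - 1) :: complex)" by (simp add: algebra_simps)
      also have "\<dots> = of_real t powr of_int k * of_real t powr (s - of_int k/2 - 1)" by (rule powr_add)
      finally show ?thesis by (simp add: psi_def mult_ac)
    qed
    also have "of_real t powr (of_int k::complex) = of_real (t powr of_int k)"
      using t by (simp add: powr_of_real[symmetric] del: powr_of_real)
    also have "(4 * of_real pi) powi (1 - k) * of_real (Im z) powi (- k) * complex_of_real (a powr (1 - of_int k/2)) * (of_real (t powr of_int k) * ?\<chi>)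
      = of_real ((4 * pi) powi (1 - k) * Im z powi (- k) * a powr (1 - of_int k/2) * t powr of_int k) * ?\<chi>"
      by simp
    also have "(4 * pi) powi (1 - k) * Im z powi (- k) * a powr (1 - of_int k/2) * t powr of_int k = 4 * pi * a * a powr (of_int k/2)"
    proof -
      have 1: "t powr of_int k = (4 * pi) powr of_int k * a powr of_int k * Im z powr of_int k"
        using a z by (simp add: t_def powr_mult)
      have gen: "P powi (1 - k) * P powr of_int k = P" "P powi (- k) * P powr of_int k = 1" if "P > 0" for P :: real
        using that by (simp_all add: powr_real_of_int' [symmetric] flip: powr_add)
      have 2: "(4 * pi) powi (1 - k) * (4 * pi) powr of_int k = 4 * pi" by (rule gen) simp
      have 3: "Im z powi (- k) * Im z powr of_int k = 1" by (rule gen) (rule z)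
      have 4: "a powr (1 - of_int k/2) * a powr of_int k = a * a powr (of_int k/2)"
        using a by (simp add: powr_mult_base add.commute flip: powr_add)
      have "(4 * pi) powi (1 - k) * Im z powi (- k) * a powr (1 - of_int k/2) * t powr of_int k =
          ((4 * pi) powi (1 - k) * (4 * pi) powr of_int k) * (Im z powi (- k) * Im z powr of_int k)
          * (a powr (1 - of_int k/2) * a powr of_int k)"
        unfolding 1 by (simp only: mult_ac)
      then show ?thesis unfolding 2 3 4 by simp
    qed
    finally have R: "\<i> / 2 * (4 * of_real pi) powi (1 - k) * of_real (Im z) powi (- k) * (s - of_int k/2) * cnj (phi (2 - k) (- m) z (cnj s))
       = \<i> / 2 * (s - of_int k/2) * e * (of_real (4 * pi * a * a powr (of_int k/2)) * ?\<chi>)" .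
    have L: "\<epsilon> * ?\<psi> (of_real t) + 2 * D = 2 * ((s - of_int k/2) * ?\<chi>)"
      unfolding D_def right_diff_distrib by simp
    show ?thesis unfolding L R C_def of_real_mult by (simp only: mult_ac of_real_numeral) simp
  qed
  finally have "((\<lambda>w. C * ?\<psi> (of_real (4 * pi * a * Im w)) * exp (2 * of_real pi * \<i> * of_int m * of_real (Re w))) has_derivative
     (\<lambda>h. (C * e * pi * \<i> * a * (\<epsilon> * ?\<psi> (of_real t) - 2 * D)) * h +
       (\<i> / 2 * (4 * of_real pi) powi (1 - k) * of_real (Im z) powi (- k) * (s - of_int k/2) *
        cnj (phi (2 - k) (- m) z (cnj s))) * cnj h)) (at z)" .
  then have "((\<lambda>w. phi k m w s) has_derivative
     (\<lambda>h. (C * e * pi * \<i> * a * (\<epsilon> * ?\<psi> (of_real t) - 2 * D)) * h +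
       (\<i> / 2 * (4 * of_real pi) powi (1 - k) * of_real (Im z) powi (- k) * (s - of_int k/2) *
        cnj (phi (2 - k) (- m) z (cnj s))) * cnj h)) (at z)"
    by (rule has_derivative_transform_within_open[OF _ open_halfspace_Im_gt[of 0]])
      (use z m in \<open>auto simp: phi_eq_psi C_def a_def \<epsilon>_def\<close>)
  then show ?thesis by blast
qed

section \<open>The Wirtinger derivative under the slash operator\<close>

lemma SL2Z_denominator_nonzero:
  assumes "A \<in> carrier SL2Z" "Im z > 0"
  shows "of_int (A $ 2 $ 1) * z + of_int (A $ 2 $ 2) \<noteq> 0"
proof
  assume "of_int (A $ 2 $ 1) * z + of_int (A $ 2 $ 2) = 0"
  then have "Im (of_int (A $ 2 $ 1) * z + of_int (A $ 2 $ 2)) = 0" "Re (of_int (A $ 2 $ 1) * z + of_int (A $ 2 $ 2)) = 0" by simp_all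
  then have "A $ 2 $ 1 = 0" "A $ 2 $ 2 = 0" using assms(2) by auto
  then show False using assms(1) by (auto simp: SL2Z_def det_2)
qed

lemma moebius_action_eqs:
  assumes "A \<in> carrier SL2Z" "Im z > 0"
  defines "j \<equiv> of_int (A $ 2 $ 1) * z + of_int (A $ 2 $ 2)"
  shows "Im (moebius_action A z) = Im z / (norm j)\<^sup>2"
    and "(moebius_action A has_field_derivative (1 / j\<^sup>2)) (at z)"
proof -
  have det: "A $ 1 $ 1 * A $ 2 $ 2 - A $ 1 $ 2 * A $ 2 $ 1 = 1" using assms(1) by (simp add: SL2Z_def det_2)
  have det': "complex_of_int (A $ 1 $ 1) * of_int (A $ 2 $ 2) - of_int (A $ 1 $ 2) * of_int (A $ 2 $ 1) = 1"
    using det by (simp flip: of_int_mult of_int_diff)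
  have detr: "real_of_int (A $ 1 $ 1) * of_int (A $ 2 $ 2) - of_int (A $ 1 $ 2) * of_int (A $ 2 $ 1) = 1"
    using det by (simp flip: of_int_mult of_int_diff)
  have j: "j \<noteq> 0" unfolding j_def by (rule SL2Z_denominator_nonzero[OF assms(1,2)])
  have "Im (moebius_action A z) = Im ((of_int (A $ 1 $ 1) * z + of_int (A $ 1 $ 2)) * cnj j) / (norm j)\<^sup>2"
    by (simp add: moebius_action_def j_def[symmetric] complex_div_cnj[of _ j])
  also have "Im ((of_int (A $ 1 $ 1) * z + of_int (A $ 1 $ 2)) * cnj j) =
      Im z * (real_of_int (A $ 1 $ 1) * of_int (A $ 2 $ 2) - of_int (A $ 1 $ 2) * of_int (A $ 2 $ 1))"
    by (simp add: j_def algebra_simps)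
  finally show "Im (moebius_action A z) = Im z / (norm j)\<^sup>2" using detr by simp
  have "(moebius_action A has_field_derivative
     (of_int (A $ 1 $ 1) * j - (of_int (A $ 1 $ 1) * z + of_int (A $ 1 $ 2)) * of_int (A $ 2 $ 1)) / (j * j)) (at z)"
    unfolding moebius_action_def[abs_def] j_def
    by (rule derivative_eq_intros refl SL2Z_denominator_nonzero[OF assms(1,2)] | simp)+
  also have "of_int (A $ 1 $ 1) * j - (of_int (A $ 1 $ 1) * z + of_int (A $ 1 $ 2)) * of_int (A $ 2 $ 1)
     = complex_of_int (A $ 1 $ 1) * of_int (A $ 2 $ 2) - of_int (A $ 1 $ 2) * of_int (A $ 2 $ 1)"
    by (simp add: j_def algebra_simps)
  finally show "(moebius_action A has_field_derivative (1 / j\<^sup>2)) (at z)"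
    unfolding det' by (simp add: power2_eq_square)
qed

text \<open>The chain rule multiplies the antiholomorphic part by the conjugate of j^(-2), where j =
  cz + d. Since Im(gamma z) = y/|j|^2, the factor y^(-k) contributes |j|^(2k), and j^(-k) |j|^(2k)
  conj(j)^(-2) = conj(j)^(k-2), the conjugate of the factor of weight 2 - k.\<close>

lemma dzbar_slash_phi:
  assumes A: "A \<in> carrier SL2Z" and z: "Im z > 0" and m: "m \<noteq> 0" and s: "Re s \<ge> 1/2"
  shows "dzbar (slash k (\<lambda>w. phi k m w s) A) z = \<i> / 2 * (4 * of_real pi) powi (1 - k) * of_real (Im z) powi (- k) * (s - of_int k/2) *
     cnj (slash (2 - k) (\<lambda>w. phi (2 - k) (- m) w (cnj s)) A z)"
proof -
  define j where "j = (\<lambda>z. of_int (A $ 2 $ 1) * z + of_int (A $ 2 $ 2) :: complex)"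
  have j0: "j z \<noteq> 0" unfolding j_def by (rule SL2Z_denominator_nonzero[OF A z])
  define w where "w = moebius_action A z"
  have Imw: "Im w = Im z / (norm (j z))\<^sup>2" unfolding w_def j_def by (rule moebius_action_eqs(1)[OF A z])
  have w0: "Im w > 0" using z j0 by (simp add: Imw)
  define \<beta> where "\<beta> = \<i> / 2 * (4 * of_real pi) powi (1 - k) * of_real (Im w) powi (- k) * (s - of_int k/2) * cnj (phi (2 - k) (- m) w (cnj s))"
  obtain \<alpha> where \<alpha>: "((\<lambda>w. phi k m w s) has_derivative (\<lambda>h. \<alpha> * h + \<beta> * cnj h)) (at w)"
    using phi_has_derivative[OF w0 m s, of k] unfolding \<beta>_def by blast
  have "(moebius_action A has_derivative (\<lambda>h. 1 / (j z)\<^sup>2 * h)) (at z)"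
    using moebius_action_eqs(2)[OF A z] by (simp only: has_field_derivative_def j_def)
  then have 1: "((\<lambda>v. phi k m (moebius_action A v) s) has_derivative (\<lambda>h. \<alpha> * (1 / (j z)\<^sup>2 * h) + \<beta> * cnj (1 / (j z)\<^sup>2 * h))) (at z)"
    using \<alpha> unfolding w_def
    by (rule has_derivative_compose[where g = "\<lambda>w. phi k m w s" and g' = "\<lambda>h. \<alpha> * h + \<beta> * cnj h"])
  have "((\<lambda>v. j v powi (- k)) has_field_derivative (of_int (- k) * j z powi (- k - 1) * of_int (A $ 2 $ 1))) (at z)"
    using j0 unfolding j_def by (auto intro!: derivative_eq_intros)
  then have 2: "((\<lambda>v. j v powi (- k)) has_derivative (\<lambda>h. (of_int (- k) * j z powi (- k - 1) * of_int (A $ 2 $ 1)) * h)) (at z)"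
    by (simp only: has_field_derivative_def)
  have "((\<lambda>v. j v powi (- k) * phi k m (moebius_action A v) s) has_derivative
    (\<lambda>h. j z powi (- k) * (\<alpha> * (1 / (j z)\<^sup>2 * h) + \<beta> * cnj (1 / (j z)\<^sup>2 * h)) +
       (of_int (- k) * j z powi (- k - 1) * of_int (A $ 2 $ 1)) * h * phi k m w s)) (at z)"
    using has_derivative_mult[OF 2 1] by (simp add: w_def)
  also have "(\<lambda>h. j z powi (- k) * (\<alpha> * (1 / (j z)\<^sup>2 * h) + \<beta> * cnj (1 / (j z)\<^sup>2 * h)) +
       (of_int (- k) * j z powi (- k - 1) * of_int (A $ 2 $ 1)) * h * phi k m w s)
    = (\<lambda>h. (j z powi (- k) * \<alpha> * (1 / (j z)\<^sup>2) + (of_int (- k) * j z powi (- k - 1) * of_int (A $ 2 $ 1)) * phi k m w s) * h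
         + (j z powi (- k) * \<beta> * cnj (1 / (j z)\<^sup>2)) * cnj h)"
    by (rule ext) (simp add: ring_distribs mult_ac)
  finally have "dzbar (\<lambda>v. j v powi (- k) * phi k m (moebius_action A v) s) z = j z powi (- k) * \<beta> * cnj (1 / (j z)\<^sup>2)"
    by (rule dzbar_has_derivative)
  also have "j z powi (- k) * \<beta> * cnj (1 / (j z)\<^sup>2) = \<i> / 2 * (4 * of_real pi) powi (1 - k) * of_real (Im z) powi (- k) * (s - of_int k/2) *
     cnj (j z powi (- (2 - k)) * phi (2 - k) (- m) w (cnj s))"
  proof -
    have n: "complex_of_real ((norm (j z))\<^sup>2) = j z * cnj (j z)" by (rule complex_norm_square)
    have "complex_of_real (Im w) powi (- k) = of_real (Im z) powi (- k) * (j z * cnj (j z)) powi k"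
      unfolding Imw of_real_divide n by (simp add: power_int_divide_distrib power_int_minus field_simps)
    then have "j z powi (- k) * of_real (Im w) powi (- k) * cnj (1 / (j z)\<^sup>2) = of_real (Im z) powi (- k) * (cnj (j z) powi k / (cnj (j z))\<^sup>2)"
      using j0 by (simp add: power_int_mult_distrib power_int_minus field_simps)
    also have "cnj (j z) powi k / (cnj (j z))\<^sup>2 = cnj (j z) powi (- (2 - k))"
      using j0 by (simp add: power_int_diff)
    finally have *: "j z powi (- k) * of_real (Im w) powi (- k) * cnj (1 / (j z)\<^sup>2) = of_real (Im z) powi (- k) * cnj (j z) powi (- (2 - k))" .
    have "j z powi (- k) * \<beta> * cnj (1 / (j z)\<^sup>2) = \<i> / 2 * (4 * of_real pi) powi (1 - k) *
        (j z powi (- k) * of_real (Im w) powi (- k) * cnj (1 / (j z)\<^sup>2)) * (s - of_int k/2) * cnj (phi (2 - k) (- m) w (cnj s))"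
      unfolding \<beta>_def by (simp only: mult_ac)
    then show ?thesis unfolding * by (simp only: mult_ac complex_cnj_mult complex_cnj_power_int)
  qed
  finally show ?thesis by (simp add: slash_def[abs_def] j_def w_def)
qed

section \<open>Cosets and bottom rows\<close>

text \<open>Since -1 lies in \<open>Gamma_inf\<close>, a coset fixes its bottom row only up to sign;
  one row of each sign class is kept.\<close>

definition row_index :: "(int \<times> int) set" where
  "row_index = {(c, d). coprime c d \<and> (c > 0 \<or> c = 0 \<and> d = 1)}"

definition row_matrix :: "int \<Rightarrow> int \<Rightarrow> int^2^2" where
  "row_matrix c d = (SOME A. A \<in> carrier SL2Z \<and> A $ 2 $ 1 = c \<and> A $ 2 $ 2 = d)"

definition matrix22 :: "int \<Rightarrow> int \<Rightarrow> int \<Rightarrow> int \<Rightarrow> int^2^2" where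
  "matrix22 a b c d = (\<chi> i j. if i = 1 then (if j = 1 then a else b) else (if j = 1 then c else d))"

lemma matrix22_nth [simp]:
  "matrix22 a b c d $ 1 $ 1 = a" "matrix22 a b c d $ 1 $ 2 = b"
  "matrix22 a b c d $ 2 $ 1 = c" "matrix22 a b c d $ 2 $ 2 = d"
  by (simp_all add: matrix22_def)

lemma matrix22_eqI:
  fixes A B :: "int^2^2"
  assumes "A $ 1 $ 1 = B $ 1 $ 1" "A $ 1 $ 2 = B $ 1 $ 2" "A $ 2 $ 1 = B $ 2 $ 1" "A $ 2 $ 2 = B $ 2 $ 2"
  shows "A = B"
  using assms by (simp add: vec_eq_iff forall_2)

lemma matrix_mult_nth2:
  fixes A B :: "int^2^2"
  shows "(A ** B) $ i $ j = A $ i $ 1 * B $ 1 $ j + A $ i $ 2 * B $ 2 $ j"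
  by (simp add: matrix_matrix_mult_def sum_2)

lemma SL2Z_iff: "A \<in> carrier SL2Z \<longleftrightarrow> A $ 1 $ 1 * A $ 2 $ 2 - A $ 1 $ 2 * A $ 2 $ 1 = 1"
  by (simp add: SL2Z_def det_2)

lemma coprime_bottom_row: "A \<in> carrier SL2Z \<Longrightarrow> coprime (A $ 2 $ 1) (A $ 2 $ 2)"
proof (rule coprimeI)
  fix g assume "A \<in> carrier SL2Z" "g dvd A $ 2 $ 1" "g dvd A $ 2 $ 2"
  then have "g dvd A $ 1 $ 1 * A $ 2 $ 2 - A $ 1 $ 2 * A $ 2 $ 1" by (intro dvd_diff) auto
  then show "is_unit g" using \<open>A \<in> carrier SL2Z\<close> by (simp add: SL2Z_iff)
qed

lemma row_matrix:
  assumes "coprime c d"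
  shows "row_matrix c d \<in> carrier SL2Z" "row_matrix c d $ 2 $ 1 = c" "row_matrix c d $ 2 $ 2 = d"
proof -
  obtain u v where "u * c + v * d = 1" using bezout_int[of c d] assms by (auto simp: coprime_iff_gcd_eq_1)
  then have "matrix22 v (- u) c d \<in> carrier SL2Z" by (simp add: SL2Z_iff algebra_simps)
  then have "\<exists>A. A \<in> carrier SL2Z \<and> A $ 2 $ 1 = c \<and> A $ 2 $ 2 = d"
    by (intro exI[of _ "matrix22 v (- u) c d"]) simp
  from someI_ex[OF this] show "row_matrix c d \<in> carrier SL2Z" "row_matrix c d $ 2 $ 1 = c" "row_matrix c d $ 2 $ 2 = d"
    by (auto simp: row_matrix_def)
qed

text \<open>The lower left entry of B A^(-1) is the cross product of the bottom rows of B and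
  A.\<close>

lemma r_coset_Gamma_inf:
  assumes A: "A \<in> carrier SL2Z"
  shows "Gamma_inf #>\<^bsub>SL2Z\<^esub> A = {B \<in> carrier SL2Z. B $ 2 $ 1 * A $ 2 $ 2 = B $ 2 $ 2 * A $ 2 $ 1}"
proof (intro equalityI subsetI)
  fix B assume "B \<in> Gamma_inf #>\<^bsub>SL2Z\<^esub> A"
  then obtain T where T: "T \<in> Gamma_inf" "B = T ** A" by (auto simp: r_coset_def SL2Z_def)
  then have "det B = 1" using A by (simp add: SL2Z_def det_mul Gamma_inf_def)
  moreover have "B $ 2 $ 1 * A $ 2 $ 2 = B $ 2 $ 2 * A $ 2 $ 1"
    using T by (simp add: matrix_mult_nth2 Gamma_inf_def)
  ultimately show "B \<in> {B \<in> carrier SL2Z. B $ 2 $ 1 * A $ 2 $ 2 = B $ 2 $ 2 * A $ 2 $ 1}"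
    by (simp add: SL2Z_def)
next
  fix B assume B: "B \<in> {B \<in> carrier SL2Z. B $ 2 $ 1 * A $ 2 $ 2 = B $ 2 $ 2 * A $ 2 $ 1}"
  define T where "T = B ** matrix22 (A $ 2 $ 2) (- A $ 1 $ 2) (- A $ 2 $ 1) (A $ 1 $ 1)"
  have detA: "A $ 1 $ 1 * A $ 2 $ 2 - A $ 1 $ 2 * A $ 2 $ 1 = 1" using A by (simp add: SL2Z_iff)
  have inv: "matrix22 (A $ 2 $ 2) (- A $ 1 $ 2) (- A $ 2 $ 1) (A $ 1 $ 1) ** A = mat 1"
    using detA by (intro matrix22_eqI) (auto simp: matrix_mult_nth2 mat_def algebra_simps)
  have "T ** A = B" unfolding T_def matrix_mul_assoc[symmetric] inv by simp
  moreover have "T \<in> Gamma_inf"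
  proof -
    have "matrix22 (A $ 2 $ 2) (- A $ 1 $ 2) (- A $ 2 $ 1) (A $ 1 $ 1) \<in> carrier SL2Z"
      using detA by (simp add: SL2Z_iff algebra_simps)
    then have "det T = 1" using B by (simp add: T_def det_mul SL2Z_def)
    moreover have "T $ 2 $ 1 = 0" using B by (simp add: T_def matrix_mult_nth2)
    ultimately show ?thesis by (simp add: Gamma_inf_def SL2Z_def)
  qed
  ultimately show "B \<in> Gamma_inf #>\<^bsub>SL2Z\<^esub> A" by (auto simp: r_coset_def SL2Z_def)
qed

lemma proportional_coprime:
  fixes c d c' d' :: int
  assumes "coprime c d" "coprime c' d'" "c' * d = d' * c"
  shows "c' = c \<and> d' = d \<or> c' = - c \<and> d' = - d"
proof -
  have "c dvd c' * d" "c' dvd d' * c" using assms(3) by (metis dvd_triv_right, metis dvd_triv_left)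
  then have "c dvd c'" "c' dvd c" using assms(1,2) by (auto simp: coprime_dvd_mult_left_iff coprime_dvd_mult_right_iff)
  then have "\<bar>c'\<bar> = \<bar>c\<bar>" by (intro zdvd_antisym_abs)
  moreover have "d dvd d' * c" "d' dvd c' * d" using assms(3) by (metis dvd_triv_right, metis dvd_triv_left)
  then have "d dvd d'" "d' dvd d" using assms(1,2)
    by (auto simp: coprime_dvd_mult_left_iff coprime_dvd_mult_right_iff coprime_commute)
  then have "\<bar>d'\<bar> = \<bar>d\<bar>" by (intro zdvd_antisym_abs)
  ultimately show ?thesis using assms by (auto simp: abs_if split: if_splits)
qed

lemma bij_betw_row_cosets:
  "bij_betw (\<lambda>(c, d). Gamma_inf #>\<^bsub>SL2Z\<^esub> row_matrix c d) row_index (rcosets\<^bsub>SL2Z\<^esub> Gamma_inf)"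
  unfolding bij_betw_def
proof
  show "inj_on (\<lambda>(c, d). Gamma_inf #>\<^bsub>SL2Z\<^esub> row_matrix c d) row_index"
  proof (rule inj_onI, clarify)
    fix c d c' d' assume i: "(c, d) \<in> row_index" "(c', d') \<in> row_index"
      and eq: "Gamma_inf #>\<^bsub>SL2Z\<^esub> row_matrix c d = Gamma_inf #>\<^bsub>SL2Z\<^esub> row_matrix c' d'"
    have co: "coprime c d" "coprime c' d'" using i by (auto simp: row_index_def)
    have "row_matrix c d \<in> Gamma_inf #>\<^bsub>SL2Z\<^esub> row_matrix c d"
      using row_matrix[OF co(1)] by (simp add: r_coset_Gamma_inf mult.commute)
    then have "c * d' = d * c'"
      unfolding eq using row_matrix[OF co(1)] row_matrix[OF co(2)] by (simp add: r_coset_Gamma_inf)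
    then show "c = c' \<and> d = d'"
      using proportional_coprime[OF co(2,1)] i by (auto simp: row_index_def)
  qed
  show "(\<lambda>(c, d). Gamma_inf #>\<^bsub>SL2Z\<^esub> row_matrix c d) ` row_index = rcosets\<^bsub>SL2Z\<^esub> Gamma_inf"
  proof (intro equalityI subsetI)
    fix C assume "C \<in> (\<lambda>(c, d). Gamma_inf #>\<^bsub>SL2Z\<^esub> row_matrix c d) ` row_index"
    then show "C \<in> rcosets\<^bsub>SL2Z\<^esub> Gamma_inf"
      using row_matrix(1) by (auto simp: RCOSETS_def row_index_def)
  next
    fix C assume "C \<in> rcosets\<^bsub>SL2Z\<^esub> Gamma_inf"
    then obtain A where A: "A \<in> carrier SL2Z" "C = Gamma_inf #>\<^bsub>SL2Z\<^esub> A" by (auto simp: RCOSETS_def)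
    define c d where "c = A $ 2 $ 1" and "d = A $ 2 $ 2"
    have co: "coprime c d" using coprime_bottom_row[OF A(1)] by (simp add: c_def d_def)
    \<comment> \<open>The sign that brings the bottom row into \<open>row_index\<close>; for c = 0
      coprimality leaves d = 1 or d = -1.\<close>
    define e where "e = (if c > 0 \<or> c = 0 \<and> d > 0 then 1 else -1 :: int)"
    have e: "e = 1 \<or> e = -1" by (simp add: e_def)
    have "(e * c, e * d) \<in> row_index"
      using co by (auto simp: row_index_def e_def)
    moreover have "C = Gamma_inf #>\<^bsub>SL2Z\<^esub> row_matrix (e * c) (e * d)"
    proof -
      have "coprime (e * c) (e * d)" using co e by auto
      then show ?thesis using row_matrix[of "e * c" "e * d"] e A
        by (auto simp: r_coset_Gamma_inf c_def d_def)
    qed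
    ultimately show "C \<in> (\<lambda>(c, d). Gamma_inf #>\<^bsub>SL2Z\<^esub> row_matrix c d) ` row_index" by auto
  qed
qed

text \<open>\<open>phi_slash_Gamma_inf\<close> makes the summand independent of the representative,
  so the choice inside the coset may be replaced by \<open>row_matrix\<close>.\<close>

lemma poincare_series_rows:
  assumes k: "even k" and z: "Im z > 0"
  shows "poincare_series k m z s = (\<Sum>\<^sub>\<infinity>p\<in>row_index. slash k (\<lambda>w. phi k m w s) (row_matrix (fst p) (snd p)) z)"
proof -
  let ?f = "\<lambda>C. slash k (\<lambda>w. phi k m w s) (SOME A. A \<in> C) z"
  let ?h = "\<lambda>(c, d). Gamma_inf #>\<^bsub>SL2Z\<^esub> row_matrix c d"
  have "poincare_series k m z s = (\<Sum>\<^sub>\<infinity>p\<in>row_index. ?f (?h p))"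
    unfolding poincare_series_def by (rule infsum_reindex_bij_betw[OF bij_betw_row_cosets, symmetric])
  also have "\<dots> = (\<Sum>\<^sub>\<infinity>p\<in>row_index. slash k (\<lambda>w. phi k m w s) (row_matrix (fst p) (snd p)) z)"
  proof (rule infsum_cong)
    fix p assume "p \<in> row_index"
    then have R: "row_matrix (fst p) (snd p) \<in> carrier SL2Z" by (auto simp: row_index_def intro: row_matrix)
    have "(SOME A. A \<in> ?h p) \<in> ?h p"
      by (rule someI[of _ "row_matrix (fst p) (snd p)"])
        (use R in \<open>simp add: r_coset_Gamma_inf case_prod_unfold mult.commute\<close>)
    then obtain T where "T \<in> Gamma_inf" "(SOME A. A \<in> ?h p) = T ** row_matrix (fst p) (snd p)"
      by (auto simp: r_coset_def SL2Z_def case_prod_unfold)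
    then show "?f (?h p) = slash k (\<lambda>w. phi k m w s) (row_matrix (fst p) (snd p)) z"
      using phi_slash_Gamma_inf[OF k R _ z] by simp
  qed
  finally show ?thesis .
qed

section \<open>Lattice sums\<close>

text \<open>For complex x and y the extension of the conjugate of cz + d is a separate function,
  \<open>lin_minus\<close>. The product of the two extends |cz + d|^2.\<close>

definition lin_plus :: "int \<Rightarrow> int \<Rightarrow> complex \<Rightarrow> complex \<Rightarrow> complex" where
  "lin_plus c d x y = of_int c * x + of_int d + \<i> * of_int c * y"

definition lin_minus :: "int \<Rightarrow> int \<Rightarrow> complex \<Rightarrow> complex \<Rightarrow> complex" where
  "lin_minus c d x y = of_int c * x + of_int d - \<i> * of_int c * y"

definition row_norm :: "int \<Rightarrow> int \<Rightarrow> real \<Rightarrow> real \<Rightarrow> real" where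
  "row_norm c d x y = (of_int c * x + of_int d)\<^sup>2 + (of_int c * y)\<^sup>2"

text \<open>The complexification of \<open>z \<mapsto> Im (\<gamma> z)\<close> in the two real coordinates of \<open>z\<close>.\<close>
definition im_part :: "int \<Rightarrow> int \<Rightarrow> complex \<Rightarrow> complex \<Rightarrow> complex" where
  "im_part c d x y = y / (lin_plus c d x y * lin_minus c d x y)"

lemma lin_plus_of_real: "lin_plus c d (of_real x) (of_real y) = of_int c * Complex x y + of_int d"
  by (simp add: lin_plus_def Complex_eq algebra_simps)

lemma lin_minus_of_real: "lin_minus c d (of_real x) (of_real y) = cnj (lin_plus c d (of_real x) (of_real y))"
  by (simp add: lin_minus_def lin_plus_def)

lemma norm_lin_plus_sq: "(norm (lin_plus c d (of_real x) (of_real y)))\<^sup>2 = row_norm c d x y"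
  by (simp add: lin_plus_def row_norm_def cmod_power2)

lemma lin_plus_mult_lin_minus_of_real:
  "lin_plus c d (of_real x) (of_real y) * lin_minus c d (of_real x) (of_real y) = of_real (row_norm c d x y)"
  unfolding lin_minus_of_real norm_lin_plus_sq[symmetric] by (rule complex_norm_square[symmetric])

lemma row_norm_pos:
  assumes "y > 0" "(c, d) \<noteq> (0, 0)" shows "row_norm c d x y > 0"
proof (cases "c = 0")
  case False
  then have "(of_int c * y)\<^sup>2 > 0" using assms(1) by simp
  then show ?thesis unfolding row_norm_def by (intro add_nonneg_pos) auto
qed (use assms in \<open>auto simp: row_norm_def\<close>)

lemma row_norm_ge:
  assumes "y > 0" "(c, d) \<noteq> (0, 0)" shows "row_norm c d x y \<ge> min 1 (y\<^sup>2)"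
proof (cases "c = 0")
  case False
  then have "1 * y\<^sup>2 \<le> (real_of_int c)\<^sup>2 * y\<^sup>2"
    by (intro mult_right_mono) (auto simp: abs_square_le_1 [symmetric] simp flip: of_int_power intro!: int_one_le_iff_zero_less[THEN iffD2])
  then have "y\<^sup>2 \<le> (of_int c * y)\<^sup>2" by (simp add: power_mult_distrib)
  then show ?thesis unfolding row_norm_def by (smt (verit) zero_le_power2 min.cobounded2)
next
  case True
  then have "d \<noteq> 0" using assms by auto
  then have "1 \<le> (real_of_int d)\<^sup>2" by (simp flip: of_int_power add: int_one_le_iff_zero_less)
  then show ?thesis using True by (simp add: row_norm_def)
qed

text \<open>With J0 the value at the centre, the perturbation is at most |c| y0/16 = |Im J0|/16 <=
  |J0|/16, a relative error free of c and d. One polydisc therefore serves all rows; the radius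
  y0/32 is chosen for this.\<close>

lemma lin_near:
  assumes y0: "y0 > 0" and cd: "(c, d) \<noteq> (0, 0)"
    and x: "norm (x - of_real x0) < y0 / 32" and y: "norm (y - of_real y0) < y0 / 32"
  obtains u where "lin_plus c d x y = lin_plus c d (of_real x0) (of_real y0) * (1 + u)" "norm u \<le> 1/16"
    "lin_plus c d (of_real x0) (of_real y0) \<noteq> 0"
proof -
  let ?J0 = "lin_plus c d (of_real x0) (of_real y0)"
  have J0: "?J0 \<noteq> 0" using row_norm_pos[OF y0 cd, of x0] norm_lin_plus_sq[of c d x0 y0] by auto
  have "norm (lin_plus c d x y - ?J0) = norm (of_int c * ((x - of_real x0) + \<i> * (y - of_real y0)))"
    by (simp add: lin_plus_def algebra_simps)
  also have "\<dots> \<le> \<bar>of_int c\<bar> * (norm (x - of_real x0) + norm (y - of_real y0))"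
    unfolding norm_mult norm_of_int
    by (intro mult_left_mono order.trans[OF norm_triangle_ineq]) (auto simp: norm_mult)
  also have "\<dots> \<le> \<bar>of_int c\<bar> * (y0 / 16)" using x y by (intro mult_left_mono) auto
  also have "\<dots> = \<bar>Im ?J0\<bar> / 16" using y0 by (simp add: lin_plus_def abs_mult)
  also have "\<dots> \<le> norm ?J0 / 16" using abs_Im_le_cmod by (intro divide_right_mono) auto
  finally have "norm ((lin_plus c d x y - ?J0) / ?J0) \<le> 1/16" using J0 by (simp add: norm_divide divide_le_eq)
  moreover have "lin_plus c d x y = ?J0 * (1 + (lin_plus c d x y - ?J0) / ?J0)" using J0 by (simp add: field_simps)
  ultimately show ?thesis using that J0 by blast
qed

lemma lin_minus_eq_cnj: "lin_minus c d x y = cnj (lin_plus c d (cnj x) (cnj y))"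
  by (simp add: lin_minus_def lin_plus_def)

text \<open>Relative errors 1/16 in each linear factor and 1/32 in y combine: the denominator is 1 +
  e with |e| <= 9/64, and (1/32 + 9/64)/(55/64) = 1/5 < 1/4. The resulting bound keeps
  \<open>im_part\<close> away from the branch cut.\<close>

lemma im_part_near:
  assumes y0: "y0 > 0" and cd: "(c, d) \<noteq> (0, 0)"
    and x: "norm (x - of_real x0) < y0 / 32" and y: "norm (y - of_real y0) < y0 / 32"
  defines "r \<equiv> row_norm c d x0 y0"
  shows "\<exists>\<rho>. im_part c d x y = of_real (y0 / r) * (1 + \<rho>) \<and> norm \<rho> \<le> 1/4"
    and "15/16 * sqrt r \<le> norm (lin_plus c d x y)" "norm (lin_plus c d x y) \<le> 17/16 * sqrt r"
    and "15/16 * sqrt r \<le> norm (lin_minus c d x y)" "norm (lin_minus c d x y) \<le> 17/16 * sqrt r"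
proof -
  let ?J0 = "lin_plus c d (of_real x0) (of_real y0)"
  have sq: "sqrt r = norm ?J0" unfolding r_def norm_lin_plus_sq[symmetric] by simp
  have r: "r > 0" unfolding r_def by (rule row_norm_pos[OF y0 cd])
  obtain u where u: "lin_plus c d x y = ?J0 * (1 + u)" "norm u \<le> 1/16" "?J0 \<noteq> 0"
    by (rule lin_near[OF y0 cd x y])
  \<comment> \<open>\<open>lin_minus\<close> is handled as the conjugate of \<open>lin_plus\<close>
    at the conjugate point, which is equally close to the real centre.\<close>
  have "cnj x - of_real x0 = cnj (x - of_real x0)" "cnj y - of_real y0 = cnj (y - of_real y0)" by simp_all
  then have x': "norm (cnj x - of_real x0) < y0 / 32" and y': "norm (cnj y - of_real y0) < y0 / 32"
    using x y by (simp_all only: complex_mod_cnj)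
  obtain v' where v': "lin_plus c d (cnj x) (cnj y) = ?J0 * (1 + v')" "norm v' \<le> 1/16"
    by (rule lin_near[OF y0 cd x' y'])
  define v where "v = cnj v'"
  have v: "lin_minus c d x y = cnj ?J0 * (1 + v)" "norm v \<le> 1/16"
    using v' by (simp_all add: lin_minus_eq_cnj v_def)
  have bd: "15/16 \<le> norm (1 + w) \<and> norm (1 + w) \<le> 17/16" if "norm w \<le> 1/16" for w :: complex
    using that norm_triangle_ineq[of 1 w] norm_diff_ineq[of 1 w] by simp
  show "15/16 * sqrt r \<le> norm (lin_plus c d x y)" "norm (lin_plus c d x y) \<le> 17/16 * sqrt r"
    unfolding sq u(1) norm_mult mult.commute[of "norm ?J0"] using bd[OF u(2)] by (intro mult_right_mono; simp)+
  show "15/16 * sqrt r \<le> norm (lin_minus c d x y)" "norm (lin_minus c d x y) \<le> 17/16 * sqrt r"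
    unfolding sq v(1) norm_mult complex_mod_cnj mult.commute[of "norm ?J0"] using bd[OF v(2)] by (intro mult_right_mono; simp)+
  define w where "w = (y - of_real y0) / of_real y0"
  have w: "y = of_real y0 * (1 + w)" "norm w \<le> 1/32"
    using y0 y by (simp_all add: w_def field_simps norm_divide)
  define e where "e = u + v + u * v"
  have e: "norm e \<le> 9/64"
  proof -
    have "norm e \<le> norm u + norm v + norm u * norm v"
      unfolding e_def norm_mult[symmetric] by (intro norm_triangle_le add_mono norm_triangle_ineq) auto
    also have "\<dots> \<le> 1/16 + 1/16 + 1/16 * (1/16)" using u v by (intro add_mono mult_mono) auto
    finally show ?thesis by simp
  qed
  have e1: "norm (1 + e) \<ge> 55/64" using e norm_diff_ineq[of 1 e] by simp
  then have e0: "1 + e \<noteq> 0" by auto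
  have JJ: "?J0 * cnj ?J0 = of_real r"
    unfolding r_def lin_plus_mult_lin_minus_of_real[symmetric] lin_minus_of_real ..
  have "im_part c d x y = of_real y0 * (1 + w) / (of_real r * (1 + e))"
  proof -
    have "lin_plus c d x y * lin_minus c d x y = (?J0 * cnj ?J0) * (1 + e)"
      unfolding u(1) v(1) e_def by (simp add: algebra_simps)
    then show ?thesis unfolding im_part_def JJ using w(1) by simp
  qed
  also have "\<dots> = of_real (y0 / r) * (1 + (w - e) / (1 + e))"
    using e0 r by (simp add: field_simps)
  finally have "im_part c d x y = of_real (y0 / r) * (1 + (w - e) / (1 + e))" .
  moreover have "norm ((w - e) / (1 + e)) \<le> 1/4"
  proof -
    have "norm (w - e) \<le> 1/32 + 9/64" using w e norm_triangle_ineq4[of w e] by simp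
    then have "norm (w - e) \<le> 1/4 * norm (1 + e)" using e1 by simp
    then show ?thesis using e0 by (simp add: norm_divide divide_le_eq)
  qed
  ultimately show "\<exists>\<rho>. im_part c d x y = of_real (y0 / r) * (1 + \<rho>) \<and> norm \<rho> \<le> 1/4" by blast
qed

lemma near_real_not_nonpos:
  fixes \<rho> :: complex
  assumes "r > 0" "norm \<rho> \<le> 1/4"
  shows "of_real r * (1 + \<rho>) \<notin> \<real>\<^sub>\<le>\<^sub>0" "norm (of_real r * (1 + \<rho>)) \<le> 5/4 * r" "3/4 * r \<le> norm (of_real r * (1 + \<rho>))"
proof -
  have "Re (1 + \<rho>) > 0" using abs_Re_le_cmod[of \<rho>] assms(2) by simp
  then have "Re (of_real r * (1 + \<rho>)) > 0" using assms(1) by simp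
  then show "of_real r * (1 + \<rho>) \<notin> \<real>\<^sub>\<le>\<^sub>0" by (auto simp: complex_nonpos_Reals_iff)
  have "norm (1 + \<rho>) \<le> 5/4" "3/4 \<le> norm (1 + \<rho>)"
    using norm_triangle_ineq[of 1 \<rho>] norm_diff_ineq[of 1 \<rho>] assms(2) by simp_all
  then show "norm (of_real r * (1 + \<rho>)) \<le> 5/4 * r" "3/4 * r \<le> norm (of_real r * (1 + \<rho>))"
    using assms(1) by (simp_all add: norm_mult mult.commute)
qed

text \<open>Off the positive axis the argument of w enters; it is at most pi in absolute value,
  whence the second factor.\<close>

lemma norm_powr_complex_le:
  assumes "w \<noteq> 0"
  shows "norm (w powr s) \<le> norm w powr Re s * exp (pi * norm s)"
proof -
  have "norm (w powr s) = exp (Re s * ln (norm w) - Im s * Im (Ln w))"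
    using assms by (simp add: powr_def)
  also have "\<dots> = norm w powr Re s * exp (- (Im s * Im (Ln w)))"
    using assms by (simp add: powr_def exp_diff exp_minus divide_inverse)
  also have "\<dots> \<le> norm w powr Re s * exp (pi * norm s)"
  proof (intro mult_left_mono, subst exp_le_cancel_iff)
    have "- (Im s * Im (Ln w)) \<le> \<bar>Im s\<bar> * \<bar>Im (Ln w)\<bar>" by (metis abs_ge_minus_self abs_mult)
    also have "\<dots> \<le> norm s * pi"
      using assms mpi_less_Im_Ln[of w] Im_Ln_le_pi[of w] by (intro mult_mono abs_Im_le_cmod) auto
    finally show "- (Im s * Im (Ln w)) \<le> pi * norm s" by (simp add: mult.commute)
  qed auto
  finally show ?thesis .
qed

text \<open>Lets the exponent range over an interval: powers with t < 1 and with 1 <= t <= L are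
  both controlled by the lowest exponent.\<close>

lemma powr_le_powr_base:
  fixes t :: real
  assumes "0 < t" "t \<le> L" "1 \<le> L" "\<sigma>1 \<le> \<sigma>" "\<sigma> \<le> \<sigma>2"
  shows "t powr \<sigma> \<le> L powr (\<sigma>2 - \<sigma>1) * t powr \<sigma>1"
proof -
  have "t powr (\<sigma> - \<sigma>1) \<le> L powr (\<sigma> - \<sigma>1)" using assms by (intro powr_mono2) auto
  also have "\<dots> \<le> L powr (\<sigma>2 - \<sigma>1)" using assms by (intro powr_mono) auto
  finally have "t powr (\<sigma> - \<sigma>1) * t powr \<sigma>1 \<le> L powr (\<sigma>2 - \<sigma>1) * t powr \<sigma>1" by (intro mult_right_mono) auto
  then show ?thesis by (simp flip: powr_add)
qed

section \<open>Summable majorants on the lattice\<close>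

definition int_weight :: "real \<Rightarrow> int \<Rightarrow> real" where
  "int_weight \<sigma> n = (1 + \<bar>real_of_int n\<bar>) powr (- \<sigma>)"

lemma int_weight_nonneg [simp]: "int_weight \<sigma> n \<ge> 0" by (simp add: int_weight_def)

lemma summable_int_weight:
  assumes "\<sigma> > 1" shows "int_weight \<sigma> summable_on UNIV"
proof -
  have "summable (\<lambda>n. of_nat n powr (- \<sigma>) :: real)" using assms by (simp add: summable_real_powr_iff)
  then have "summable (\<lambda>n. real (Suc n) powr (- \<sigma>))" by (subst summable_Suc_iff)
  then have 1: "(\<lambda>n. real (Suc n) powr (- \<sigma>)) summable_on UNIV"
    by (intro norm_summable_imp_summable_on) simp
  have "int_weight \<sigma> summable_on range int"
    by (subst summable_on_reindex) (use 1 in \<open>auto simp: o_def int_weight_def inj_on_def add_ac\<close>)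
  moreover have "int_weight \<sigma> summable_on range (\<lambda>n. - int n)"
    by (subst summable_on_reindex) (use 1 in \<open>auto simp: o_def int_weight_def inj_on_def add_ac\<close>)
  moreover have "range int \<union> range (\<lambda>n. - int n) = UNIV"
    by (auto simp: image_iff) (metis int_cases2)
  ultimately show ?thesis using summable_on_union by metis
qed

text \<open>The product form reduces summability over pairs to the one-dimensional series.\<close>

definition pair_weight :: "real \<Rightarrow> int \<times> int \<Rightarrow> real" where
  "pair_weight \<sigma> p = int_weight \<sigma> (fst p) * int_weight \<sigma> (snd p)"

lemma pair_weight_nonneg [simp]: "pair_weight \<sigma> p \<ge> 0" by (simp add: pair_weight_def)

lemma summable_pair_weight:
  assumes "\<sigma> > 1" shows "pair_weight \<sigma> summable_on A"
proof -
  have "pair_weight \<sigma> summable_on (SIGMA x:UNIV. UNIV)"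
  proof (rule summable_on_SigmaI)
    show "((\<lambda>y. pair_weight \<sigma> (x, y)) has_sum int_weight \<sigma> x * infsum (int_weight \<sigma>) UNIV) UNIV" for x
      unfolding pair_weight_def using summable_int_weight[OF assms]
      by (auto intro!: has_sum_cmult_right has_sum_infsum)
    show "(\<lambda>x. int_weight \<sigma> x * infsum (int_weight \<sigma>) UNIV) summable_on UNIV"
      by (intro summable_on_cmult_left summable_int_weight assms)
  qed simp
  then show ?thesis by (rule summable_on_subset_banach) auto
qed

definition lattice_const :: "real \<Rightarrow> real \<Rightarrow> real" where
  "lattice_const X y = 4 * (2 + (1 + 2 * X\<^sup>2) / y\<^sup>2)"

text \<open>Write d = (cx + d) - cx: then d^2 <= 2 (cx + d)^2 + 2 c^2 X^2, and c^2 is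
  (cy)^2/y^2.\<close>

lemma sq_sum_le_row_norm:
  assumes y: "y > 0" and x: "\<bar>x\<bar> \<le> X"
  shows "(real_of_int c)\<^sup>2 + (real_of_int d)\<^sup>2 \<le> (2 + (1 + 2 * X\<^sup>2) / y\<^sup>2) * row_norm c d x y"
proof -
  define C D where "C = real_of_int c" and "D = real_of_int d"
  define E where "E = C * x + D"
  have D: "D = E - C * x" by (simp add: E_def)
  have "D\<^sup>2 \<le> 2 * E\<^sup>2 + 2 * (C\<^sup>2 * x\<^sup>2)"
    unfolding D using zero_le_power2[of "E + C * x"] by (simp add: power2_eq_square algebra_simps)
  moreover have "C\<^sup>2 * x\<^sup>2 \<le> C\<^sup>2 * X\<^sup>2" using x by (intro mult_left_mono) (auto simp: abs_le_square_iff[symmetric])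
  ultimately have "C\<^sup>2 + D\<^sup>2 \<le> 2 * E\<^sup>2 + (1 + 2 * X\<^sup>2) * C\<^sup>2" by (simp add: algebra_simps)
  also have "(1 + 2 * X\<^sup>2) * C\<^sup>2 = (1 + 2 * X\<^sup>2) / y\<^sup>2 * (C * y)\<^sup>2" using y by (simp add: power_mult_distrib)
  also have "2 * E\<^sup>2 + (1 + 2 * X\<^sup>2) / y\<^sup>2 * (C * y)\<^sup>2 \<le> (2 + (1 + 2 * X\<^sup>2) / y\<^sup>2) * (E\<^sup>2 + (C * y)\<^sup>2)"
    unfolding distrib_left distrib_right by (simp add: add_nonneg_nonneg)
  finally show ?thesis by (simp add: row_norm_def E_def C_def D_def)
qed

text \<open>For integers |c| <= c^2, and |cd| <= c^2 + d^2, so the quadratic form dominates the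
  product. Expanding the product costs at most 4 (c^2 + d^2), which is the 4 in
  \<open>lattice_const\<close>.\<close>

lemma row_norm_lower:
  assumes y: "y > 0" and x: "\<bar>x\<bar> \<le> X" and cd: "(c, d) \<noteq> (0, 0)"
  shows "(1 + \<bar>real_of_int c\<bar>) * (1 + \<bar>real_of_int d\<bar>) \<le> lattice_const X y * row_norm c d x y"
proof -
  define C D where "C = real_of_int c" and "D = real_of_int d"
  have sq: "\<bar>C\<bar> \<le> C\<^sup>2" "\<bar>D\<bar> \<le> D\<^sup>2"
  proof -
    have "\<bar>n\<bar> \<le> n\<^sup>2" for n :: int
    proof (cases "n = 0")
      case False
      then have "\<bar>n\<bar> * 1 \<le> \<bar>n\<bar> * \<bar>n\<bar>" by (intro mult_left_mono) auto
      then show ?thesis by (simp add: power2_eq_square flip: abs_mult)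
    qed auto
    then show "\<bar>C\<bar> \<le> C\<^sup>2" "\<bar>D\<bar> \<le> D\<^sup>2"
      unfolding C_def D_def by (metis of_int_abs of_int_le_iff of_int_power)+
  qed
  have one: "1 \<le> C\<^sup>2 + D\<^sup>2"
  proof (cases "c = 0")
    case True
    then have "1 \<le> \<bar>D\<bar>" using cd by (auto simp: D_def)
    then show ?thesis using sq(2) by (smt (verit) zero_le_power2)
  next
    case False
    then have "1 \<le> \<bar>C\<bar>" by (auto simp: C_def)
    then show ?thesis using sq(1) by (smt (verit) zero_le_power2)
  qed
  have CD: "\<bar>C\<bar> * \<bar>D\<bar> \<le> C\<^sup>2 + D\<^sup>2"
  proof -
    have "2 * \<bar>C\<bar> * \<bar>D\<bar> \<le> C\<^sup>2 + D\<^sup>2"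
      using sum_squares_bound[of "\<bar>C\<bar>" "\<bar>D\<bar>"] by (simp only: power2_abs)
    moreover have "0 \<le> \<bar>C\<bar> * \<bar>D\<bar>" by (intro mult_nonneg_nonneg abs_ge_zero)
    ultimately show ?thesis by linarith
  qed
  have "(1 + a) * (1 + b) = 1 + a + b + a * b" for a b :: real by (simp add: algebra_simps)
  then have "(1 + \<bar>C\<bar>) * (1 + \<bar>D\<bar>) = 1 + \<bar>C\<bar> + \<bar>D\<bar> + \<bar>C\<bar> * \<bar>D\<bar>" .
  also have "\<dots> \<le> 4 * (C\<^sup>2 + D\<^sup>2)"
  proof -
    have "1 + \<bar>C\<bar> + \<bar>D\<bar> + \<bar>C\<bar> * \<bar>D\<bar> \<le> (C\<^sup>2 + D\<^sup>2) + C\<^sup>2 + D\<^sup>2 + (C\<^sup>2 + D\<^sup>2)"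
      by (intro add_mono sq one CD)
    also have "\<dots> = 3 * (C\<^sup>2 + D\<^sup>2)" by simp
    also have "\<dots> \<le> 4 * (C\<^sup>2 + D\<^sup>2)" by (intro mult_right_mono) auto
    finally show ?thesis .
  qed
  also have "C\<^sup>2 + D\<^sup>2 \<le> (2 + (1 + 2 * X\<^sup>2) / y\<^sup>2) * row_norm c d x y"
    unfolding C_def D_def by (rule sq_sum_le_row_norm[OF y x])
  finally show ?thesis by (simp only: lattice_const_def C_def D_def mult.assoc)
qed

lemma row_norm_powr_le:
  assumes y: "y > 0" and x: "\<bar>x\<bar> \<le> X" and cd: "(c, d) \<noteq> (0, 0)" and \<sigma>: "\<sigma> \<ge> 0"
  shows "(y / row_norm c d x y) powr \<sigma> \<le> (y * lattice_const X y) powr \<sigma> * pair_weight \<sigma> (c, d)"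
proof -
  let ?w = "(1 + \<bar>real_of_int c\<bar>) * (1 + \<bar>real_of_int d\<bar>)"
  have w: "?w > 0" by (intro mult_pos_pos) auto
  have r: "row_norm c d x y > 0" by (rule row_norm_pos[OF y cd])
  have "y / row_norm c d x y \<le> y * lattice_const X y / ?w"
    using row_norm_lower[OF y x cd] w r y by (simp add: divide_le_eq le_divide_eq mult.commute mult.left_commute)
  then have "(y / row_norm c d x y) powr \<sigma> \<le> (y * lattice_const X y / ?w) powr \<sigma>"
    using y r \<sigma> by (intro powr_mono2) auto
  also have "\<dots> = (y * lattice_const X y) powr \<sigma> / ?w powr \<sigma>"
    by (rule powr_divide)
  also have "?w powr \<sigma> = (1 + \<bar>real_of_int c\<bar>) powr \<sigma> * (1 + \<bar>real_of_int d\<bar>) powr \<sigma>"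
    by (rule powr_mult)
  also have "(y * lattice_const X y) powr \<sigma> / \<dots> = (y * lattice_const X y) powr \<sigma> * pair_weight \<sigma> (c, d)"
    by (simp add: pair_weight_def int_weight_def powr_minus_divide)
  finally show ?thesis .
qed

section \<open>Complexified summands and their size\<close>

lemma holomorphic_lin_plus [holomorphic_intros]:
  "X holomorphic_on B \<Longrightarrow> Y holomorphic_on B \<Longrightarrow> (\<lambda>u. lin_plus c d (X u) (Y u)) holomorphic_on B"
  unfolding lin_plus_def by (intro holomorphic_intros)

lemma holomorphic_lin_minus [holomorphic_intros]:
  "X holomorphic_on B \<Longrightarrow> Y holomorphic_on B \<Longrightarrow> (\<lambda>u. lin_minus c d (X u) (Y u)) holomorphic_on B"
  unfolding lin_minus_def by (intro holomorphic_intros)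

definition near_point :: "real \<Rightarrow> real \<Rightarrow> complex \<Rightarrow> complex \<Rightarrow> bool" where
  "near_point x0 y0 x y \<longleftrightarrow> norm (x - of_real x0) < y0 / 32 \<and> norm (y - of_real y0) < y0 / 32"

lemma near_point_nonzero:
  assumes "y0 > 0" "(c, d) \<noteq> (0, 0)" "near_point x0 y0 x y"
  shows "lin_plus c d x y \<noteq> 0" "lin_minus c d x y \<noteq> 0"
  using im_part_near(2,4)[OF assms(1,2), of x x0 y] assms(3) row_norm_pos[OF assms(1,2), of x0]
  by (auto simp: near_point_def)

lemma near_point_im_part:
  assumes "y0 > 0" "(c, d) \<noteq> (0, 0)" "near_point x0 y0 x y" "a > 0"
  shows "of_real a * im_part c d x y \<notin> \<real>\<^sub>\<le>\<^sub>0"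
    and "norm (of_real a * im_part c d x y) \<le> 5/4 * (a * (y0 / row_norm c d x0 y0))"
    and "3/4 * (a * (y0 / row_norm c d x0 y0)) \<le> norm (of_real a * im_part c d x y)"
proof -
  obtain \<rho> where \<rho>: "im_part c d x y = of_real (y0 / row_norm c d x0 y0) * (1 + \<rho>)" "norm \<rho> \<le> 1/4"
    using im_part_near(1)[OF assms(1,2), of x x0 y] assms(3) by (auto simp: near_point_def)
  have "a * (y0 / row_norm c d x0 y0) > 0" using assms row_norm_pos[OF assms(1,2), of x0] by simp
  note * = near_real_not_nonpos[OF this \<rho>(2)]
  have eq: "of_real a * im_part c d x y = of_real (a * (y0 / row_norm c d x0 y0)) * (1 + \<rho>)"
    unfolding \<rho>(1) by simp
  show "of_real a * im_part c d x y \<notin> \<real>\<^sub>\<le>\<^sub>0"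
    "norm (of_real a * im_part c d x y) \<le> 5/4 * (a * (y0 / row_norm c d x0 y0))"
    "3/4 * (a * (y0 / row_norm c d x0 y0)) \<le> norm (of_real a * im_part c d x y)"
    unfolding eq by (rule *)+
qed

text \<open>The complexification of Re(gamma z), the companion of \<open>im_part\<close>.\<close>

definition re_part :: "int^2^2 \<Rightarrow> complex \<Rightarrow> complex \<Rightarrow> complex" where
  "re_part A x y = ((of_int (A $ 1 $ 1) * x + of_int (A $ 1 $ 2)) * (of_int (A $ 2 $ 1) * x + of_int (A $ 2 $ 2)) +
     of_int (A $ 1 $ 1) * of_int (A $ 2 $ 1) * y\<^sup>2) /
     (lin_plus (A $ 2 $ 1) (A $ 2 $ 2) x y * lin_minus (A $ 2 $ 1) (A $ 2 $ 2) x y)"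

text \<open>The holomorphic extension of the slashed summand, with \<open>phi\<close> in the form of
  \<open>phi_eq_psi\<close>; \<open>slash_term_of_real\<close> identifies it at real points.\<close>

definition slash_term :: "int \<Rightarrow> int \<Rightarrow> int^2^2 \<Rightarrow> complex \<Rightarrow> complex \<Rightarrow> complex \<Rightarrow> complex" where
  "slash_term k m A x y s = lin_plus (A $ 2 $ 1) (A $ 2 $ 2) x y powi (- k) *
     (of_real (\<bar>real_of_int m\<bar> powr (of_int k/2)) *
      psi (s - of_int k/2) (s - of_int (sgn m) * of_int k/2) (2 * s)
        (of_real (4 * pi * \<bar>real_of_int m\<bar>) * im_part (A $ 2 $ 1) (A $ 2 $ 2) x y) *
      exp (2 * of_real pi * \<i> * of_int m * re_part A x y))"

lemma slash_term_of_real: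
  assumes A: "A \<in> carrier SL2Z" and y: "y > 0" and m: "m \<noteq> 0"
  shows "slash k (\<lambda>w. phi k m w s) A (Complex x y) = slash_term k m A (of_real x) (of_real y) s"
proof -
  let ?z = "Complex x y"
  define c d where "c = A $ 2 $ 1" and "d = A $ 2 $ 2"
  have J: "lin_plus c d (of_real x) (of_real y) = of_int c * ?z + of_int d" by (rule lin_plus_of_real)
  have N: "lin_plus c d (of_real x) (of_real y) * lin_minus c d (of_real x) (of_real y) = of_real (row_norm c d x y)"
    by (rule lin_plus_mult_lin_minus_of_real)
  have n: "(norm (of_int c * ?z + of_int d))\<^sup>2 = row_norm c d x y"
    unfolding J[symmetric] by (rule norm_lin_plus_sq)
  have im: "of_real (Im (moebius_action A ?z)) = im_part c d (of_real x) (of_real y)"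
    using moebius_action_eqs(1)[OF A, of ?z] y n unfolding im_part_def N by (simp add: c_def d_def)
  have "Im (moebius_action A ?z) > 0"
    using moebius_action_eqs(1)[OF A, of ?z] SL2Z_denominator_nonzero[OF A, of ?z] y by simp
  note phi = phi_eq_psi[OF this m, of k s]
  have "moebius_action A ?z = (of_int (A $ 1 $ 1) * ?z + of_int (A $ 1 $ 2)) * cnj (of_int c * ?z + of_int d) / of_real (row_norm c d x y)"
    unfolding moebius_action_def c_def[symmetric] d_def[symmetric]
    by (subst complex_div_cnj) (simp only: n flip: of_real_power)
  then have "Re (moebius_action A ?z) = Re ((of_int (A $ 1 $ 1) * ?z + of_int (A $ 1 $ 2)) * cnj (of_int c * ?z + of_int d)) / row_norm c d x y"
    by simp
  also have "Re ((of_int (A $ 1 $ 1) * ?z + of_int (A $ 1 $ 2)) * cnj (of_int c * ?z + of_int d)) =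
     (of_int (A $ 1 $ 1) * x + of_int (A $ 1 $ 2)) * (of_int c * x + of_int d) + of_int (A $ 1 $ 1) * of_int c * y\<^sup>2"
    by (simp add: power2_eq_square)
  finally have re: "of_real (Re (moebius_action A ?z)) = re_part A (of_real x) (of_real y)"
    unfolding re_part_def c_def[symmetric] d_def[symmetric] N by simp
  show ?thesis
    unfolding slash_def phi slash_term_def of_real_mult im re c_def[symmetric] d_def[symmetric] J
    by simp
qed

lemma bottom_row_nonzero: "A \<in> carrier SL2Z \<Longrightarrow> (A $ 2 $ 1, A $ 2 $ 2) \<noteq> (0, 0)"
  by (auto simp: SL2Z_iff)

lemma holomorphic_slash_term:
  assumes A: "A \<in> carrier SL2Z" and y0: "y0 > 0" and m: "m \<noteq> 0" and B: "open B"
    and hol: "X holomorphic_on B" "Y holomorphic_on B" "S holomorphic_on B"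
    and near: "\<And>u. u \<in> B \<Longrightarrow> near_point x0 y0 (X u) (Y u)" and S: "\<And>u. u \<in> B \<Longrightarrow> Re (S u) \<ge> 1/2"
  shows "(\<lambda>u. slash_term k m A (X u) (Y u) (S u)) holomorphic_on B"
proof -
  let ?c = "A $ 2 $ 1" and ?d = "A $ 2 $ 2"
  have nz: "lin_plus ?c ?d (X u) (Y u) \<noteq> 0" "lin_minus ?c ?d (X u) (Y u) \<noteq> 0" if "u \<in> B" for u
    using near_point_nonzero[OF y0 bottom_row_nonzero[OF A] near[OF that]] by auto
  have "4 * pi * \<bar>real_of_int m\<bar> > 0" using m by simp
  note np = near_point_im_part(1)[OF y0 bottom_row_nonzero[OF A] near this]
  have S': "Re (2 * S u) \<ge> 1" if "u \<in> B" for u using S[OF that] by simp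
  have im: "(\<lambda>u. im_part ?c ?d (X u) (Y u)) holomorphic_on B"
    unfolding im_part_def using nz hol by (intro holomorphic_intros) auto
  have re: "(\<lambda>u. re_part A (X u) (Y u)) holomorphic_on B"
    unfolding re_part_def using nz hol by (intro holomorphic_intros) auto
  show ?thesis
    unfolding slash_term_def psi_def
    by (intro holomorphic_intros hol im re B S' np disjI2 ballI nz) auto
qed

text \<open>From gamma z = a/c - 1/(c (cz + d)): take half the sum of this and its formal
  conjugate.\<close>

lemma re_part_diff:
  assumes A: "A \<in> carrier SL2Z" and c: "A $ 2 $ 1 \<noteq> 0"
    and nz: "lin_plus (A $ 2 $ 1) (A $ 2 $ 2) x y \<noteq> 0" "lin_minus (A $ 2 $ 1) (A $ 2 $ 2) x y \<noteq> 0"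
  shows "re_part A x y = of_int (A $ 1 $ 1) / of_int (A $ 2 $ 1) -
    (1 / lin_plus (A $ 2 $ 1) (A $ 2 $ 2) x y + 1 / lin_minus (A $ 2 $ 1) (A $ 2 $ 2) x y) / (2 * of_int (A $ 2 $ 1))"
proof -
  define a b c' d where "a = complex_of_int (A $ 1 $ 1)" and "b = complex_of_int (A $ 1 $ 2)"
    and "c' = complex_of_int (A $ 2 $ 1)" and "d = complex_of_int (A $ 2 $ 2)"
  define P Q where "P = lin_plus (A $ 2 $ 1) (A $ 2 $ 2) x y" and "Q = lin_minus (A $ 2 $ 1) (A $ 2 $ 2) x y"
  have det: "a * d - b * c' = 1" using A unfolding a_def b_def c'_def d_def SL2Z_iff by (simp flip: of_int_mult of_int_diff)
  have c': "c' \<noteq> 0" using c by (simp add: c'_def)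
  have PQ: "P \<noteq> 0" "Q \<noteq> 0" using nz by (simp_all add: P_def Q_def)
  have sum: "P + Q = 2 * (c' * x + d)" by (simp add: P_def Q_def lin_plus_def lin_minus_def c'_def d_def)
  have prod: "P * Q = (c' * x + d)\<^sup>2 + c'\<^sup>2 * y\<^sup>2"
    by (simp add: P_def Q_def lin_plus_def lin_minus_def c'_def[symmetric] d_def[symmetric] power2_eq_square algebra_simps)
  have E: "c' * ((a * x + b) * (c' * x + d) + a * c' * y\<^sup>2) = a * (P * Q) - (c' * x + d)"
  proof -
    have "b * c' = a * d - 1" using det by (simp add: algebra_simps)
    moreover have "c' * ((a * x + b) * (c' * x + d) + a * c' * y\<^sup>2) = (a * (c' * x) + b * c') * (c' * x + d) + a * c'\<^sup>2 * y\<^sup>2"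
      by (simp add: algebra_simps power2_eq_square)
    ultimately have "c' * ((a * x + b) * (c' * x + d) + a * c' * y\<^sup>2) = (a * (c' * x) + (a * d - 1)) * (c' * x + d) + a * c'\<^sup>2 * y\<^sup>2"
      by simp
    then show ?thesis unfolding prod by (simp add: algebra_simps power2_eq_square)
  qed
  have "((a * x + b) * (c' * x + d) + a * c' * y\<^sup>2) / (P * Q) = (c' * ((a * x + b) * (c' * x + d) + a * c' * y\<^sup>2)) / (c' * (P * Q))"
    using c' by simp
  also have "\<dots> = (a * (P * Q) - (P + Q) / 2) / (c' * (P * Q))"
  proof -
    have "(P + Q) / 2 = c' * x + d" unfolding sum by (simp del: distrib_left_numeral)
    then show ?thesis by (simp only: E)
  qed
  also have "\<dots> = a / c' - (1 / P + 1 / Q) / (2 * c')"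
    using c' PQ by (simp add: field_simps)
  finally show ?thesis
    by (simp add: re_part_def a_def b_def c'_def d_def P_def Q_def)
qed

lemma norm_re_part_diff:
  assumes A: "A \<in> carrier SL2Z" and c: "A $ 2 $ 1 \<noteq> 0" and y0: "y0 > 0" and near: "near_point x0 y0 x y"
  shows "norm (re_part A x y - of_int (A $ 1 $ 1) / of_int (A $ 2 $ 1)) \<le> 16/15 / sqrt (row_norm (A $ 2 $ 1) (A $ 2 $ 2) x0 y0)"
proof -
  let ?c = "A $ 2 $ 1" and ?d = "A $ 2 $ 2"
  let ?r = "row_norm ?c ?d x0 y0"
  have r: "sqrt ?r > 0" using row_norm_pos[OF y0 bottom_row_nonzero[OF A]] by simp
  note nz = near_point_nonzero[OF y0 bottom_row_nonzero[OF A] near]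
  have lb: "15/16 * sqrt ?r \<le> norm (lin_plus ?c ?d x y)" "15/16 * sqrt ?r \<le> norm (lin_minus ?c ?d x y)"
    using im_part_near(2,4)[OF y0 bottom_row_nonzero[OF A]] near by (auto simp: near_point_def)
  have inv: "norm (1 / w) \<le> 16/15 / sqrt ?r" if "15/16 * sqrt ?r \<le> norm w" for w :: complex
  proof -
    have "norm (1 / w) = 1 / norm w" by (simp add: norm_divide)
    also have "\<dots> \<le> 1 / (15/16 * sqrt ?r)" using that r by (intro frac_le) auto
    finally show ?thesis by simp
  qed
  have "norm (re_part A x y - of_int (A $ 1 $ 1) / of_int ?c) = norm (1 / lin_plus ?c ?d x y + 1 / lin_minus ?c ?d x y) / (2 * \<bar>real_of_int ?c\<bar>)"
    unfolding re_part_diff[OF A c nz] by (simp add: norm_divide norm_mult)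
  also have "\<dots> \<le> (16/15 / sqrt ?r + 16/15 / sqrt ?r) / 2"
  proof (rule frac_le)
    show "norm (1 / lin_plus ?c ?d x y + 1 / lin_minus ?c ?d x y) \<le> 16/15 / sqrt ?r + 16/15 / sqrt ?r"
      by (intro norm_triangle_le add_mono inv lb)
    have "1 \<le> \<bar>?c\<bar>" using c by simp
    then show "2 \<le> 2 * \<bar>real_of_int ?c\<bar>" by linarith
  qed (use r in auto)
  finally show ?thesis by simp
qed

text \<open>For complex x and y \<open>re_part\<close> acquires an imaginary part, which has to stay
  bounded over all rows if the exponential factor is to stay bounded. For c = 0 it is an integer
  translate of x; otherwise it is close to the real number a/c, because \<open>row_norm\<close> is
  at least y0^2.\<close>

lemma Im_re_part_bound:
  assumes A: "A \<in> carrier SL2Z" and y0: "y0 > 0" and near: "near_point x0 y0 x y"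
  shows "\<bar>Im (re_part A x y)\<bar> \<le> y0 + 2 / y0"
proof (cases "A $ 2 $ 1 = 0")
  case True
  have d: "A $ 1 $ 1 * A $ 2 $ 2 = 1" using A True by (simp add: SL2Z_iff)
  then have "A $ 2 $ 2 = 1 \<or> A $ 2 $ 2 = -1" by (metis mult.commute zmult_eq_1_iff)
  then have "re_part A x y = x + of_int (A $ 1 $ 2) \<or> re_part A x y = x - of_int (A $ 1 $ 2)"
    using d True by (auto simp: re_part_def lin_plus_def lin_minus_def)
  then have "\<bar>Im (re_part A x y)\<bar> = \<bar>Im (x - of_real x0)\<bar>" by auto
  also have "\<dots> \<le> norm (x - of_real x0)" by (rule abs_Im_le_cmod)
  also have "\<dots> \<le> y0" using near y0 by (auto simp: near_point_def)
  finally show ?thesis using y0 by (smt (verit) divide_pos_pos)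
next
  case False
  let ?r = "row_norm (A $ 2 $ 1) (A $ 2 $ 2) x0 y0"
  have "1 * y0\<^sup>2 \<le> (real_of_int (A $ 2 $ 1))\<^sup>2 * y0\<^sup>2"
  proof (intro mult_right_mono)
    have "1 \<le> (A $ 2 $ 1)\<^sup>2" using False by (simp add: int_one_le_iff_zero_less)
    then show "1 \<le> (real_of_int (A $ 2 $ 1))\<^sup>2" by (metis of_int_1_le_iff of_int_power)
  qed simp
  then have "y0\<^sup>2 \<le> ?r" by (simp add: row_norm_def power_mult_distrib) (smt (verit) zero_le_power2)
  then have y0r: "y0 \<le> sqrt ?r" by (rule real_le_rsqrt)
  have "Im (re_part A x y) = Im (re_part A x y - of_int (A $ 1 $ 1) / of_int (A $ 2 $ 1))"
    by (simp add: Im_divide)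
  also have "\<bar>\<dots>\<bar> \<le> 16/15 / sqrt ?r"
    by (rule order.trans[OF abs_Im_le_cmod norm_re_part_diff[OF A False y0 near]])
  also have "\<dots> \<le> 2 / y0" using y0r y0 by (intro frac_le) auto
  finally show ?thesis using y0 by simp
qed

lemma norm_exp_re_part_le:
  assumes A: "A \<in> carrier SL2Z" and y0: "y0 > 0" and near: "near_point x0 y0 x y"
  shows "norm (exp (2 * of_real pi * \<i> * of_int m * re_part A x y)) \<le> exp (2 * pi * \<bar>real_of_int m\<bar> * (y0 + 2 / y0))"
proof -
  have "Re (2 * of_real pi * \<i> * of_int m * re_part A x y) = - (2 * pi * real_of_int m * Im (re_part A x y))" by simp
  also have "\<dots> \<le> \<bar>2 * pi * real_of_int m * Im (re_part A x y)\<bar>" by (rule abs_ge_minus_self)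
  also have "\<dots> = 2 * pi * \<bar>real_of_int m\<bar> * \<bar>Im (re_part A x y)\<bar>" by (simp add: abs_mult)
  also have "\<dots> \<le> 2 * pi * \<bar>real_of_int m\<bar> * (y0 + 2 / y0)"
    by (intro mult_left_mono Im_re_part_bound[OF assms]) auto
  finally show ?thesis unfolding norm_exp_eq_Re exp_le_cancel_iff .
qed

lemma norm_psi_le:
  assumes "t \<noteq> 0" "norm t \<le> L" "norm a \<le> S" "Re b \<ge> 1"
  shows "norm (psi \<rho> a b t) \<le> norm t powr Re \<rho> * (exp (pi * norm \<rho>) * exp ((S + 2) * L))"
proof -
  have L: "L \<ge> 0" using assms(2) norm_ge_zero order_trans by blast
  have "norm (exp (- t / 2)) \<le> exp L"
  proof -
    have "Re (- t / 2) \<le> norm t" using abs_Re_le_cmod[of t] by simp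
    then show ?thesis using assms(2) by (simp del: uminus_complex.sel)
  qed
  moreover have "norm (hyp11 a b t) \<le> exp ((S + 1) * L)" using assms by (intro norm_hyp11_le)
  moreover have "norm (t powr \<rho>) \<le> norm t powr Re \<rho> * exp (pi * norm \<rho>)" by (rule norm_powr_complex_le[OF assms(1)])
  ultimately have "norm (psi \<rho> a b t) \<le> exp L * (norm t powr Re \<rho> * exp (pi * norm \<rho>)) * exp ((S + 1) * L)"
    unfolding psi_def norm_mult by (intro mult_mono) auto
  also have "\<dots> = norm t powr Re \<rho> * (exp (pi * norm \<rho>) * (exp L * exp ((S + 1) * L)))" by (simp add: mult_ac)
  also have "exp L * exp ((S + 1) * L) = exp ((S + 2) * L)" by (simp flip: exp_add add: algebra_simps)
  finally show ?thesis .
qed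

text \<open>The weight drops out: with T the argument of \<open>psi\<close>, the product |cz + d|^2
  |T| lies between positive constants, uniformly in the row, so the automorphy factor and the power
  T^(-k/2) together are bounded. What is left is |T|^(Re s).\<close>

lemma slash_term_bound:
  assumes y0: "y0 > 0" and m: "m \<noteq> 0" and \<sigma>: "1/2 \<le> \<sigma>1"
  shows "\<exists>K\<ge>0. \<forall>A\<in>carrier SL2Z. \<forall>x0 x y s. near_point x0 y0 x y \<longrightarrow> \<sigma>1 \<le> Re s \<longrightarrow> Re s \<le> \<sigma>2 \<longrightarrow> norm s \<le> S \<longrightarrow>
     norm (slash_term k m A x y s) \<le> K * (y0 / row_norm (A $ 2 $ 1) (A $ 2 $ 2) x0 y0) powr \<sigma>1"
proof -
  define a where "a = 4 * pi * \<bar>real_of_int m\<bar>"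
  have a: "a > 0" using m by (simp add: a_def)
  define L where "L = max 1 (5/4 * (a * (y0 / min 1 (y0\<^sup>2))))"
  define S' where "S' = S + \<bar>real_of_int k\<bar> / 2"
  define E1 where "E1 = exp (pi * S') * exp ((S' + 2) * L)"
  define E2 where "E2 = exp (2 * pi * \<bar>real_of_int m\<bar> * (y0 + 2 / y0))"
  \<comment> \<open>A power with exponent -k/2 is monotone in a direction that depends on the sign
    of k; the sum covers both ends of the range of |J|^2 |T|.\<close>
  define X where "X = (a * y0 / 2) powr (- (of_int k / 2)) + (2 * (a * y0)) powr (- (of_int k / 2))"
  define C where "C = \<bar>real_of_int m\<bar> powr (of_int k/2)"
  define K where "K = C * E1 * E2 * X * (L powr (\<sigma>2 - \<sigma>1) * (5/4 * a) powr \<sigma>1)"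
  have K0: "K \<ge> 0" by (simp add: K_def C_def E1_def E2_def X_def)
  have "norm (slash_term k m A x y s) \<le> K * (y0 / row_norm (A $ 2 $ 1) (A $ 2 $ 2) x0 y0) powr \<sigma>1"
    if A: "A \<in> carrier SL2Z" and near: "near_point x0 y0 x y" and s: "\<sigma>1 \<le> Re s" "Re s \<le> \<sigma>2" "norm s \<le> S" for A x0 x y s
  proof -
    let ?c = "A $ 2 $ 1" and ?d = "A $ 2 $ 2"
    note cd = bottom_row_nonzero[OF A]
    define r where "r = row_norm ?c ?d x0 y0"
    have r: "r > 0" unfolding r_def by (rule row_norm_pos[OF y0 cd])
    define J where "J = lin_plus ?c ?d x y"
    define T where "T = of_real a * im_part ?c ?d x y"
    have T1: "T \<notin> \<real>\<^sub>\<le>\<^sub>0" and T2: "norm T \<le> 5/4 * (a * (y0 / r))" and T3: "3/4 * (a * (y0 / r)) \<le> norm T"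
      unfolding T_def r_def using near_point_im_part[OF y0 cd near a] by auto
    have T0: "T \<noteq> 0" using T1 by auto
    have TL: "norm T \<le> L"
    proof -
      have "y0 / r \<le> y0 / min 1 (y0\<^sup>2)"
        using row_norm_ge[OF y0 cd, of x0] y0 r by (intro divide_left_mono) (auto simp: r_def[symmetric])
      then have "5/4 * (a * (y0 / r)) \<le> 5/4 * (a * (y0 / min 1 (y0\<^sup>2)))" using a by (intro mult_left_mono) auto
      then show ?thesis using T2 by (simp add: L_def)
    qed
    have J1: "15/16 * sqrt r \<le> norm J" and J2: "norm J \<le> 17/16 * sqrt r"
      using im_part_near(2,3)[OF y0 cd] near by (auto simp: near_point_def J_def r_def)
    have J0: "norm J > 0" using J1 r by (smt (verit) real_sqrt_gt_zero mult_pos_pos divide_pos_pos)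
    have JX: "norm J powr (- of_int k) * norm T powr (- (of_int k / 2)) \<le> X"
    proof -
      define Y where "Y = (norm J)\<^sup>2 * norm T"
      have "norm J powr (- of_int k) = ((norm J)\<^sup>2) powr (- (of_int k / 2))"
        using J0 by (simp add: powr_powr flip: powr_numeral)
      then have eq: "norm J powr (- of_int k) * norm T powr (- (of_int k / 2)) = Y powr (- (of_int k / 2))"
        by (simp add: Y_def powr_mult)
      have scale: "(\<alpha> * sqrt r)\<^sup>2 * (\<beta> * (a * (y0 / r))) = \<alpha>\<^sup>2 * \<beta> * (a * y0)" for \<alpha> \<beta>
        using r by (simp add: power_mult_distrib)
      have "(15/16 * sqrt r)\<^sup>2 * (3/4 * (a * (y0 / r))) \<le> Y"
        unfolding Y_def using J1 T3 r a y0 by (intro mult_mono power_mono) auto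
      then have "(15/16)\<^sup>2 * (3/4) * (a * y0) \<le> Y"
        unfolding scale .
      then have lo: "a * y0 / 2 \<le> Y" using mult_pos_pos[OF a y0] by (simp add: power2_eq_square)
      have "Y \<le> (17/16 * sqrt r)\<^sup>2 * (5/4 * (a * (y0 / r)))"
        unfolding Y_def using J2 T2 r a y0 by (intro mult_mono power_mono) auto
      also have "\<dots> = (17/16)\<^sup>2 * (5/4) * (a * y0)"
        by (rule scale)
      finally have hi: "Y \<le> 2 * (a * y0)" using mult_pos_pos[OF a y0] by (simp add: power2_eq_square)
      have pos: "a * y0 / 2 > 0" using a y0 by simp
      show ?thesis
      proof (cases "k \<ge> 0")
        case True
        then have "Y powr (- (of_int k / 2)) \<le> (a * y0 / 2) powr (- (of_int k / 2))"
          using lo pos by (intro powr_mono2') auto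
        then show ?thesis unfolding eq X_def by (smt (verit) powr_ge_zero)
      next
        case False
        then have "Y powr (- (of_int k / 2)) \<le> (2 * (a * y0)) powr (- (of_int k / 2))"
          using hi lo pos by (intro powr_mono2) auto
        then show ?thesis unfolding eq X_def by (smt (verit) powr_ge_zero)
      qed
    qed
    have Ts: "norm T powr Re s \<le> L powr (\<sigma>2 - \<sigma>1) * ((5/4 * a) powr \<sigma>1 * (y0 / r) powr \<sigma>1)"
    proof -
      have "norm T powr Re s \<le> L powr (\<sigma>2 - \<sigma>1) * norm T powr \<sigma>1"
        using T0 TL s by (intro powr_le_powr_base) (auto simp: L_def)
      also have "norm T powr \<sigma>1 \<le> (5/4 * (a * (y0 / r))) powr \<sigma>1"
        using T2 \<sigma> by (intro powr_mono2) auto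
      also have "(5/4 * (a * (y0 / r))) powr \<sigma>1 = ((5/4 * a) * (y0 / r)) powr \<sigma>1" by (simp only: mult.assoc)
      also have "\<dots> = (5/4 * a) powr \<sigma>1 * (y0 / r) powr \<sigma>1" by (rule powr_mult)
      finally show ?thesis by (simp add: mult_left_mono)
    qed
    have nk: "norm (complex_of_int k / 2) \<le> \<bar>real_of_int k\<bar> / 2" by (simp add: norm_divide)
    have n1: "norm (s - of_int k/2) \<le> S'"
      unfolding S'_def using s(3) nk by (intro order.trans[OF norm_triangle_ineq4] add_mono)
    have "norm (complex_of_int (sgn m) * of_int k/2) \<le> \<bar>real_of_int k\<bar> / 2"
      by (simp add: norm_divide norm_mult sgn_if)
    then have n2: "norm (s - of_int (sgn m) * of_int k/2) \<le> S'"
      unfolding S'_def using s(3) by (intro order.trans[OF norm_triangle_ineq4] add_mono)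
    have "norm (psi (s - of_int k/2) (s - of_int (sgn m) * of_int k/2) (2 * s) T) \<le>
        norm T powr Re (s - of_int k/2) * (exp (pi * norm (s - of_int k/2)) * exp ((S' + 2) * L))"
      using T0 TL n2 s \<sigma> by (intro norm_psi_le) auto
    also have "\<dots> \<le> norm T powr Re (s - of_int k/2) * E1"
      unfolding E1_def using n1 by (intro mult_left_mono mult_right_mono) auto
    also have "norm T powr Re (s - of_int k/2) = norm T powr (- (of_int k / 2)) * norm T powr Re s"
      by (simp flip: powr_add)
    finally have P: "norm (psi (s - of_int k/2) (s - of_int (sgn m) * of_int k/2) (2 * s) T) \<le>
        norm T powr (- (of_int k / 2)) * norm T powr Re s * E1" .
    have "norm (slash_term k m A x y s) = norm J powr (- of_int k) * (C *
        norm (psi (s - of_int k/2) (s - of_int (sgn m) * of_int k/2) (2 * s) T) * norm (exp (2 * of_real pi * \<i> * of_int m * re_part A x y)))"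
      using J0 unfolding slash_term_def J_def[symmetric] T_def a_def[symmetric] norm_mult
      by (simp add: C_def norm_power_int powr_real_of_int' [symmetric])
    also have "\<dots> \<le> norm J powr (- of_int k) * (C * (norm T powr (- (of_int k / 2)) * norm T powr Re s * E1) * E2)"
      using P norm_exp_re_part_le[OF A y0 near, of m]
      by (intro mult_left_mono mult_mono) (auto simp: C_def E2_def E1_def)
    also have "\<dots> = C * E1 * E2 * (norm J powr (- of_int k) * norm T powr (- (of_int k / 2))) * norm T powr Re s" by (simp only: mult_ac)
    also have "\<dots> \<le> C * E1 * E2 * X * (L powr (\<sigma>2 - \<sigma>1) * ((5/4 * a) powr \<sigma>1 * (y0 / r) powr \<sigma>1))"
      using JX Ts by (intro mult_mono) (auto simp: C_def E1_def E2_def X_def)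
    also have "\<dots> = K * (y0 / r) powr \<sigma>1" by (simp only: K_def mult_ac)
    finally show ?thesis unfolding r_def .
  qed
  then show ?thesis using K0 by (intro exI[of _ K]) auto
qed

lemma near_pointI: "x \<in> ball (of_real x0) (y0 / 32) \<Longrightarrow> y \<in> ball (of_real y0) (y0 / 32) \<Longrightarrow> near_point x0 y0 x y"
  by (simp add: near_point_def dist_norm norm_minus_commute)

lemma hol3_slash_term:
  assumes A: "A \<in> carrier SL2Z" and y0: "y0 > 0" and m: "m \<noteq> 0"
    and C: "open C" "\<And>s. s \<in> C \<Longrightarrow> Re s \<ge> 1/2"
    and M: "\<And>x y s. near_point x0 y0 x y \<Longrightarrow> s \<in> C \<Longrightarrow> norm (slash_term k m A x y s) \<le> M"
  shows "hol3 (ball (of_real x0) (y0 / 32)) (ball (of_real y0) (y0 / 32)) C (slash_term k m A) M"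
  unfolding hol3_def
proof (intro conjI ballI)
  fix x y s
  assume x: "x \<in> ball (complex_of_real x0) (y0 / 32)" and y: "y \<in> ball (complex_of_real y0) (y0 / 32)" and s: "s \<in> C"
  show "norm (slash_term k m A x y s) \<le> M" using M near_pointI[OF x y] s by blast
next
  fix y s assume y: "y \<in> ball (complex_of_real y0) (y0 / 32)" and s: "s \<in> C"
  show "(\<lambda>x. slash_term k m A x y s) holomorphic_on ball (of_real x0) (y0 / 32)"
    by (rule holomorphic_slash_term[OF A y0 m open_ball, where X = "\<lambda>x. x"])
      (use near_pointI[OF _ y] C(2)[OF s] in \<open>auto intro!: holomorphic_intros\<close>)
next
  fix x s assume x: "x \<in> ball (complex_of_real x0) (y0 / 32)" and s: "s \<in> C"
  show "(\<lambda>y. slash_term k m A x y s) holomorphic_on ball (of_real y0) (y0 / 32)"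
    by (rule holomorphic_slash_term[OF A y0 m open_ball, where Y = "\<lambda>y. y"])
      (use near_pointI[OF x] C(2)[OF s] in \<open>auto intro!: holomorphic_intros\<close>)
next
  fix x y assume x: "x \<in> ball (complex_of_real x0) (y0 / 32)" and y: "y \<in> ball (complex_of_real y0) (y0 / 32)"
  show "(\<lambda>s. slash_term k m A x y s) holomorphic_on C"
    by (rule holomorphic_slash_term[OF A y0 m C(1), where S = "\<lambda>s. s"])
      (use near_pointI[OF x y] C(2) in \<open>auto intro!: holomorphic_intros\<close>)
qed (use C in auto)

section \<open>The series in its half-plane of convergence\<close>

definition slash_sum :: "int \<Rightarrow> int \<Rightarrow> complex \<Rightarrow> complex \<Rightarrow> complex" where
  "slash_sum k m z s = (\<Sum>\<^sub>\<infinity>p\<in>row_index. slash k (\<lambda>w. phi k m w s) (row_matrix (fst p) (snd p)) z)"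

lemma row_index_row_matrix:
  assumes "p \<in> row_index"
  shows "row_matrix (fst p) (snd p) \<in> carrier SL2Z" "row_matrix (fst p) (snd p) $ 2 $ 1 = fst p"
    "row_matrix (fst p) (snd p) $ 2 $ 2 = snd p" "p \<noteq> (0, 0)"
  using assms row_matrix by (auto simp: row_index_def)

text \<open>Halving the distance to the line Re s = 1 leaves an exponent above 1 on the whole disc,
  so \<open>pair_weight\<close> supplies a summable majorant.\<close>

lemma slash_sum_local:
  assumes z: "Im z > 0" and m: "m \<noteq> 0" and s: "Re s > 1"
  obtains r M where "r > 0" "ball s r \<subseteq> {s. Re s > 1}" "M summable_on row_index"
    "\<And>p. p \<in> row_index \<Longrightarrow> hol3 (ball (of_real (Re z)) (Im z / 32)) (ball (of_real (Im z)) (Im z / 32)) (ball s r)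
       (slash_term k m (row_matrix (fst p) (snd p))) (M p)"
proof -
  define r where "r = (Re s - 1) / 2"
  have r: "r > 0" using s by (simp add: r_def)
  define \<sigma>1 \<sigma>2 where "\<sigma>1 = Re s - r" and "\<sigma>2 = Re s + r"
  have \<sigma>1: "\<sigma>1 > 1" using s by (simp add: \<sigma>1_def r_def field_simps)
  have ball: "\<sigma>1 \<le> Re t \<and> Re t \<le> \<sigma>2 \<and> norm t \<le> norm s + r" if "t \<in> ball s r" for t
  proof -
    have n: "norm (t - s) < r" using that by (simp add: dist_norm norm_minus_commute)
    then have "\<bar>Re (t - s)\<bar> < r" using abs_Re_le_cmod[of "t - s"] by linarith
    moreover have "norm t \<le> norm s + norm (t - s)" using norm_triangle_ineq[of s "t - s"] by simp
    ultimately show ?thesis using n by (auto simp: \<sigma>1_def \<sigma>2_def abs_less_iff)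
  qed
  obtain K where K: "K \<ge> 0" "\<forall>A\<in>carrier SL2Z. \<forall>x0 x y t. near_point x0 (Im z) x y \<longrightarrow> \<sigma>1 \<le> Re t \<longrightarrow> Re t \<le> \<sigma>2 \<longrightarrow> norm t \<le> norm s + r \<longrightarrow>
     norm (slash_term k m A x y t) \<le> K * (Im z / row_norm (A $ 2 $ 1) (A $ 2 $ 2) x0 (Im z)) powr \<sigma>1"
    using slash_term_bound[OF z m, of \<sigma>1 \<sigma>2 "norm s + r" k] \<sigma>1 by auto
  define M where "M = (\<lambda>p. K * ((Im z * lattice_const \<bar>Re z\<bar> (Im z)) powr \<sigma>1 * pair_weight \<sigma>1 p))"
  show thesis
  proof (rule that)
    show "M summable_on row_index"
      unfolding M_def by (intro summable_on_cmult_right summable_pair_weight \<sigma>1)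
    show "ball s r \<subseteq> {s. Re s > 1}" using ball \<sigma>1 by fastforce
    fix p assume p: "p \<in> row_index"
    note R = row_index_row_matrix[OF p]
    show "hol3 (ball (of_real (Re z)) (Im z / 32)) (ball (of_real (Im z)) (Im z / 32)) (ball s r)
       (slash_term k m (row_matrix (fst p) (snd p))) (M p)"
    proof (rule hol3_slash_term[OF R(1) z m open_ball])
      show "Re t \<ge> 1/2" if "t \<in> ball s r" for t using ball[OF that] \<sigma>1 by linarith
      fix x y t assume near: "near_point (Re z) (Im z) x y" and t: "t \<in> ball s r"
      have "norm (slash_term k m (row_matrix (fst p) (snd p)) x y t) \<le> K * (Im z / row_norm (fst p) (snd p) (Re z) (Im z)) powr \<sigma>1"
        using K(2)[rule_format, OF R(1) near] ball[OF t] R by auto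
      also have "\<dots> \<le> M p"
        unfolding M_def using row_norm_powr_le[OF z order_refl, of "fst p" "snd p" \<sigma>1 "Re z"] R(4) \<sigma>1 K(1)
        by (intro mult_left_mono) auto
      finally show "norm (slash_term k m (row_matrix (fst p) (snd p)) x y t) \<le> M p" .
    qed
  qed (use r in auto)
qed

lemma slash_sum_of_real:
  assumes "y > 0" "m \<noteq> 0"
  shows "slash_sum k m (Complex x y) s = (\<Sum>\<^sub>\<infinity>p\<in>row_index. slash_term k m (row_matrix (fst p) (snd p)) (of_real x) (of_real y) s)"
  unfolding slash_sum_def
  by (intro infsum_cong slash_term_of_real row_index_row_matrix assms)

lemma near_ball_pos:
  assumes "y0 > 0" "complex_of_real y \<in> ball (of_real y0) (y0 / 32)" shows "y > 0"
proof -
  have "dist y0 y < y0 / 32" using assms(2) by simp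
  then show ?thesis using assms(1) unfolding dist_real_def by linarith
qed

lemma analytic_family_slash_sum:
  assumes m: "m \<noteq> 0"
  shows "analytic_family {s. Re s > 1} (slash_sum k m)"
proof (rule analytic_familyI)
  fix z s assume z: "Im z > 0" and "s \<in> {s. Re s > 1}"
  then have s: "Re s > 1" by simp
  let ?A = "ball (complex_of_real (Re z)) (Im z / 32)" and ?B = "ball (complex_of_real (Im z)) (Im z / 32)"
  obtain r M where r: "r > 0" "ball s r \<subseteq> {s. Re s > 1}" and M: "M summable_on row_index"
    "\<And>p. p \<in> row_index \<Longrightarrow> hol3 ?A ?B (ball s r) (slash_term k m (row_matrix (fst p) (snd p))) (M p)"
    by (rule slash_sum_local[OF z m s, where k = k]) (rule that; blast)
  have h: "hol3 ?A ?B (ball s r) (\<lambda>x y s. \<Sum>\<^sub>\<infinity>p\<in>row_index. slash_term k m (row_matrix (fst p) (snd p)) x y s) (infsum M row_index)"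
    by (rule hol3_infsum[OF M(2,1)]) auto
  show "\<exists>A B C U M. hol3 A B C U M \<and> of_real (Re z) \<in> A \<and> of_real (Im z) \<in> B \<and> s \<in> C \<and> C \<subseteq> {s. Re s > 1} \<and>
     (\<forall>x y s. of_real x \<in> A \<longrightarrow> of_real y \<in> B \<longrightarrow> s \<in> C \<longrightarrow> slash_sum k m (Complex x y) s = U (of_real x) (of_real y) s)"
    using h r z slash_sum_of_real[OF near_ball_pos[OF z] m]
    by (intro exI[of _ ?A] exI[of _ ?B] exI[of _ "ball s r"]
        exI[of _ "\<lambda>x y s. \<Sum>\<^sub>\<infinity>p\<in>row_index. slash_term k m (row_matrix (fst p) (snd p)) x y s"]
        exI[of _ "infsum M row_index"]) auto
qed

text \<open>The majorants of \<open>slash_sum_local\<close> allow \<open>dx\<close> and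
  \<open>dy\<close> to be taken term by term. The factor in \<open>dzbar_slash_phi\<close> is the
  same for all rows, so the terms add up to the series of weight 2 - k.\<close>

lemma dzbar_slash_sum:
  assumes z: "Im z > 0" and m: "m \<noteq> 0" and s: "Re s > 1"
  shows "dzbar (\<lambda>w. slash_sum k m w s) z = \<i> / 2 * (4 * of_real pi) powi (1 - k) * of_real (Im z) powi (- k) * (s - of_int k/2) *
     cnj (slash_sum (2 - k) (- m) z (cnj s))"
proof -
  let ?A = "ball (complex_of_real (Re z)) (Im z / 32)" and ?B = "ball (complex_of_real (Im z)) (Im z / 32)"
  let ?x = "complex_of_real (Re z)" and ?y = "complex_of_real (Im z)"
  let ?t = "\<lambda>p. slash_term k m (row_matrix (fst p) (snd p))"
  let ?f = "\<lambda>p. slash k (\<lambda>w. phi k m w s) (row_matrix (fst p) (snd p))"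
  obtain r M where r: "r > 0" "ball s r \<subseteq> {s. Re s > 1}" and M: "M summable_on row_index"
    "\<And>p. p \<in> row_index \<Longrightarrow> hol3 ?A ?B (ball s r) (?t p) (M p)"
    by (rule slash_sum_local[OF z m s, where k = k]) (rule that; blast)
  have h: "hol3 ?A ?B (ball s r) (\<lambda>x y s. \<Sum>\<^sub>\<infinity>p\<in>row_index. ?t p x y s) (infsum M row_index)"
    by (rule hol3_infsum[OF M(2,1)]) auto
  have mem: "?x \<in> ?A" "?y \<in> ?B" "s \<in> ball s r" using z r by auto
  have Z: "Complex (Re z) (Im z) = z" by simp
  have eqS: "slash_sum k m (Complex x y) s = (\<Sum>\<^sub>\<infinity>p\<in>row_index. ?t p (of_real x) (of_real y) s)"
    if "of_real y \<in> ?B" for x y s by (rule slash_sum_of_real[OF near_ball_pos[OF z that] m])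
  have eqf: "slash k (\<lambda>w. phi k m w s) (row_matrix (fst p) (snd p)) (Complex x y) = ?t p (of_real x) (of_real y) s"
    if "p \<in> row_index" "of_real y \<in> ?B" for p x y s
    by (rule slash_term_of_real[OF row_index_row_matrix(1)[OF that(1)] near_ball_pos[OF z that(2)] m])
  have dxS: "dx (\<lambda>w. slash_sum k m w s) z = deriv (\<lambda>x. \<Sum>\<^sub>\<infinity>p\<in>row_index. ?t p x ?y s) ?x"
    using hol3_dx(2)[OF h mem, of "slash_sum k m"] eqS by (simp only: Z)
  have dyS: "dy (\<lambda>w. slash_sum k m w s) z = deriv (\<lambda>y. \<Sum>\<^sub>\<infinity>p\<in>row_index. ?t p ?x y s) ?y"
    using hol3_dy(2)[OF h mem, of "slash_sum k m"] eqS by (simp only: Z)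
  have dxf: "dx (?f p) z = deriv (\<lambda>x. ?t p x ?y s) ?x" if "p \<in> row_index" for p
    using hol3_dx(2)[OF M(2)[OF that] mem, of "\<lambda>z s. slash k (\<lambda>w. phi k m w s) (row_matrix (fst p) (snd p)) z"] eqf[OF that] by (simp only: Z)
  have dyf: "dy (?f p) z = deriv (\<lambda>y. ?t p ?x y s) ?y" if "p \<in> row_index" for p
    using hol3_dy(2)[OF M(2)[OF that] mem, of "\<lambda>z s. slash k (\<lambda>w. phi k m w s) (row_matrix (fst p) (snd p)) z"] eqf[OF that] by (simp only: Z)
  have "((\<lambda>p. deriv (\<lambda>x. ?t p x ?y s) ?x) has_sum dx (\<lambda>w. slash_sum k m w s) z) row_index"
    unfolding dxS by (rule infsum_holomorphic(2)[OF open_ball _ _ M(1) mem(1)]) (use M(2) mem in \<open>auto simp: hol3_def\<close>)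
  moreover have "((\<lambda>p. deriv (\<lambda>y. ?t p ?x y s) ?y) has_sum dy (\<lambda>w. slash_sum k m w s) z) row_index"
    unfolding dyS by (rule infsum_holomorphic(2)[OF open_ball _ _ M(1) mem(2)]) (use M(2) mem in \<open>auto simp: hol3_def\<close>)
  ultimately have "((\<lambda>p. (1/2) * (deriv (\<lambda>x. ?t p x ?y s) ?x + \<i> * deriv (\<lambda>y. ?t p ?x y s) ?y)) has_sum
      (1/2) * (dx (\<lambda>w. slash_sum k m w s) z + \<i> * dy (\<lambda>w. slash_sum k m w s) z)) row_index"
    by (intro has_sum_cmult_right has_sum_add)
  also have "?this \<longleftrightarrow> ((\<lambda>p. dzbar (?f p) z) has_sum dzbar (\<lambda>w. slash_sum k m w s) z) row_index"
  proof -
    have "dzbar (\<lambda>w. slash_sum k m w s) z = (1/2) * (dx (\<lambda>w. slash_sum k m w s) z + \<i> * dy (\<lambda>w. slash_sum k m w s) z)"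
      by (simp add: dzbar_def)
    then show ?thesis by (simp only:) (rule has_sum_cong, simp add: dzbar_def dxf dyf)
  qed
  finally have "dzbar (\<lambda>w. slash_sum k m w s) z = (\<Sum>\<^sub>\<infinity>p\<in>row_index. dzbar (?f p) z)"
    by (simp add: infsumI)
  also have "\<dots> = (\<Sum>\<^sub>\<infinity>p\<in>row_index. \<i> / 2 * (4 * of_real pi) powi (1 - k) * of_real (Im z) powi (- k) * (s - of_int k/2) *
     cnj (slash (2 - k) (\<lambda>w. phi (2 - k) (- m) w (cnj s)) (row_matrix (fst p) (snd p)) z))"
    by (rule infsum_cong, rule dzbar_slash_phi) (use row_index_row_matrix(1) z m s in auto)
  also have "\<dots> = \<i> / 2 * (4 * of_real pi) powi (1 - k) * of_real (Im z) powi (- k) * (s - of_int k/2) *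
     cnj (slash_sum (2 - k) (- m) z (cnj s))"
    unfolding slash_sum_def infsum_cmult_right' infsum_cnj ..
  finally show ?thesis .
qed

section \<open>Continuation in weight 0\<close>

lemma norm_exp_minus_1_le: "norm (exp z - 1) \<le> norm z * exp (norm (z :: complex))"
proof -
  have "norm (exp z - 1) \<le> exp (norm z) - 1"
  proof (rule norm_sums_le)
    show "(\<lambda>n. z ^ Suc n /\<^sub>R fact (Suc n)) sums (exp z - 1)"
      using exp_converges[of z] by (subst sums_Suc_iff) simp
    show "(\<lambda>n. norm z ^ Suc n / fact (Suc n)) sums (exp (norm z) - 1)"
      using exp_series_sums[of "norm z"] by (subst sums_Suc_iff) simp
    show "norm (z ^ Suc n /\<^sub>R fact (Suc n)) \<le> norm z ^ Suc n / fact (Suc n)" for n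
      by (simp add: norm_power norm_mult divide_inverse mult.commute del: fact_Suc)
  qed
  then show ?thesis using exp_minus_1_le[of "norm z"] by simp
qed

lemma im_part_powr_bound:
  assumes y0: "y0 > 0" and a: "a > 0" and \<sigma>: "0 \<le> \<sigma>1"
  shows "\<exists>K\<ge>0. \<forall>c d x0 x y s. (c, d) \<noteq> (0, 0) \<longrightarrow> near_point x0 y0 x y \<longrightarrow> \<sigma>1 \<le> Re s \<longrightarrow> Re s \<le> \<sigma>2 \<longrightarrow> norm s \<le> S \<longrightarrow>
     norm ((of_real a * im_part c d x y) powr s) \<le> K * (y0 / row_norm c d x0 y0) powr \<sigma>1"
proof -
  define L where "L = max 1 (5/4 * (a * (y0 / min 1 (y0\<^sup>2))))"
  define K where "K = L powr (\<sigma>2 - \<sigma>1) * (5/4 * a) powr \<sigma>1 * exp (pi * S)"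
  have "norm ((of_real a * im_part c d x y) powr s) \<le> K * (y0 / row_norm c d x0 y0) powr \<sigma>1"
    if cd: "(c, d) \<noteq> (0, 0)" and near: "near_point x0 y0 x y" and s: "\<sigma>1 \<le> Re s" "Re s \<le> \<sigma>2" "norm s \<le> S" for c d x0 x y s
  proof -
    define r where "r = row_norm c d x0 y0"
    have r: "r > 0" unfolding r_def by (rule row_norm_pos[OF y0 cd])
    define T where "T = of_real a * im_part c d x y"
    have T1: "T \<notin> \<real>\<^sub>\<le>\<^sub>0" and T2: "norm T \<le> 5/4 * (a * (y0 / r))"
      unfolding T_def r_def using near_point_im_part[OF y0 cd near a] by auto
    have T0: "T \<noteq> 0" using T1 by auto
    have "y0 / r \<le> y0 / min 1 (y0\<^sup>2)"
      using row_norm_ge[OF y0 cd, of x0] y0 r by (intro divide_left_mono) (auto simp: r_def[symmetric])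
    then have "5/4 * (a * (y0 / r)) \<le> 5/4 * (a * (y0 / min 1 (y0\<^sup>2)))" using a by (intro mult_left_mono) auto
    then have TL: "norm T \<le> L" using T2 by (simp add: L_def)
    have "norm (T powr s) \<le> norm T powr Re s * exp (pi * norm s)" by (rule norm_powr_complex_le[OF T0])
    also have "\<dots> \<le> (L powr (\<sigma>2 - \<sigma>1) * norm T powr \<sigma>1) * exp (pi * S)"
      using T0 TL s by (intro mult_mono powr_le_powr_base) (auto simp: L_def)
    also have "\<dots> \<le> (L powr (\<sigma>2 - \<sigma>1) * ((5/4 * a) * (y0 / r)) powr \<sigma>1) * exp (pi * S)"
      using T2 \<sigma> by (intro mult_right_mono mult_left_mono powr_mono2) (auto simp: mult.assoc)
    also have "((5/4 * a) * (y0 / r)) powr \<sigma>1 = (5/4 * a) powr \<sigma>1 * (y0 / r) powr \<sigma>1" by (rule powr_mult)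
    finally show ?thesis unfolding T_def r_def K_def by (simp only: mult_ac)
  qed
  then show ?thesis by (intro exI[of _ K]) (auto simp: K_def)
qed

lemma holomorphic_im_part_powr:
  assumes cd: "(c, d) \<noteq> (0, 0)" and y0: "y0 > 0" and a: "a > 0"
    and hol: "X holomorphic_on B" "Y holomorphic_on B" "S holomorphic_on B"
    and near: "\<And>u. u \<in> B \<Longrightarrow> near_point x0 y0 (X u) (Y u)"
  shows "(\<lambda>u. (of_real a * im_part c d (X u) (Y u)) powr S u) holomorphic_on B"
proof -
  have im: "(\<lambda>u. im_part c d (X u) (Y u)) holomorphic_on B"
    unfolding im_part_def using near_point_nonzero[OF y0 cd near] hol by (intro holomorphic_intros) auto
  show ?thesis using near_point_im_part(1)[OF y0 cd near a]
    by (intro holomorphic_intros im hol) auto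
qed

text \<open>With c = 1 fixed only one summation variable remains and the full quadratic decay in n
  is kept, so the sum over n converges as soon as the exponent exceeds 1/2.\<close>

lemma row_norm_one_powr_le:
  assumes y: "y > 0" and x: "\<bar>x\<bar> \<le> X" and \<sigma>: "\<sigma> \<ge> 0"
  shows "(y / row_norm 1 n x y) powr \<sigma> \<le> (y * lattice_const X y) powr \<sigma> * int_weight (2 * \<sigma>) n"
proof -
  let ?w = "(1 + \<bar>real_of_int n\<bar>)"
  have r: "row_norm 1 n x y > 0" by (rule row_norm_pos[OF y]) auto
  have "?w\<^sup>2 \<le> 2 * (1 + (real_of_int n)\<^sup>2)"
    using zero_le_power2[of "1 - \<bar>real_of_int n\<bar>"] by (simp add: power2_eq_square algebra_simps)
  also have "\<dots> \<le> 4 * ((real_of_int 1)\<^sup>2 + (real_of_int n)\<^sup>2)" by simp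
  also have "\<dots> \<le> 4 * ((2 + (1 + 2 * X\<^sup>2) / y\<^sup>2) * row_norm 1 n x y)"
    by (intro mult_left_mono sq_sum_le_row_norm[OF y x]) auto
  also have "\<dots> = lattice_const X y * row_norm 1 n x y" by (simp only: lattice_const_def mult.assoc)
  finally have "?w\<^sup>2 \<le> lattice_const X y * row_norm 1 n x y" .
  moreover have w2: "?w\<^sup>2 > 0" by (simp add: add_pos_nonneg)
  ultimately have "y / row_norm 1 n x y \<le> y * lattice_const X y / ?w\<^sup>2"
    using y r by (simp add: divide_le_eq le_divide_eq mult.commute mult.left_commute)
  then have "(y / row_norm 1 n x y) powr \<sigma> \<le> (y * lattice_const X y / ?w\<^sup>2) powr \<sigma>"
    using y r \<sigma> by (intro powr_mono2) auto
  also have "\<dots> = (y * lattice_const X y) powr \<sigma> / (?w\<^sup>2) powr \<sigma>" by (rule powr_divide)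
  also have "(?w\<^sup>2) powr \<sigma> = ?w powr (2 * \<sigma>)"
    by (simp add: powr_powr flip: powr_numeral)
  also have "(y * lattice_const X y) powr \<sigma> / ?w powr (2 * \<sigma>) = (y * lattice_const X y) powr \<sigma> * int_weight (2 * \<sigma>) n"
    by (simp add: int_weight_def powr_minus_divide)
  finally show ?thesis .
qed

text \<open>The periodization of (y/(u^2 + y^2))^s over integer shifts of u.\<close>

definition lat_sum :: "complex \<Rightarrow> complex \<Rightarrow> complex \<Rightarrow> complex" where
  "lat_sum u y s = (\<Sum>\<^sub>\<infinity>n. im_part 1 n u y powr s)"

text \<open>Both linear factors of the row (c, e + cn) are c times those of (1, n) at the point
  shifted by e/c; this is the source of c^(-2s).\<close>

lemma im_part_scale:
  assumes "c > 0"
  shows "im_part (int c) (e + int c * n) x y = im_part 1 n (x + of_int e / of_nat c) y / (of_nat c)\<^sup>2"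
proof -
  have "lin_plus (int c) (e + int c * n) x y = of_nat c * lin_plus 1 n (x + of_int e / of_nat c) y"
    "lin_minus (int c) (e + int c * n) x y = of_nat c * lin_minus 1 n (x + of_int e / of_nat c) y"
    using assms by (simp_all add: lin_plus_def lin_minus_def field_simps)
  then show ?thesis by (simp add: im_part_def power2_eq_square)
qed

lemma lat_sum_shift: "lat_sum (u + of_int k) y s = lat_sum u y s"
proof -
  have "im_part 1 n (u + of_int k) y = im_part 1 (n + k) u y" for n
    by (simp add: im_part_def lin_plus_def lin_minus_def add_ac)
  then have "lat_sum (u + of_int k) y s = (\<Sum>\<^sub>\<infinity>n. im_part 1 (n + k) u y powr s)"
    by (simp add: lat_sum_def)
  also have "\<dots> = lat_sum u y s" unfolding lat_sum_def
    by (rule infsum_reindex_bij_betw[where g = "\<lambda>n. n + k"])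
      (intro bij_betwI[where g = "\<lambda>n. n - k"], auto)
  finally show ?thesis .
qed

text \<open>One M for all centres in [-1, 1], so that periodicity can spread the bound over a whole
  strip.\<close>

lemma hol3_lat_sum:
  assumes y0: "y0 > 0" and C: "open C" and \<sigma>: "1/2 < \<sigma>1"
    and s: "\<And>s. s \<in> C \<Longrightarrow> \<sigma>1 \<le> Re s \<and> Re s \<le> \<sigma>2 \<and> norm s \<le> S"
  shows "\<exists>M\<ge>0. \<forall>x0. \<bar>x0\<bar> \<le> 1 \<longrightarrow> hol3 (ball (of_real x0) (y0 / 32)) (ball (of_real y0) (y0 / 32)) C lat_sum M"
proof -
  obtain K where K: "K \<ge> 0" "\<forall>c d x0 x y s. (c, d) \<noteq> (0, 0) \<longrightarrow> near_point x0 y0 x y \<longrightarrow> \<sigma>1 \<le> Re s \<longrightarrow> Re s \<le> \<sigma>2 \<longrightarrow> norm s \<le> S \<longrightarrow>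
     norm ((of_real 1 * im_part c d x y) powr s) \<le> K * (y0 / row_norm c d x0 y0) powr \<sigma>1"
    using im_part_powr_bound[OF y0, of 1 \<sigma>1 \<sigma>2 S] \<sigma> by auto
  define M where "M = (\<lambda>n. K * ((y0 * lattice_const 1 y0) powr \<sigma>1 * int_weight (2 * \<sigma>1) n))"
  have Ms: "M summable_on UNIV"
    unfolding M_def using \<sigma> by (intro summable_on_cmult_right summable_int_weight) auto
  have "hol3 (ball (of_real x0) (y0 / 32)) (ball (of_real y0) (y0 / 32)) C lat_sum (infsum M UNIV)"
    if x0: "\<bar>x0\<bar> \<le> 1" for x0
    unfolding lat_sum_def[abs_def]
  proof (rule hol3_infsum[OF _ Ms])
    fix n :: int
    have h: "(\<lambda>u. im_part 1 n (X u) (Y u) powr T u) holomorphic_on B"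
      if "X holomorphic_on B" "Y holomorphic_on B" "T holomorphic_on B" "\<And>u. u \<in> B \<Longrightarrow> near_point x0 y0 (X u) (Y u)" for X Y T B
      using holomorphic_im_part_powr[OF _ y0, of 1 n 1 X B Y T x0] that by simp
    have "norm (im_part 1 n x y powr s) \<le> M n" if near: "near_point x0 y0 x y" and sC: "s \<in> C" for x y s
    proof -
      have "norm (im_part 1 n x y powr s) \<le> K * (y0 / row_norm 1 n x0 y0) powr \<sigma>1"
        using K(2)[rule_format, OF _ near, of 1 n s] s[OF sC] by simp
      also have "\<dots> \<le> M n"
        unfolding M_def using \<sigma> K(1) by (intro mult_left_mono row_norm_one_powr_le y0 x0) auto
      finally show ?thesis .
    qed
    then show "hol3 (ball (of_real x0) (y0 / 32)) (ball (of_real y0) (y0 / 32)) C (\<lambda>x y s. im_part 1 n x y powr s) (M n)"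
      unfolding hol3_def using C
      by (intro conjI ballI h open_ball holomorphic_intros) (use near_pointI in auto)
  qed (use C in auto)
  moreover have "infsum M UNIV \<ge> 0" using K(1) by (intro infsum_nonneg) (auto simp: M_def)
  ultimately show ?thesis by blast
qed

definition strip :: "real \<Rightarrow> complex set" where "strip h = {u. \<bar>Im u\<bar> < h}"

lemma open_strip: "open (strip h)"
  unfolding strip_def by (intro open_Collect_less continuous_intros)

lemma convex_strip: "convex (strip h)"
proof -
  have "strip h = {u. Im u < h} \<inter> {u. Im u > - h}" by (auto simp: strip_def abs_less_iff)
  then show ?thesis by (simp add: convex_Int convex_halfspace_Im_lt convex_halfspace_Im_gt)
qed

text \<open>An integer translation moves any point of the strip close to a real centre in [0, 1),
  where \<open>hol3_lat_sum\<close> applies. The whole strip is wanted because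
  \<open>twisted_unit_sum_bound\<close> asks for bounds at all integers e, that is at all shifts
  e/c.\<close>

lemma lat_sum_strip:
  assumes y0: "y0 > 0" and C: "open C" and \<sigma>: "1/2 < \<sigma>1"
    and s: "\<And>s. s \<in> C \<Longrightarrow> \<sigma>1 \<le> Re s \<and> Re s \<le> \<sigma>2 \<and> norm s \<le> S"
  shows "\<exists>M\<ge>0. hol3 (strip (y0 / 32)) (ball (of_real y0) (y0 / 32)) C lat_sum M"
proof -
  let ?B = "ball (complex_of_real y0) (y0 / 32)"
  obtain M where M: "M \<ge> 0" "\<And>x0. \<bar>x0\<bar> \<le> 1 \<Longrightarrow> hol3 (ball (of_real x0) (y0 / 32)) ?B C lat_sum M"
    using hol3_lat_sum[OF y0 C \<sigma> s] by blast
  have red: "\<exists>x0 n. \<bar>x0\<bar> \<le> 1 \<and> u + of_int n \<in> ball (complex_of_real x0) (y0 / 32)" if u: "u \<in> strip (y0 / 32)" for u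
  proof (intro exI conjI)
    show "\<bar>frac (Re u)\<bar> \<le> 1" using frac_lt_1[of "Re u"] frac_ge_0[of "Re u"] by simp
    have "u + of_int (- \<lfloor>Re u\<rfloor>) - of_real (frac (Re u)) = \<i> * of_real (Im u)"
      by (simp add: complex_eq_iff frac_def)
    then have "norm (u + of_int (- \<lfloor>Re u\<rfloor>) - of_real (frac (Re u))) = \<bar>Im u\<bar>"
      by (simp add: norm_mult)
    then show "u + of_int (- \<lfloor>Re u\<rfloor>) \<in> ball (complex_of_real (frac (Re u))) (y0 / 32)"
      using u by (simp add: dist_norm norm_minus_commute strip_def)
  qed
  have "hol3 (strip (y0 / 32)) ?B C lat_sum M"
    unfolding hol3_def
  proof (intro conjI ballI)
    fix u y s assume u: "u \<in> strip (y0 / 32)" and y: "y \<in> ?B" and s: "s \<in> C"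
    obtain x0 n where "\<bar>x0\<bar> \<le> 1" "u + of_int n \<in> ball (complex_of_real x0) (y0 / 32)" using red[OF u] by blast
    then have "norm (lat_sum (u + of_int n) y s) \<le> M" using M(2) y s unfolding hol3_def by blast
    then show "norm (lat_sum u y s) \<le> M" by (simp only: lat_sum_shift)
  next
    fix y s assume y: "y \<in> ?B" and s: "s \<in> C"
    have "(\<lambda>u. lat_sum u y s) field_differentiable at u" if u: "u \<in> strip (y0 / 32)" for u
    proof -
      obtain x0 n where n: "\<bar>x0\<bar> \<le> 1" "u + of_int n \<in> ball (complex_of_real x0) (y0 / 32)" using red[OF u] by blast
      then have "(\<lambda>u. lat_sum u y s) holomorphic_on ball (complex_of_real x0) (y0 / 32)"
        using M(2) y s unfolding hol3_def by blast
      then have "(\<lambda>u. lat_sum u y s) field_differentiable at (u + of_int n)"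
        using n by (auto intro: holomorphic_on_imp_differentiable_at)
      then have "((\<lambda>u. lat_sum u y s) \<circ> (\<lambda>u. u + of_int n)) field_differentiable at u"
        by (intro field_differentiable_compose) (auto intro!: derivative_intros)
      then show ?thesis by (simp add: o_def lat_sum_shift)
    qed
    then show "(\<lambda>u. lat_sum u y s) holomorphic_on strip (y0 / 32)"
      using field_differentiable_at_within holomorphic_on_def by blast
  next
    fix u s assume u: "u \<in> strip (y0 / 32)" and s: "s \<in> C"
    obtain x0 n where "\<bar>x0\<bar> \<le> 1" "u + of_int n \<in> ball (complex_of_real x0) (y0 / 32)" using red[OF u] by blast
    then have "(\<lambda>y. lat_sum (u + of_int n) y s) holomorphic_on ?B" using M(2) s unfolding hol3_def by blast
    then show "(\<lambda>y. lat_sum u y s) holomorphic_on ?B" by (simp only: lat_sum_shift)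
  next
    fix u y assume u: "u \<in> strip (y0 / 32)" and y: "y \<in> ?B"
    obtain x0 n where "\<bar>x0\<bar> \<le> 1" "u + of_int n \<in> ball (complex_of_real x0) (y0 / 32)" using red[OF u] by blast
    then have "(\<lambda>s. lat_sum (u + of_int n) y s) holomorphic_on C" using M(2) y unfolding hol3_def by blast
    then show "(\<lambda>s. lat_sum u y s) holomorphic_on C" by (simp only: lat_sum_shift)
  qed (use C open_strip in auto)
  then show ?thesis using M(1) by blast
qed

text \<open>Cauchy's inequality bounds the second derivative; the mean value inequality is applied
  to G' and to the increment of G. The step h = 1/c gives the decay c^(-2) that completion
  needs.\<close>

lemma second_difference_bound:
  assumes hol: "G holomorphic_on strip (2 * \<delta>)" and M: "\<And>u. u \<in> strip (2 * \<delta>) \<Longrightarrow> norm (G u) \<le> M"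
    and \<delta>: "\<delta> > 0" and u: "u \<in> strip \<delta>" and h: "h \<ge> 0"
  shows "norm (G (u + 2 * of_real h) - 2 * G (u + of_real h) + G u) \<le> 2 * M / \<delta>\<^sup>2 * h\<^sup>2"
proof -
  define B where "B = 2 * M / \<delta>\<^sup>2"
  have sub: "strip \<delta> \<subseteq> strip (2 * \<delta>)" using \<delta> by (auto simp: strip_def)
  have G2: "norm (deriv (deriv G) w) \<le> B" if w: "w \<in> strip \<delta>" for w
  proof -
    have "cball w \<delta> \<subseteq> strip (2 * \<delta>)"
    proof
      fix v assume "v \<in> cball w \<delta>"
      then have "norm (v - w) \<le> \<delta>" by (simp add: dist_norm norm_minus_commute)
      then have "\<bar>Im (v - w)\<bar> \<le> \<delta>" using abs_Im_le_cmod order_trans by blast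
      then show "v \<in> strip (2 * \<delta>)" using w by (auto simp: strip_def)
    qed
    then have "norm ((deriv ^^ 2) G w) \<le> fact 2 * M / \<delta>^2"
      using Cauchy_bound_cball[OF hol open_strip _ \<delta> M] by blast
    then show ?thesis by (simp add: numeral_2_eq_2 B_def)
  qed
  have d1: "(G has_field_derivative deriv G w) (at w)" and d2: "(deriv G has_field_derivative deriv (deriv G) w) (at w)"
    if "w \<in> strip \<delta>" for w
    using holomorphic_derivI[OF hol open_strip] holomorphic_derivI[OF holomorphic_deriv[OF hol open_strip] open_strip] sub that by blast+
  have sh: "w + of_real h \<in> strip \<delta>" if "w \<in> strip \<delta>" for w using that by (simp add: strip_def)
  have k': "norm (deriv G (w + of_real h) - deriv G w) \<le> B * h" if w: "w \<in> strip \<delta>" for w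
    using field_differentiable_bound[OF convex_strip, of \<delta> "deriv G" "deriv (deriv G)" B "w + of_real h" w] d2 G2 sh[OF w] w h
    by (auto intro: has_field_derivative_at_within)
  have "norm ((G (u + of_real h + of_real h) - G (u + of_real h)) - (G (u + of_real h) - G u)) \<le> B * h * norm ((u + of_real h) - u)"
  proof (rule field_differentiable_bound[OF convex_strip, of \<delta> "\<lambda>w. G (w + of_real h) - G w" "\<lambda>w. deriv G (w + of_real h) - deriv G w"])
    show "((\<lambda>w. G (w + of_real h) - G w) has_field_derivative deriv G (w + of_real h) - deriv G w) (at w within strip \<delta>)" if w: "w \<in> strip \<delta>" for w
      by (rule has_field_derivative_at_within, rule DERIV_diff) (use d1[OF w] d1[OF sh[OF w]] in \<open>auto simp: DERIV_shift\<close>)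
  qed (use k' u sh in auto)
  then show ?thesis using h by (simp add: B_def algebra_simps power2_eq_square)
qed

section \<open>Twisted sums and their Dirichlet series\<close>

definition twist_sum :: "int \<Rightarrow> nat \<Rightarrow> complex \<Rightarrow> complex \<Rightarrow> complex \<Rightarrow> complex" where
  "twist_sum m c x y s = (\<Sum>(e, e')\<in>unit_pairs c. add_char c (m * e') * lat_sum (x + of_int e / of_nat c) y s)"

text \<open>The fourth root of |m| d_3(c) is replaced by the larger |m| d_3(c), which avoids further
  fractional powers and leaves the exponent of c unchanged.\<close>

lemma kloosterman_bound_root:
  assumes c: "c > 0" and m: "m \<noteq> 0"
  shows "norm (kloosterman c m n) \<le> \<bar>real_of_int m\<bar> * (real c powr (7/8) * card (triples c))"
proof -
  define \<tau> where "\<tau> = real (card (triples c))"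
  have "(1, 1, c) \<in> triples c" by (simp add: triples_def)
  then have "card (triples c) \<ge> 1" using finite_triples[OF c] by (metis One_nat_def Suc_leI card_gt_0_iff empty_iff)
  then have t: "1 \<le> \<tau>" by (simp add: \<tau>_def)
  have m1: "1 \<le> \<bar>real_of_int m\<bar>" using m by linarith
  have p: "x \<le> x ^ 4" if "1 \<le> x" for x :: real using that self_le_power[of x 4] by simp
  have "norm (kloosterman c m n) ^ 4 \<le> \<bar>m\<bar> * (real c ^ 3 * sqrt c * \<tau>)"
    unfolding \<tau>_def using kloosterman_bound[OF c m, of n] by simp
  also have "real c ^ 3 * sqrt c = (real c powr (7/8)) ^ 4"
  proof -
    have "(real c powr (7/8)) ^ 4 = real c powr (7/2)" using c by (simp add: powr_power)
    also have "\<dots> = real c powr (3 + 1/2)" by simp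
    also have "\<dots> = real c powr 3 * real c powr (1/2)" by (rule powr_add)
    finally show ?thesis using c by (simp add: powr_half_sqrt flip: powr_numeral)
  qed
  also have "\<bar>m\<bar> * ((real c powr (7/8)) ^ 4 * \<tau>) \<le> \<bar>real_of_int m\<bar> ^ 4 * ((real c powr (7/8)) ^ 4 * \<tau> ^ 4)"
    using p[OF m1] p[OF t] t by (intro mult_mono) auto
  also have "\<dots> = (\<bar>real_of_int m\<bar> * (real c powr (7/8) * \<tau>)) ^ 4" by (simp add: power_mult_distrib)
  finally show ?thesis unfolding \<tau>_def by (subst (asm) power_mono_iff) auto
qed

text \<open>\<open>twisted_unit_sum_bound\<close> for the values of \<open>lat_sum\<close> at x +
  e/c: period 1 in x becomes period c in e, and a unit step in e is a step 1/c in x. Half of the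
  strip width y0/32 is given up to Cauchy's inequality.\<close>

lemma twist_sum_bound:
  assumes c: "c > 0" and m: "m \<noteq> 0" and y0: "y0 > 0"
    and h: "hol3 (strip (y0 / 32)) B C lat_sum M" and x: "x \<in> strip (y0 / 64)" and y: "y \<in> B" and s: "s \<in> C"
  shows "norm (twist_sum m c x y s) \<le> \<bar>real_of_int m\<bar> * (real c powr (7/8) * card (triples c)) * (M + 2 * (2 * M / (y0 / 64)\<^sup>2))"
  unfolding twist_sum_def
proof (rule twisted_unit_sum_bound[OF c])
  let ?g = "\<lambda>e::int. lat_sum (x + of_int e / of_nat c) y s"
  have sh: "x + of_int e / of_nat c \<in> strip r \<longleftrightarrow> x \<in> strip r" for e r
    by (simp add: strip_def Im_divide)
  have x': "x \<in> strip (y0 / 32)" using x y0 by (auto simp: strip_def)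
  have G: "norm (lat_sum u y s) \<le> M" if "u \<in> strip (y0 / 32)" for u
    using h that y s unfolding hol3_def by blast
  have hol: "(\<lambda>u. lat_sum u y s) holomorphic_on strip (2 * (y0 / 64))"
    using h y s unfolding hol3_def by simp
  show "?g (e + int c) = ?g e" for e
  proof -
    have "x + of_int (e + int c) / of_nat c = (x + of_int e / of_nat c) + of_int 1" using c by (simp add: field_simps)
    then show ?thesis by (simp only: lat_sum_shift)
  qed
  show "norm (?g e) \<le> M" for e by (rule G) (use sh x' in simp)
  show "norm (?g (e + 2) - 2 * ?g (e + 1) + ?g e) \<le> 2 * M / (y0 / 64)\<^sup>2 / (real c)\<^sup>2" for e
  proof -
    have b: "norm (lat_sum (x + of_int e / of_nat c + 2 * of_real (1 / real c)) y s
        - 2 * lat_sum (x + of_int e / of_nat c + of_real (1 / real c)) y s + lat_sum (x + of_int e / of_nat c) y s)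
        \<le> 2 * M / (y0 / 64)\<^sup>2 * (1 / real c)\<^sup>2"
      by (rule second_difference_bound[OF hol]) (use G y0 x sh in \<open>auto simp: hol3_def\<close>)
    have e: "x + of_int e / of_nat c + 2 * of_real (1 / real c) = x + of_int (e + 2) / of_nat c"
      "x + of_int e / of_nat c + of_real (1 / real c) = x + of_int (e + 1) / of_nat c"
      using c by (simp_all add: field_simps)
    show ?thesis using b unfolding e by (simp add: power_divide)
  qed
  show "norm (kloosterman c m n) \<le> \<bar>real_of_int m\<bar> * (real c powr (7/8) * card (triples c))" for n
    by (rule kloosterman_bound_root[OF c m])
qed

lemma hol3_twist_sum:
  assumes c: "c > 0" and m: "m \<noteq> 0" and y0: "y0 > 0"
    and h: "hol3 (strip (y0 / 32)) B C lat_sum M"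
  shows "hol3 (strip (y0 / 64)) B C (twist_sum m c)
     (\<bar>real_of_int m\<bar> * (real c powr (7/8) * card (triples c)) * (M + 2 * (2 * M / (y0 / 64)\<^sup>2)))"
  unfolding hol3_def
proof (intro conjI ballI)
  have sh: "x + of_int e / of_nat c \<in> strip (y0 / 32)" if "x \<in> strip (y0 / 64)" for x e
    using that y0 by (auto simp: strip_def Im_divide)
  fix x y s assume x: "x \<in> strip (y0 / 64)" and y: "y \<in> B" and s: "s \<in> C"
  show "norm (twist_sum m c x y s) \<le> \<bar>real_of_int m\<bar> * (real c powr (7/8) * card (triples c)) * (M + 2 * (2 * M / (y0 / 64)\<^sup>2))"
    by (rule twist_sum_bound[OF c m y0 h x y s])
next
  have sh: "x + of_int e / of_nat c \<in> strip (y0 / 32)" if "x \<in> strip (y0 / 64)" for x e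
    using that y0 by (auto simp: strip_def Im_divide)
  fix y s assume y: "y \<in> B" and s: "s \<in> C"
  have hol: "(\<lambda>u. lat_sum u y s) holomorphic_on strip (y0 / 32)" using h y s unfolding hol3_def by blast
  have "((\<lambda>u. lat_sum u y s) \<circ> (\<lambda>x. x + of_int e / of_nat c)) holomorphic_on strip (y0 / 64)" for e
    by (rule holomorphic_on_compose_gen[OF _ hol]) (use sh in \<open>auto intro!: holomorphic_intros\<close>)
  then show "(\<lambda>x. twist_sum m c x y s) holomorphic_on strip (y0 / 64)"
    unfolding twist_sum_def case_prod_unfold o_def by (intro holomorphic_intros)
next
  have sh: "x + of_int e / of_nat c \<in> strip (y0 / 32)" if "x \<in> strip (y0 / 64)" for x e
    using that y0 by (auto simp: strip_def Im_divide)
  fix x s assume x: "x \<in> strip (y0 / 64)" and s: "s \<in> C"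
  have "(\<lambda>y. lat_sum (x + of_int e / of_nat c) y s) holomorphic_on B" for e
    using h sh[OF x] s unfolding hol3_def by blast
  then show "(\<lambda>y. twist_sum m c x y s) holomorphic_on B"
    unfolding twist_sum_def case_prod_unfold by (intro holomorphic_intros)
next
  have sh: "x + of_int e / of_nat c \<in> strip (y0 / 32)" if "x \<in> strip (y0 / 64)" for x e
    using that y0 by (auto simp: strip_def Im_divide)
  fix x y assume x: "x \<in> strip (y0 / 64)" and y: "y \<in> B"
  have "(\<lambda>s. lat_sum (x + of_int e / of_nat c) y s) holomorphic_on C" for e
    using h sh[OF x] y unfolding hol3_def by blast
  then show "(\<lambda>s. twist_sum m c x y s) holomorphic_on C"
    unfolding twist_sum_def case_prod_unfold by (intro holomorphic_intros)
qed (use h open_strip in \<open>auto simp: hol3_def\<close>)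

lemma summable_nat_powr:
  assumes "w > 1" shows "(\<lambda>c::nat. real c powr (- w)) summable_on {1..}"
proof -
  have "summable (\<lambda>n. of_nat n powr (- w) :: real)" using assms by (simp add: summable_real_powr_iff)
  then have "(\<lambda>c::nat. real c powr (- w)) summable_on UNIV"
    by (intro norm_summable_imp_summable_on) simp
  then show ?thesis by (rule summable_on_subset_banach) auto
qed

text \<open>Regrouping (d1, d2, d3) by their product turns the series into the cube of the
  convergent sum of d^(-w).\<close>

lemma summable_triples_powr:
  assumes w: "w > 1"
  shows "(\<lambda>c. real c powr (- w) * card (triples c)) summable_on {1..}"
proof -
  let ?f = "\<lambda>d::nat. real d powr (- w)"
  note S = summable_nat_powr[OF w]
  have S2: "(\<lambda>(d2, d3). ?f d2 * ?f d3) summable_on (SIGMA d2:{1..}. {1..})"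
  proof (rule summable_on_SigmaI)
    show "((\<lambda>d3. case (d2, d3) of (d2, d3) \<Rightarrow> ?f d2 * ?f d3) has_sum ?f d2 * infsum ?f {1..}) {1..}" for d2
      using S by (auto intro!: has_sum_cmult_right has_sum_infsum)
    show "(\<lambda>d2. ?f d2 * infsum ?f {1..}) summable_on {1..}" by (intro summable_on_cmult_left S)
  qed auto
  define I2 where "I2 = infsum (\<lambda>(d2, d3). ?f d2 * ?f d3) (SIGMA d2:{1::nat..}. {1::nat..})"
  have S3: "(\<lambda>(d1, d2, d3). ?f d1 * (?f d2 * ?f d3)) summable_on (SIGMA d1:{1..}. SIGMA d2:{1..}. {1..})"
  proof (rule summable_on_SigmaI)
    show "((\<lambda>p. case (d1, p) of (d1, d2, d3) \<Rightarrow> ?f d1 * (?f d2 * ?f d3)) has_sum ?f d1 * I2) (SIGMA d2:{1..}. {1..})" for d1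
      using has_sum_cmult_right[OF has_sum_infsum[OF S2], of "?f d1"]
      by (simp add: case_prod_unfold I2_def)
    show "(\<lambda>d1. ?f d1 * I2) summable_on {1..}" by (intro summable_on_cmult_left S)
  qed auto
  let ?T = "SIGMA c:{1::nat..}. triples c"
  have bij: "bij_betw snd ?T (SIGMA d1:{1::nat..}. SIGMA d2:{1::nat..}. {1::nat..})"
  proof (rule bij_betwI[where g = "\<lambda>(d1, d2, d3). (d1 * d2 * d3, d1, d2, d3)"])
    show "snd \<in> ?T \<rightarrow> (SIGMA d1:{1::nat..}. SIGMA d2:{1::nat..}. {1::nat..})"
      by (auto simp: triples_def Suc_le_eq intro!: Nat.gr0I)
    show "(\<lambda>(d1, d2, d3). (d1 * d2 * d3, d1, d2, d3)) \<in> (SIGMA d1:{1::nat..}. SIGMA d2:{1::nat..}. {1::nat..}) \<rightarrow> ?T"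
      by (auto simp: triples_def Suc_le_eq)
  qed (auto simp: triples_def)
  have "(\<lambda>q. case snd q of (d1, d2, d3) \<Rightarrow> ?f d1 * (?f d2 * ?f d3)) summable_on ?T"
    using S3 by (subst summable_on_reindex_bij_betw[OF bij])
  then have "(\<lambda>(c, p). case p of (d1, d2, d3) \<Rightarrow> ?f d1 * (?f d2 * ?f d3)) summable_on ?T"
    by (simp add: case_prod_unfold)
  then have "(\<lambda>c. infsum (\<lambda>p. case p of (d1, d2, d3) \<Rightarrow> ?f d1 * (?f d2 * ?f d3)) (triples c)) summable_on {1..}"
    by (rule summable_on_Sigma_banach)
  also have "?this \<longleftrightarrow> (\<lambda>c. real c powr (- w) * card (triples c)) summable_on {1..}"
  proof (rule summable_on_cong)
    fix c :: nat assume "c \<in> {1..}"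
    then have fin: "finite (triples c)" by (intro finite_triples) auto
    have "infsum (\<lambda>p. case p of (d1, d2, d3) \<Rightarrow> ?f d1 * (?f d2 * ?f d3)) (triples c) =
        (\<Sum>p\<in>triples c. case p of (d1, d2, d3) \<Rightarrow> ?f d1 * (?f d2 * ?f d3))"
      by (rule infsum_finite[OF fin])
    also have "\<dots> = (\<Sum>p\<in>triples c. real c powr (- w))"
      by (intro sum.cong refl) (auto simp: triples_def powr_mult mult.assoc)
    finally show "infsum (\<lambda>p. case p of (d1, d2, d3) \<Rightarrow> ?f d1 * (?f d2 * ?f d3)) (triples c) = real c powr (- w) * card (triples c)"
      by (simp add: mult.commute)
  qed
  finally show ?thesis .
qed

definition main_sum :: "int \<Rightarrow> complex \<Rightarrow> complex \<Rightarrow> complex \<Rightarrow> complex" where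
  "main_sum m x y s = (\<Sum>\<^sub>\<infinity>c\<in>{1::nat..}. of_nat c powr (- 2 * s) * twist_sum m c x y s)"

lemma hol3_main_sum:
  assumes m: "m \<noteq> 0" and y0: "y0 > 0" and C: "open C" and \<sigma>: "15/16 < \<sigma>1"
    and s: "\<And>s. s \<in> C \<Longrightarrow> \<sigma>1 \<le> Re s \<and> Re s \<le> \<sigma>2 \<and> norm s \<le> S"
  shows "\<exists>M. hol3 (strip (y0 / 64)) (ball (of_real y0) (y0 / 32)) C (main_sum m) M"
proof -
  let ?B = "ball (complex_of_real y0) (y0 / 32)"
  obtain M where M: "M \<ge> 0" "hol3 (strip (y0 / 32)) ?B C lat_sum M"
    using lat_sum_strip[OF y0 C _ s] \<sigma> by fastforce
  define K where "K = \<bar>real_of_int m\<bar> * (M + 2 * (2 * M / (y0 / 64)\<^sup>2))"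
  have K: "K \<ge> 0" using M(1) by (simp add: K_def)
  \<comment> \<open>Here c^(-2 sigma1) meets the Kloosterman bound c^(7/8) d_3(c); 2 sigma1 - 7/8 >
    1 is the condition sigma1 > 15/16.\<close>
  define N where "N = (\<lambda>c::nat. K * (real c powr (- (2 * \<sigma>1 - 7/8)) * card (triples c)))"
  have Ns: "N summable_on {1..}"
    unfolding N_def using \<sigma> by (intro summable_on_cmult_right summable_triples_powr) auto
  have "hol3 (strip (y0 / 64)) ?B C (main_sum m) (infsum N {1..})"
    unfolding main_sum_def[abs_def]
  proof (rule hol3_infsum[OF _ Ns])
    fix c :: nat assume "c \<in> {1..}"
    then have c: "c > 0" by simp
    note h = hol3_twist_sum[OF c m y0 M(2)]
    have cn: "complex_of_nat c \<notin> \<real>\<^sub>\<le>\<^sub>0" using c by (auto simp: complex_nonpos_Reals_iff)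
    show "hol3 (strip (y0 / 64)) ?B C (\<lambda>x y s. of_nat c powr (- 2 * s) * twist_sum m c x y s) (N c)"
      unfolding hol3_def
    proof (intro conjI ballI)
      fix x y t assume x: "x \<in> strip (y0 / 64)" and y: "y \<in> ?B" and t: "t \<in> C"
      have "norm (complex_of_nat c powr (- 2 * t)) = real c powr (- 2 * Re t)"
        using c by (subst norm_powr_real_powr) auto
      also have "\<dots> \<le> real c powr (- 2 * \<sigma>1)" using c s[OF t] by (intro powr_mono) auto
      finally have "norm (complex_of_nat c powr (- 2 * t) * twist_sum m c x y t) \<le>
          real c powr (- 2 * \<sigma>1) * (\<bar>real_of_int m\<bar> * (real c powr (7/8) * card (triples c)) * (M + 2 * (2 * M / (y0 / 64)\<^sup>2)))"
        unfolding norm_mult by (intro mult_mono twist_sum_bound[OF c m y0 M(2) x y t]) auto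
      also have "\<dots> = K * (real c powr (- 2 * \<sigma>1) * real c powr (7/8) * card (triples c))" by (simp only: K_def mult_ac)
      also have "real c powr (- 2 * \<sigma>1) * real c powr (7/8) = real c powr (- (2 * \<sigma>1 - 7/8))" by (simp flip: powr_add)
      finally show "norm (complex_of_nat c powr (- 2 * t) * twist_sum m c x y t) \<le> N c" by (simp only: N_def)
    next
      fix y t assume "y \<in> ?B" "t \<in> C"
      then have "(\<lambda>x. twist_sum m c x y t) holomorphic_on strip (y0 / 64)" using h unfolding hol3_def by blast
      then show "(\<lambda>x. of_nat c powr (- 2 * t) * twist_sum m c x y t) holomorphic_on strip (y0 / 64)"
        by (intro holomorphic_intros)
    next
      fix x t assume "x \<in> strip (y0 / 64)" "t \<in> C"
      then have "(\<lambda>y. twist_sum m c x y t) holomorphic_on ?B" using h unfolding hol3_def by blast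
      then show "(\<lambda>y. of_nat c powr (- 2 * t) * twist_sum m c x y t) holomorphic_on ?B"
        by (intro holomorphic_intros)
    next
      fix x y assume "x \<in> strip (y0 / 64)" "y \<in> ?B"
      then have "(\<lambda>t. twist_sum m c x y t) holomorphic_on C" using h unfolding hol3_def by blast
      then show "(\<lambda>t. of_nat c powr (- 2 * t) * twist_sum m c x y t) holomorphic_on C"
        by (intro holomorphic_intros) (use cn in auto)
    qed (use C open_strip in auto)
  qed (use C open_strip in auto)
  then show ?thesis by blast
qed

definition row_char :: "int \<Rightarrow> int \<times> int \<Rightarrow> complex" where
  "row_char m p = exp (2 * of_real pi * \<i> * of_int m * (of_int (row_matrix (fst p) (snd p) $ 1 $ 1) / of_int (fst p)))"

text \<open>The row (0, 1) has no finite cusp a/c. It contributes 0 here and stays entirely in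
  \<open>diff_term\<close>.\<close>

definition main_term :: "int \<Rightarrow> int \<times> int \<Rightarrow> complex \<Rightarrow> complex \<Rightarrow> complex \<Rightarrow> complex" where
  "main_term m p x y s = (if fst p > 0 then im_part (fst p) (snd p) x y powr s * row_char m p else 0)"

lemma norm_row_char [simp]: "norm (row_char m p) = 1"
  by (simp add: row_char_def)

text \<open>The determinant condition says that a times the bottom right entry is 1 modulo c, so a
  is the inverse e' of e. The choice made in \<open>row_matrix\<close> can change a only by a
  multiple of c.\<close>

lemma row_char_eq:
  assumes c: "c > 0" and e: "(e, e') \<in> unit_pairs c" and p: "(int c, e + int c * n) \<in> row_index"
  shows "row_char m (int c, e + int c * n) = add_char c (m * e')"
proof -
  define R where "R = row_matrix (int c) (e + int c * n)"
  note r = row_index_row_matrix[OF p, unfolded fst_conv snd_conv, folded R_def]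
  have "R $ 1 $ 1 * (e + int c * n) - R $ 1 $ 2 * int c = 1" using r by (simp add: SL2Z_iff)
  then have "R $ 1 $ 1 * e - 1 = int c * (R $ 1 $ 2 - R $ 1 $ 1 * n)" by (simp add: algebra_simps)
  then have "[R $ 1 $ 1 * e = 1] (mod int c)" by (metis cong_iff_dvd_diff dvd_triv_left)
  then have 1: "[R $ 1 $ 1 * e * e' = 1 * e'] (mod int c)" by (rule cong_scalar_right)
  have 2: "[R $ 1 $ 1 * (e * e') = R $ 1 $ 1 * 1] (mod int c)"
    by (rule cong_scalar_left, rule unit_pairs_cong[OF e])
  have "[R $ 1 $ 1 = e'] (mod int c)"
    using cong_trans[OF cong_sym[OF 2]] 1 by (simp add: mult.assoc)
  then have "add_char c (m * R $ 1 $ 1) = add_char c (m * e')"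
    by (intro add_char_cong[OF c] cong_scalar_left)
  moreover have "row_char m (int c, e + int c * n) = add_char c (m * R $ 1 $ 1)"
    unfolding row_char_def add_char_def cis_conv_exp fst_conv snd_conv R_def
    by (intro arg_cong[where f = exp]) (simp add: mult_ac)
  ultimately show ?thesis by simp
qed

text \<open>Division of d by c with remainder e. The inverse e' is determined by e, so recording it
  does not enlarge the index set.\<close>

lemma bij_betw_row_residues:
  "bij_betw (\<lambda>(c, (e, e'), n). (int c, e + int c * n)) (SIGMA c:{1..}. unit_pairs c \<times> UNIV) {p \<in> row_index. fst p > 0}"
  unfolding bij_betw_def
proof
  let ?h = "\<lambda>(c, (e, e'), n). (int c, e + int c * n)"
  show "inj_on ?h (SIGMA c:{1..}. unit_pairs c \<times> UNIV)"
  proof (rule inj_onI, clarsimp)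
    fix c e e' n f f' k
    assume c: "Suc 0 \<le> c" and e: "(e, e') \<in> unit_pairs c" and f: "(f, f') \<in> unit_pairs c"
      and eq: "e + int c * n = f + int c * k"
    have r: "e mod int c = e" "f mod int c = f" using e f by (auto simp: unit_pairs_def)
    have "e = (e + int c * n) mod int c" using r by simp
    also have "\<dots> = f" unfolding eq using r by simp
    finally have "e = f" .
    moreover from this have "n = k" using eq c by simp
    ultimately show "e = f \<and> e' = f' \<and> n = k" using e f unit_pairs_unique by blast
  qed
  show "?h ` (SIGMA c:{1..}. unit_pairs c \<times> UNIV) = {p \<in> row_index. fst p > 0}"
  proof (intro equalityI subsetI)
    fix p assume "p \<in> ?h ` (SIGMA c:{1..}. unit_pairs c \<times> UNIV)"
    then obtain c e e' n where c: "c \<ge> 1" "(e, e') \<in> unit_pairs c" and p: "p = (int c, e + int c * n)" by auto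
    have "[e * e' = 1] (mod int c)" using c(2) by (rule unit_pairs_cong)
    then have "coprime e (int c)" by (metis coprime_iff_invertible_int)
    then have "coprime (int c) (e + int c * n)"
      by (metis coprime_commute gcd_add_mult coprime_iff_gcd_eq_1 add.commute mult.commute)
    then show "p \<in> {p \<in> row_index. fst p > 0}" using c p by (auto simp: row_index_def)
  next
    fix p assume p: "p \<in> {p \<in> row_index. fst p > 0}"
    define c where "c = nat (fst p)"
    have c: "c \<ge> 1" "fst p = int c" using p by (auto simp: c_def)
    have "coprime (snd p) (int c)" using p c by (auto simp: row_index_def coprime_commute)
    then obtain x where "[snd p * x = 1] (mod int c)" by (auto simp: coprime_iff_invertible_int)
    then have "[(snd p mod int c) * (x mod int c) = 1] (mod int c)" by (simp add: cong_def mod_mult_eq)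
    then have "(snd p mod int c, x mod int c) \<in> unit_pairs c" using c by (auto simp: unit_pairs_def)
    then have "(c, (snd p mod int c, x mod int c), snd p div int c) \<in> (SIGMA c:{1..}. unit_pairs c \<times> UNIV)"
      using c by simp
    moreover have "p = ?h (c, (snd p mod int c, x mod int c), snd p div int c)"
      using c by (cases p) simp
    ultimately show "p \<in> ?h ` (SIGMA c:{1..}. unit_pairs c \<times> UNIV)" by (rule rev_image_eqI)
  qed
qed

lemma near_point_of_real: "y > 0 \<Longrightarrow> near_point x y (of_real x) (of_real y)"
  by (simp add: near_point_def)

lemma summable_main_term:
  assumes y: "y > 0" and s: "Re s > 1"
  shows "(\<lambda>p. main_term m p (of_real x) (of_real y) s) summable_on row_index"
proof -
  obtain K where K: "K \<ge> 0" "\<forall>c d x0 x z t. (c, d) \<noteq> (0, 0) \<longrightarrow> near_point x0 y x z \<longrightarrow> Re s \<le> Re t \<longrightarrow> Re t \<le> Re s \<longrightarrow> norm t \<le> norm s \<longrightarrow>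
     norm ((of_real 1 * im_part c d x z) powr t) \<le> K * (y / row_norm c d x0 y) powr Re s"
    using im_part_powr_bound[OF y, of 1 "Re s" "Re s" "norm s"] s by auto
  have bd: "norm (main_term m p (of_real x) (of_real y) s) \<le> K * ((y * lattice_const \<bar>x\<bar> y) powr Re s * pair_weight (Re s) p)"
    if "p \<in> row_index" for p
  proof -
    have p: "(fst p, snd p) \<noteq> (0, 0)" using row_index_row_matrix(4)[OF that] by simp
    have "norm (main_term m p (of_real x) (of_real y) s) \<le> norm (im_part (fst p) (snd p) (of_real x) (of_real y) powr s)"
      by (simp add: main_term_def norm_mult)
    also have "\<dots> \<le> K * (y / row_norm (fst p) (snd p) x y) powr Re s"
      using K(2)[rule_format, OF p near_point_of_real[OF y], of s] by simp
    also have "\<dots> \<le> K * ((y * lattice_const \<bar>x\<bar> y) powr Re s * pair_weight (Re s) p)"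
      using row_norm_powr_le[OF y order_refl p, of "Re s"] s K(1) by (intro mult_left_mono) auto
    finally show ?thesis .
  qed
  have sm: "(\<lambda>p. K * ((y * lattice_const \<bar>x\<bar> y) powr Re s * pair_weight (Re s) p)) summable_on row_index"
    using s by (intro summable_on_cmult_right summable_pair_weight) auto
  show ?thesis
    by (rule abs_summable_summable, rule summable_on_comparison_test[OF sm]) (use bd in auto)
qed

text \<open>Absolute convergence permits regrouping by c, by the residue e and by the quotient n.
  The sum over n is \<open>lat_sum\<close>, and e enters through the character and the shift
  e/c.\<close>

lemma infsum_main_term:
  assumes y: "y > 0" and s: "Re s > 1"
  shows "(\<Sum>\<^sub>\<infinity>p\<in>row_index. main_term m p (of_real x) (of_real y) s) = main_sum m (of_real x) (of_real y) s"
proof -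
  let ?f = "\<lambda>p. main_term m p (of_real x) (of_real y) s"
  let ?h = "\<lambda>(c, (e, e'), n). (int c, e + int c * n)"
  let ?S = "SIGMA c:{1::nat..}. unit_pairs c \<times> (UNIV :: int set)"
  have sum: "?f summable_on {p \<in> row_index. fst p > 0}"
    by (rule summable_on_subset_banach[OF summable_main_term[OF y s]]) auto
  have sumS: "(\<lambda>q. ?f (?h q)) summable_on ?S"
    using sum by (subst summable_on_reindex_bij_betw[OF bij_betw_row_residues])
  have eq: "?f (?h (c, (e, e'), n)) = of_nat c powr (- 2 * s) * (add_char c (m * e') * im_part 1 n (of_real x + of_int e / of_nat c) (of_real y) powr s)"
    if c: "c \<ge> 1" and e: "(e, e') \<in> unit_pairs c" for c e e' n
  proof -
    have p: "(int c, e + int c * n) \<in> row_index"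
      using bij_betwE[OF bij_betw_row_residues] c e by fastforce
    define w where "w = im_part 1 n (of_real (x + of_int e / of_nat c)) (of_real y)"
    define q where "q = y / row_norm 1 n (x + of_int e / of_nat c) y"
    have w: "w = of_real q"
      unfolding w_def q_def im_part_def lin_plus_mult_lin_minus_of_real by simp
    have q: "q > 0" unfolding q_def using y row_norm_pos[OF y, of 1 n] by simp
    \<comment> \<open>At real points both factors are positive reals, so the principal power is
      multiplicative.\<close>
    have "(w / (of_nat c)\<^sup>2) powr s = of_nat c powr (- 2 * s) * w powr s"
    proof -
      have "w / (of_nat c)\<^sup>2 = of_real (inverse ((real c)\<^sup>2)) * of_real q" by (simp add: w field_simps)
      then have "(w / (of_nat c)\<^sup>2) powr s = of_real (inverse ((real c)\<^sup>2)) powr s * of_real q powr s"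
        using q by (simp only:) (rule powr_times_real, auto)
      also have "complex_of_real (inverse ((real c)\<^sup>2)) powr s = of_nat c powr (- 2 * s)"
      proof -
        have "ln (inverse ((real c)\<^sup>2)) = - 2 * ln (real c)" using c by (simp add: ln_inverse ln_realpow)
        moreover have "Ln (of_nat c) = of_real (ln (real c))" using c by (metis Ln_of_real of_nat_0_less_iff of_real_of_nat_eq zero_less_one less_le_trans)
        moreover have "Ln (of_real (inverse ((real c)\<^sup>2))) = of_real (ln (inverse ((real c)\<^sup>2)))" using c by (intro Ln_of_real) auto
        ultimately show ?thesis using c by (simp add: powr_def mult_ac)
      qed
      finally show ?thesis by (simp add: w)
    qed
    then show ?thesis
      using c row_char_eq[OF _ e p, of m] im_part_scale[of c e n "of_real x" "of_real y"]
      by (simp add: main_term_def w_def)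
  qed
  have "infsum ?f row_index = infsum ?f {p \<in> row_index. fst p > 0}"
    by (rule infsum_cong_neutral) (auto simp: main_term_def)
  also have "\<dots> = infsum (\<lambda>q. ?f (?h q)) ?S"
    by (rule infsum_reindex_bij_betw[OF bij_betw_row_residues, symmetric])
  also have "\<dots> = (\<Sum>\<^sub>\<infinity>c\<in>{1..}. infsum (\<lambda>q. ?f (?h (c, q))) (unit_pairs c \<times> UNIV))"
    by (rule infsum_Sigma_banach[OF sumS, symmetric])
  also have "\<dots> = main_sum m (of_real x) (of_real y) s"
    unfolding main_sum_def
  proof (rule infsum_cong)
    fix c :: nat assume c: "c \<in> {1..}"
    have sc: "(\<lambda>q. ?f (?h (c, q))) summable_on (unit_pairs c \<times> UNIV)"
    proof (rule summable_on_SigmaD1[OF _ c])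
      show "(\<lambda>(c, q). ?f (?h (c, q))) summable_on ?S" using sumS by (simp add: case_prod_unfold)
    qed
    have "infsum (\<lambda>q. ?f (?h (c, q))) (unit_pairs c \<times> UNIV) = (\<Sum>\<^sub>\<infinity>e\<in>unit_pairs c. \<Sum>\<^sub>\<infinity>n. ?f (?h (c, e, n)))"
      by (rule infsum_Sigma_banach[OF sc, symmetric])
    also have "\<dots> = (\<Sum>e\<in>unit_pairs c. \<Sum>\<^sub>\<infinity>n. ?f (?h (c, e, n)))"
      by (rule infsum_finite) auto
    also have "\<dots> = (\<Sum>(e, e')\<in>unit_pairs c. of_nat c powr (- 2 * s) * (add_char c (m * e') * lat_sum (of_real x + of_int e / of_nat c) (of_real y) s))"
    proof (intro sum.cong refl)
      fix p assume p: "p \<in> unit_pairs c"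
      obtain e e' where ee: "p = (e, e')" by force
      have "(\<Sum>\<^sub>\<infinity>n. ?f (?h (c, p, n))) = (\<Sum>\<^sub>\<infinity>n. of_nat c powr (- 2 * s) * (add_char c (m * e') * im_part 1 n (of_real x + of_int e / of_nat c) (of_real y) powr s))"
        unfolding ee using c p ee by (intro infsum_cong eq) auto
      also have "\<dots> = of_nat c powr (- 2 * s) * (add_char c (m * e') * lat_sum (of_real x + of_int e / of_nat c) (of_real y) s)"
        unfolding lat_sum_def by (simp only: infsum_cmult_right')
      finally show "(\<Sum>\<^sub>\<infinity>n. ?f (?h (c, p, n))) = (case p of (e, e') \<Rightarrow>
          of_nat c powr (- 2 * s) * (add_char c (m * e') * lat_sum (of_real x + of_int e / of_nat c) (of_real y) s))"
        by (simp add: ee)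
    qed
    also have "\<dots> = of_nat c powr (- 2 * s) * twist_sum m c (of_real x) (of_real y) s"
      by (simp add: twist_sum_def sum_distrib_left case_prod_unfold)
    finally show "infsum (\<lambda>q. ?f (?h (c, q))) (unit_pairs c \<times> UNIV) = of_nat c powr (- 2 * s) * twist_sum m c (of_real x) (of_real y) s" .
  qed
  finally show ?thesis .
qed

section \<open>The remainder after the main term\<close>

lemma powr_of_real_mult:
  assumes "a > 0" "w \<noteq> 0"
  shows "(of_real a * w) powr s = of_real a powr s * (w powr s :: complex)"
proof -
  have "Ln (of_real a * w) = Ln (of_real a) + Ln w" using Ln_times_of_real[OF assms] by simp
  then show ?thesis using assms by (simp add: powr_def ring_distribs exp_add)
qed

text \<open>\<open>main_term\<close> keeps the leading power of the Whittaker function at \<open>0\<close> and replaces \<open>Re (\<gamma> z)\<close> by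
  \<open>a / c\<close>. The error gains a factor \<open>(Im (\<gamma> z))\<^bsup>1/2\<^esup>\<close>, which suffices for convergence beyond \<open>Re s = 1\<close>.\<close>
definition diff_term :: "int \<Rightarrow> int \<times> int \<Rightarrow> complex \<Rightarrow> complex \<Rightarrow> complex \<Rightarrow> complex" where
  "diff_term m p x y s = slash_term 0 m (row_matrix (fst p) (snd p)) x y s -
     of_real (4 * pi * \<bar>real_of_int m\<bar>) powr s * main_term m p x y s"

text \<open>Two approximations are made in a row with c > 0: exp(-T/2) 1F1 = 1 + O(|T|), and e(m
  Re(gamma z)) = e(ma/c) + O(|cz + d|^(-1)). With omega = y/|cz + d|^2 both errors are
  O(omega^(1/2)), the first because omega is bounded. The power T^s contributes
  omega^(sigma1).\<close>

lemma diff_term_bound: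
  assumes y0: "y0 > 0" and m: "m \<noteq> 0" and \<sigma>: "1/2 \<le> \<sigma>1"
  shows "\<exists>K\<ge>0. \<forall>p\<in>row_index. \<forall>x0 x y s. near_point x0 y0 x y \<longrightarrow> \<sigma>1 \<le> Re s \<longrightarrow> Re s \<le> \<sigma>2 \<longrightarrow> norm s \<le> S \<longrightarrow>
     norm (diff_term m p x y s) \<le> K * (y0 / row_norm (fst p) (snd p) x0 y0) powr (\<sigma>1 + 1/2)"
proof -
  define a where "a = 4 * pi * \<bar>real_of_int m\<bar>"
  have a: "a > 0" using m by (simp add: a_def)
  obtain K1 where K1: "K1 \<ge> 0" "\<forall>A\<in>carrier SL2Z. \<forall>x0 x y s. near_point x0 y0 x y \<longrightarrow> \<sigma>1 \<le> Re s \<longrightarrow> Re s \<le> \<sigma>2 \<longrightarrow> norm s \<le> S \<longrightarrow>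
     norm (slash_term 0 m A x y s) \<le> K1 * (y0 / row_norm (A $ 2 $ 1) (A $ 2 $ 2) x0 y0) powr \<sigma>1"
    using slash_term_bound[OF y0 m \<sigma>] by blast
  have "0 \<le> \<sigma>1" using \<sigma> by simp
  then obtain K4 where K4: "K4 \<ge> 0" "\<forall>c d x0 x y s. (c, d) \<noteq> (0, 0) \<longrightarrow> near_point x0 y0 x y \<longrightarrow> \<sigma>1 \<le> Re s \<longrightarrow> Re s \<le> \<sigma>2 \<longrightarrow> norm s \<le> S \<longrightarrow>
     norm ((of_real a * im_part c d x y) powr s) \<le> K4 * (y0 / row_norm c d x0 y0) powr \<sigma>1"
    using im_part_powr_bound[OF y0 a] by blast
  define L0 where "L0 = y0 / min 1 (y0\<^sup>2)"
  have L0: "L0 > 0" using y0 by (simp add: L0_def)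
  define L where "L = 5/4 * (a * L0)"
  define u0 where "u0 = 2 * pi * \<bar>real_of_int m\<bar> * (16/15)"
  define E0 where "E0 = exp (2 * pi * \<bar>real_of_int m\<bar> * (y0 + 2 / y0))"
  define K2 where "K2 = exp L * ((S + 1) * exp ((S + 1) * L)) + exp L"
  define K3 where "K3 = K2 * (5/4 * a * sqrt L0) * E0 + u0 / sqrt y0 * exp (u0 / sqrt y0 * sqrt L0)"
  define K where "K = max (K1 / sqrt y0) (K4 * K3)"
  have main: "norm (diff_term m p x y s) \<le> K * (y0 / row_norm (fst p) (snd p) x0 y0) powr (\<sigma>1 + 1/2)"
    if p: "p \<in> row_index" and near: "near_point x0 y0 x y" and s: "\<sigma>1 \<le> Re s" "Re s \<le> \<sigma>2" "norm s \<le> S" for p x0 x y s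
  proof -
    define A where "A = row_matrix (fst p) (snd p)"
    note R = row_index_row_matrix[OF p, folded A_def]
    have cd: "(fst p, snd p) \<noteq> (0, 0)" using R(4) by simp
    define r where "r = row_norm (fst p) (snd p) x0 y0"
    have r: "r > 0" unfolding r_def by (rule row_norm_pos[OF y0 cd])
    define \<omega> where "\<omega> = y0 / r"
    have \<omega>: "\<omega> > 0" using y0 r by (simp add: \<omega>_def)
    have split: "\<omega> powr (\<sigma>1 + 1/2) = \<omega> powr \<sigma>1 * sqrt \<omega>" using \<omega> by (simp add: powr_add powr_half_sqrt)
    show ?thesis
    proof (cases "fst p > 0")
      case False
      then have "fst p = 0" "snd p = 1" using p by (auto simp: row_index_def)
      \<comment> \<open>In the row (0, 1) omega equals y0, so dividing the constant by sqrt(y0)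
        inserts the factor sqrt(omega).\<close>
      then have r1: "r = 1" by (simp add: r_def row_norm_def)
      have "norm (diff_term m p x y s) = norm (slash_term 0 m A x y s)"
        using False by (simp add: diff_term_def main_term_def A_def)
      also have "\<dots> \<le> K1 * \<omega> powr \<sigma>1"
        using K1(2)[rule_format, OF R(1) near s] R by (simp add: \<omega>_def r_def)
      also have "\<dots> = K1 / sqrt y0 * (\<omega> powr \<sigma>1 * sqrt \<omega>)"
        using y0 by (simp add: \<omega>_def r1)
      also have "\<dots> \<le> K * (\<omega> powr \<sigma>1 * sqrt \<omega>)"
        using \<omega> by (intro mult_right_mono) (auto simp: K_def)
      finally show ?thesis unfolding split[symmetric] unfolding \<omega>_def r_def .
    next
      case True
      define T where "T = of_real a * im_part (fst p) (snd p) x y"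
      have T1: "T \<notin> \<real>\<^sub>\<le>\<^sub>0" and T2: "norm T \<le> 5/4 * (a * \<omega>)"
        unfolding T_def r_def \<omega>_def using near_point_im_part[OF y0 cd near a] by auto
      have T0: "T \<noteq> 0" and im0: "im_part (fst p) (snd p) x y \<noteq> 0" using T1 by (auto simp: T_def)
      have \<omega>L: "\<omega> \<le> L0"
        using row_norm_ge[OF y0 cd, of x0] y0 r unfolding \<omega>_def L0_def r_def by (intro divide_left_mono) auto
      have "5/4 * (a * \<omega>) \<le> L" unfolding L_def using \<omega>L a by (intro mult_left_mono) auto
      then have TL: "norm T \<le> L" using T2 by linarith
      have sq: "\<omega> \<le> sqrt L0 * sqrt \<omega>"
      proof -
        have "\<omega> = sqrt \<omega> * sqrt \<omega>" using \<omega> by simp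
        also have "\<dots> \<le> sqrt L0 * sqrt \<omega>" using \<omega>L \<omega> by (intro mult_right_mono) auto
        finally show ?thesis .
      qed
      define X where "X = exp (- T / 2) * hyp11 s (2 * s) T"
      define E where "E = exp (2 * of_real pi * \<i> * of_int m * re_part A x y)"
      define \<eta> where "\<eta> = row_char m p"
      have S0: "S \<ge> 0" using s(3) norm_ge_zero order_trans by blast
      have eT: "norm (exp (- T / 2)) \<le> exp L"
      proof -
        have "Re (- T / 2) \<le> norm T" using abs_Re_le_cmod[of T] by simp
        then show ?thesis unfolding norm_exp_eq_Re exp_le_cancel_iff using TL by linarith
      qed
      have X1: "norm (X - 1) \<le> K2 * norm T"
      proof -
        have "norm (hyp11 s (2 * s) T - 1) \<le> exp ((S + 1) * norm T) - 1"
          using s \<sigma> by (intro norm_hyp11_minus_1_le) auto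
        also have "\<dots> \<le> ((S + 1) * norm T) * exp ((S + 1) * norm T)"
          using S0 by (intro exp_minus_1_le) auto
        also have "\<dots> \<le> ((S + 1) * norm T) * exp ((S + 1) * L)"
          using S0 TL by (intro mult_left_mono) (auto intro!: mult_left_mono)
        finally have h: "norm (hyp11 s (2 * s) T - 1) \<le> ((S + 1) * norm T) * exp ((S + 1) * L)" .
        have "norm (exp (- T / 2) - 1) \<le> norm (- T / 2) * exp (norm (- T / 2))" by (rule norm_exp_minus_1_le)
        also have "\<dots> \<le> norm T * exp L"
        proof (rule mult_mono)
          show half: "norm (- T / 2) \<le> norm T" by (simp add: norm_divide)
          show "exp (norm (- T / 2)) \<le> exp L" unfolding exp_le_cancel_iff by (rule order.trans[OF half TL])
        qed auto
        finally have e: "norm (exp (- T / 2) - 1) \<le> norm T * exp L" .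
        have "X - 1 = exp (- T / 2) * (hyp11 s (2 * s) T - 1) + (exp (- T / 2) - 1)" by (simp add: X_def algebra_simps)
        then have "norm (X - 1) \<le> norm (exp (- T / 2)) * norm (hyp11 s (2 * s) T - 1) + norm (exp (- T / 2) - 1)"
          by (metis norm_mult norm_triangle_ineq)
        also have "\<dots> \<le> exp L * (((S + 1) * norm T) * exp ((S + 1) * L)) + norm T * exp L"
          using eT h e by (intro add_mono mult_mono) auto
        also have "\<dots> = K2 * norm T" by (simp add: K2_def algebra_simps)
        finally show ?thesis .
      qed
      have E0: "norm E \<le> E0" unfolding E_def E0_def by (rule norm_exp_re_part_le[OF R(1) y0 near])
      have K2: "K2 \<ge> 0" using S0 by (simp add: K2_def)
      have E1: "norm (E - \<eta>) \<le> u0 / sqrt y0 * exp (u0 / sqrt y0 * sqrt L0) * sqrt \<omega>"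
      proof -
        define v where "v = 2 * of_real pi * \<i> * of_int m * (re_part A x y - of_int (A $ 1 $ 1) / of_int (A $ 2 $ 1))"
        have "E = \<eta> * exp v" unfolding E_def \<eta>_def row_char_def v_def exp_add[symmetric]
          using R(2) by (intro arg_cong[where f = exp]) (simp add: A_def algebra_simps)
        then have "norm (E - \<eta>) = norm (exp v - 1)" by (simp add: \<eta>_def norm_mult flip: right_diff_distrib[of \<eta> _ 1, simplified])
        also have "\<dots> \<le> norm v * exp (norm v)" by (rule norm_exp_minus_1_le)
        finally have 1: "norm (E - \<eta>) \<le> norm v * exp (norm v)" .
        have "norm v = 2 * pi * \<bar>real_of_int m\<bar> * norm (re_part A x y - of_int (A $ 1 $ 1) / of_int (A $ 2 $ 1))"
          unfolding v_def norm_mult by simp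
        also have "\<dots> \<le> 2 * pi * \<bar>real_of_int m\<bar> * (16/15 / sqrt r)"
          using norm_re_part_diff[OF R(1) _ y0 near] True R(2,3) by (intro mult_left_mono) (auto simp: r_def)
        also have "\<dots> = u0 / sqrt y0 * sqrt \<omega>"
          using y0 r by (simp add: u0_def \<omega>_def real_sqrt_divide)
        finally have v: "norm v \<le> u0 / sqrt y0 * sqrt \<omega>" .
        also have "u0 / sqrt y0 * sqrt \<omega> \<le> u0 / sqrt y0 * sqrt L0"
          using \<omega>L y0 by (intro mult_left_mono) (auto simp: u0_def)
        finally have "exp (norm v) \<le> exp (u0 / sqrt y0 * sqrt L0)" by simp
        with v have "norm v * exp (norm v) \<le> (u0 / sqrt y0 * sqrt \<omega>) * exp (u0 / sqrt y0 * sqrt L0)"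
          using \<omega> y0 by (intro mult_mono) (auto simp: u0_def)
        with 1 show ?thesis by (simp add: mult_ac)
      qed
      have XE: "norm (X * E - \<eta>) \<le> K3 * sqrt \<omega>"
      proof -
        have "X * E - \<eta> = (X - 1) * E + (E - \<eta>)" by (simp add: algebra_simps)
        then have "norm (X * E - \<eta>) \<le> norm (X - 1) * norm E + norm (E - \<eta>)" by (metis norm_mult norm_triangle_ineq)
        also have "\<dots> \<le> (K2 * (5/4 * (a * (sqrt L0 * sqrt \<omega>)))) * E0 + u0 / sqrt y0 * exp (u0 / sqrt y0 * sqrt L0) * sqrt \<omega>"
        proof (intro add_mono mult_mono E0 E1)
          have "5/4 * (a * \<omega>) \<le> 5/4 * (a * (sqrt L0 * sqrt \<omega>))"
            using a by (intro mult_left_mono sq) auto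
          then have "norm T \<le> 5/4 * (a * (sqrt L0 * sqrt \<omega>))" by (rule order.trans[OF T2])
          then show "norm (X - 1) \<le> K2 * (5/4 * (a * (sqrt L0 * sqrt \<omega>)))"
            using X1 K2 by (meson mult_left_mono order_trans)
        qed (use K2 a L0 \<omega> in auto)
        also have "\<dots> = K3 * sqrt \<omega>" by (simp add: K3_def algebra_simps)
        finally show ?thesis .
      qed
      have "diff_term m p x y s = T powr s * (X * E - \<eta>)"
      proof -
        have "slash_term 0 m A x y s = T powr s * X * E"
          using m by (simp add: slash_term_def psi_def X_def E_def T_def R a_def mult_ac)
        moreover have "of_real a powr s * main_term m p x y s = T powr s * \<eta>"
          using True powr_of_real_mult[OF a im0, of s] by (simp add: main_term_def T_def \<eta>_def)
        ultimately show ?thesis by (simp add: diff_term_def A_def a_def algebra_simps)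
      qed
      then have "norm (diff_term m p x y s) \<le> (K4 * \<omega> powr \<sigma>1) * (K3 * sqrt \<omega>)"
        using K4(2)[rule_format, OF cd near s] XE K4(1) unfolding norm_mult \<omega>_def r_def T_def
        by (auto simp: norm_mult intro!: mult_mono)
      also have "\<dots> = (K4 * K3) * (\<omega> powr \<sigma>1 * sqrt \<omega>)" by (simp only: mult_ac)
      also have "\<dots> \<le> K * (\<omega> powr \<sigma>1 * sqrt \<omega>)"
        using \<omega> by (intro mult_right_mono) (auto simp: K_def)
      finally show ?thesis unfolding split[symmetric] unfolding \<omega>_def r_def .
    qed
  qed
  have "K \<ge> 0" using K1(1) y0 by (simp add: K_def le_max_iff_disj)
  with main show ?thesis by blast
qed

text \<open>The first series converges for Re s > 1/2, the exponent of its majorant being shifted by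
  1/2; for the second, Re s > 15/16 suffices.\<close>

definition continued_sum :: "int \<Rightarrow> complex \<Rightarrow> complex \<Rightarrow> complex" where
  "continued_sum m z s = (\<Sum>\<^sub>\<infinity>p\<in>row_index. diff_term m p (of_real (Re z)) (of_real (Im z)) s) +
     of_real (4 * pi * \<bar>real_of_int m\<bar>) powr s * main_sum m (of_real (Re z)) (of_real (Im z)) s"

lemma continued_sum_eq:
  assumes z: "Im z > 0" and m: "m \<noteq> 0" and s: "Re s > 1"
  shows "continued_sum m z s = slash_sum 0 m z s"
proof -
  let ?x = "complex_of_real (Re z)" and ?y = "complex_of_real (Im z)"
  let ?t = "\<lambda>p. slash_term 0 m (row_matrix (fst p) (snd p)) ?x ?y s"
  let ?a = "of_real (4 * pi * \<bar>real_of_int m\<bar>) powr s"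
  obtain r M where r: "r > 0" "ball s r \<subseteq> {s. Re s > 1}" and M: "M summable_on row_index"
    "\<And>p. p \<in> row_index \<Longrightarrow> hol3 (ball ?x (Im z / 32)) (ball ?y (Im z / 32)) (ball s r) (slash_term 0 m (row_matrix (fst p) (snd p))) (M p)"
    by (rule slash_sum_local[OF z m s, where k = 0]) (rule that; blast)
  have "norm (?t p) \<le> M p" if "p \<in> row_index" for p
    using M(2)[OF that] z r unfolding hol3_def by auto
  then have st: "?t summable_on row_index"
    by (intro abs_summable_summable[OF summable_on_comparison_test[OF M(1)]]) auto
  have sm: "(\<lambda>p. ?a * main_term m p ?x ?y s) summable_on row_index"
    by (intro summable_on_cmult_right summable_main_term z s)
  have sd: "(\<lambda>p. diff_term m p ?x ?y s) summable_on row_index"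
  proof -
    have "(\<lambda>p. (- ?a) * main_term m p ?x ?y s) summable_on row_index"
      by (intro summable_on_cmult_right summable_main_term z s)
    from summable_on_add[OF st this] show ?thesis by (simp add: diff_term_def)
  qed
  have "slash_sum 0 m z s = infsum ?t row_index" using slash_sum_of_real[OF z m, of 0 "Re z" s] by simp
  also have "\<dots> = (\<Sum>\<^sub>\<infinity>p\<in>row_index. diff_term m p ?x ?y s + ?a * main_term m p ?x ?y s)"
    by (intro infsum_cong) (simp add: diff_term_def)
  also have "\<dots> = (\<Sum>\<^sub>\<infinity>p\<in>row_index. diff_term m p ?x ?y s) + (\<Sum>\<^sub>\<infinity>p\<in>row_index. ?a * main_term m p ?x ?y s)"
    by (rule infsum_add[OF sd sm])
  also have "(\<Sum>\<^sub>\<infinity>p\<in>row_index. ?a * main_term m p ?x ?y s) = ?a * main_sum m ?x ?y s"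
    by (simp only: infsum_cmult_right' infsum_main_term[OF z s])
  finally show ?thesis by (simp add: continued_sum_def)
qed

lemma holomorphic_diff_term:
  assumes p: "p \<in> row_index" and y0: "y0 > 0" and m: "m \<noteq> 0" and B: "open B"
    and hol: "X holomorphic_on B" "Y holomorphic_on B" "T holomorphic_on B"
    and near: "\<And>u. u \<in> B \<Longrightarrow> near_point x0 y0 (X u) (Y u)" and T: "\<And>u. u \<in> B \<Longrightarrow> Re (T u) \<ge> 1/2"
  shows "(\<lambda>u. diff_term m p (X u) (Y u) (T u)) holomorphic_on B"
proof -
  note R = row_index_row_matrix[OF p]
  have cd: "(fst p, snd p) \<noteq> (0, 0)" using R(4) by simp
  have 1: "(\<lambda>u. slash_term 0 m (row_matrix (fst p) (snd p)) (X u) (Y u) (T u)) holomorphic_on B"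
    by (rule holomorphic_slash_term[OF R(1) y0 m B hol near T])
  have "(\<lambda>u. (of_real 1 * im_part (fst p) (snd p) (X u) (Y u)) powr T u) holomorphic_on B"
    by (rule holomorphic_im_part_powr[OF cd y0 _ hol near]) auto
  then have 2: "(\<lambda>u. main_term m p (X u) (Y u) (T u)) holomorphic_on B"
    unfolding main_term_def by (cases "fst p > 0") (auto intro!: holomorphic_intros)
  have "4 * pi * \<bar>real_of_int m\<bar> > 0" using m by simp
  then have "complex_of_real (4 * pi * \<bar>real_of_int m\<bar>) \<notin> \<real>\<^sub>\<le>\<^sub>0" by (auto simp: complex_nonpos_Reals_iff)
  then show ?thesis unfolding diff_term_def by (intro holomorphic_intros 1 2 hol) auto
qed

lemma analytic_family_continued_sum:
  assumes m: "m \<noteq> 0"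
  shows "analytic_family {s. Re s > 15/16} (continued_sum m)"
proof (rule analytic_familyI)
  fix z s assume z: "Im z > 0" and "s \<in> {s. Re s > 15/16}"
  then have s: "Re s > 15/16" by simp
  define r where "r = (Re s - 15/16) / 2"
  have r: "r > 0" using s by (simp add: r_def)
  define \<sigma>1 \<sigma>2 where "\<sigma>1 = Re s - r" and "\<sigma>2 = Re s + r"
  have \<sigma>1: "\<sigma>1 > 15/16" using s by (simp add: \<sigma>1_def r_def field_simps)
  have ball: "\<sigma>1 \<le> Re t \<and> Re t \<le> \<sigma>2 \<and> norm t \<le> norm s + r" if "t \<in> ball s r" for t
  proof -
    have n: "norm (t - s) < r" using that by (simp add: dist_norm norm_minus_commute)
    then have "\<bar>Re (t - s)\<bar> < r" using abs_Re_le_cmod[of "t - s"] by linarith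
    moreover have "norm t \<le> norm s + norm (t - s)" using norm_triangle_ineq[of s "t - s"] by simp
    ultimately show ?thesis using n by (auto simp: \<sigma>1_def \<sigma>2_def abs_less_iff)
  qed
  \<comment> \<open>The x-disc has half the usual radius, because \<open>hol3_main_sum\<close> is
    available on a strip of half-width Im z/64.\<close>
  let ?A = "ball (complex_of_real (Re z)) (Im z / 64)" and ?B = "ball (complex_of_real (Im z)) (Im z / 32)"
  let ?C = "ball s r"
  obtain M where M: "hol3 (strip (Im z / 64)) ?B ?C (main_sum m) M"
    using hol3_main_sum[OF m z open_ball \<sigma>1 ball] by blast
  have subA: "?A \<subseteq> strip (Im z / 64)"
  proof
    fix x assume "x \<in> ?A"
    then have "norm (x - of_real (Re z)) < Im z / 64" by (simp add: dist_norm norm_minus_commute)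
    then have "\<bar>Im (x - of_real (Re z))\<bar> < Im z / 64" using abs_Im_le_cmod le_less_trans by blast
    then show "x \<in> strip (Im z / 64)" by (simp add: strip_def)
  qed
  have M': "hol3 ?A ?B ?C (main_sum m) M" by (rule hol3_subset[OF M]) (use subA in auto)
  have near: "near_point (Re z) (Im z) x y" if "x \<in> ?A" "y \<in> ?B" for x y
    by (rule near_pointI) (use that z in auto)
  have "1/2 \<le> \<sigma>1" using \<sigma>1 by simp
  then obtain K where K: "K \<ge> 0" "\<forall>p\<in>row_index. \<forall>x0 x y t. near_point x0 (Im z) x y \<longrightarrow> \<sigma>1 \<le> Re t \<longrightarrow> Re t \<le> \<sigma>2 \<longrightarrow> norm t \<le> norm s + r \<longrightarrow>
     norm (diff_term m p x y t) \<le> K * (Im z / row_norm (fst p) (snd p) x0 (Im z)) powr (\<sigma>1 + 1/2)"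
    using diff_term_bound[OF z m] by blast
  define N where "N = (\<lambda>p. K * ((Im z * lattice_const \<bar>Re z\<bar> (Im z)) powr (\<sigma>1 + 1/2) * pair_weight (\<sigma>1 + 1/2) p))"
  have Ns: "N summable_on row_index"
    unfolding N_def using \<sigma>1 by (intro summable_on_cmult_right summable_pair_weight) auto
  have D: "hol3 ?A ?B ?C (diff_term m p) (N p)" if p: "p \<in> row_index" for p
    unfolding hol3_def
  proof (intro conjI ballI)
    fix x y t assume x: "x \<in> ?A" and y: "y \<in> ?B" and t: "t \<in> ?C"
    have cd: "(fst p, snd p) \<noteq> (0, 0)" using row_index_row_matrix(4)[OF p] by simp
    have "norm (diff_term m p x y t) \<le> K * (Im z / row_norm (fst p) (snd p) (Re z) (Im z)) powr (\<sigma>1 + 1/2)"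
      using K(2) p near[OF x y] ball[OF t] by blast
    also have "\<dots> \<le> N p"
      unfolding N_def using row_norm_powr_le[OF z order_refl cd, of "\<sigma>1 + 1/2" "Re z"] \<sigma>1 K(1)
      by (intro mult_left_mono) auto
    finally show "norm (diff_term m p x y t) \<le> N p" .
  next
    fix y t assume "y \<in> ?B" "t \<in> ?C"
    then show "(\<lambda>x. diff_term m p x y t) holomorphic_on ?A"
      using near ball[of t] \<sigma>1 by (intro holomorphic_diff_term[OF p z m, where ?x0.0 = "Re z"] holomorphic_intros) auto
  next
    fix x t assume "x \<in> ?A" "t \<in> ?C"
    then show "(\<lambda>y. diff_term m p x y t) holomorphic_on ?B"
      using near ball[of t] \<sigma>1 by (intro holomorphic_diff_term[OF p z m, where ?x0.0 = "Re z"] holomorphic_intros) auto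
  next
    fix x y assume xy: "x \<in> ?A" "y \<in> ?B"
    have "Re t \<ge> 1/2" if "t \<in> ?C" for t using ball[OF that] \<sigma>1 by linarith
    then show "(\<lambda>t. diff_term m p x y t) holomorphic_on ?C"
      using near xy by (intro holomorphic_diff_term[OF p z m, where ?x0.0 = "Re z"] holomorphic_intros) auto
  qed auto
  have DS: "hol3 ?A ?B ?C (\<lambda>x y t. \<Sum>\<^sub>\<infinity>p\<in>row_index. diff_term m p x y t) (infsum N row_index)"
    by (rule hol3_infsum[OF D Ns]) auto
  define a where "a = 4 * pi * \<bar>real_of_int m\<bar>"
  have a: "a > 0" using m by (simp add: a_def)
  define Q where "Q = max 1 a powr \<sigma>2 + min 1 a powr \<sigma>1"
  let ?U = "\<lambda>x y t. (\<Sum>\<^sub>\<infinity>p\<in>row_index. diff_term m p x y t) + of_real a powr t * main_sum m x y t"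
  have U: "hol3 ?A ?B ?C ?U (infsum N row_index + Q * M)"
    unfolding hol3_def
  proof (intro conjI ballI)
    fix x y t assume xy: "x \<in> ?A" "y \<in> ?B" and t: "t \<in> ?C"
    have "norm (complex_of_real a powr t) = a powr Re t" using a by (subst norm_powr_real_powr) auto
    also have "\<dots> \<le> Q"
    proof (cases "a \<ge> 1")
      case True
      then have "a powr Re t \<le> a powr \<sigma>2" using ball[OF t] by (intro powr_mono) auto
      then show ?thesis using True by (simp add: Q_def max_def)
    next
      case False
      then have "a powr Re t \<le> a powr \<sigma>1" using ball[OF t] a by (intro powr_mono') auto
      then show ?thesis using False by (simp add: Q_def min_def)
    qed
    finally have "norm (complex_of_real a powr t * main_sum m x y t) \<le> Q * M"
      unfolding norm_mult using M' xy t by (intro mult_mono) (auto simp: hol3_def Q_def)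
    moreover have "norm (\<Sum>\<^sub>\<infinity>p\<in>row_index. diff_term m p x y t) \<le> infsum N row_index"
      using DS xy t unfolding hol3_def by blast
    ultimately show "norm (?U x y t) \<le> infsum N row_index + Q * M"
      by (intro norm_triangle_le add_mono)
  next
    fix y t assume "y \<in> ?B" "t \<in> ?C"
    then show "(\<lambda>x. ?U x y t) holomorphic_on ?A"
      using DS M' unfolding hol3_def by (intro holomorphic_intros) auto
  next
    fix x t assume "x \<in> ?A" "t \<in> ?C"
    then show "(\<lambda>y. ?U x y t) holomorphic_on ?B"
      using DS M' unfolding hol3_def by (intro holomorphic_intros) auto
  next
    fix x y assume "x \<in> ?A" "y \<in> ?B"
    then show "(\<lambda>t. ?U x y t) holomorphic_on ?C"
      using DS M' a unfolding hol3_def by (intro holomorphic_intros) (auto simp: complex_nonpos_Reals_iff)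
  qed auto
  have "?C \<subseteq> {s. Re s > 15/16}" using ball \<sigma>1 by fastforce
  then show "\<exists>A B C U M. hol3 A B C U M \<and> of_real (Re z) \<in> A \<and> of_real (Im z) \<in> B \<and> s \<in> C \<and> C \<subseteq> {s. Re s > 15/16} \<and>
     (\<forall>x y s. of_real x \<in> A \<longrightarrow> of_real y \<in> B \<longrightarrow> s \<in> C \<longrightarrow> continued_sum m (Complex x y) s = U (of_real x) (of_real y) s)"
    using U z r by (intro exI[of _ ?A] exI[of _ ?B] exI[of _ ?C] exI[of _ ?U] exI[of _ "infsum N row_index + Q * M"])
      (simp add: continued_sum_def a_def)
qed

section \<open>Taylor coefficients of the continued series\<close>

lemma dzbar_cong: "Im z > 0 \<Longrightarrow> (\<And>w. Im w > 0 \<Longrightarrow> f w = g w) \<Longrightarrow> dzbar f z = dzbar g z"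
  unfolding dzbar_def using dx_cong[of z f g] dy_cong[of z f g] by simp

lemma hyp_laplacian_cong:
  assumes "Im z > 0" "\<And>w. Im w > 0 \<Longrightarrow> f w = g w"
  shows "hyp_laplacian k f z = hyp_laplacian k g z"
proof -
  have "dx f w = dx g w" "dy f w = dy g w" if "Im w > 0" for w
    using that assms(2) dx_cong[of w f g] dy_cong[of w f g] by auto
  then have "dx (dx f) z = dx (dx g) z" "dy (dy f) z = dy (dy g) z" "dx f z = dx g z" "dy f z = dy g z"
    using assms(1) dx_cong[of z "dx f" "dx g"] dy_cong[of z "dy f" "dy g"] by auto
  then show ?thesis by (simp add: hyp_laplacian_def)
qed

lemma analytic_family_dzbar:
  assumes "analytic_family S p" "open S"
  shows "analytic_family S (\<lambda>z s. dzbar (\<lambda>w. p w s) z)"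
proof -
  have "analytic_family S (\<lambda>z s. (1/2) * (dx (\<lambda>w. p w s) z + \<i> * dy (\<lambda>w. p w s) z))"
    by (intro analytic_family_mult analytic_family_add analytic_family_dx analytic_family_dy assms
        analytic_family_param[where f = "\<lambda>s. c" for c] holomorphic_intros)
  then show ?thesis by (simp add: dzbar_def)
qed

text \<open>An integer index with value 0 below zero lets multiplication by a linear factor be an
  index shift without case distinctions.\<close>

definition taylor_coeff :: "(complex \<Rightarrow> complex) \<Rightarrow> complex \<Rightarrow> int \<Rightarrow> complex" where
  "taylor_coeff f s r = (if r < 0 then 0 else (deriv ^^ nat r) f s / fact (nat r))"

lemma taylor_coeff_cong:
  assumes "eventually (\<lambda>t. f t = g t) (nhds s)"
  shows "taylor_coeff f s r = taylor_coeff g s r"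
  unfolding taylor_coeff_def using higher_deriv_cong_ev[OF assms refl] by simp

lemma taylor_coeff_cong_on:
  assumes "open S" "s \<in> S" "\<And>t. t \<in> S \<Longrightarrow> f t = g t"
  shows "taylor_coeff f s r = taylor_coeff g s r"
  by (rule taylor_coeff_cong) (use assms in \<open>auto simp: eventually_nhds\<close>)

lemma taylor_coeff_add:
  assumes "f holomorphic_on S" "g holomorphic_on S" "open S" "s \<in> S"
  shows "taylor_coeff (\<lambda>t. f t + g t) s r = taylor_coeff f s r + taylor_coeff g s r"
  using higher_deriv_add[OF assms] by (simp add: taylor_coeff_def add_divide_distrib)

lemma taylor_coeff_cmult:
  assumes "f holomorphic_on S" "open S" "s \<in> S"
  shows "taylor_coeff (\<lambda>t. c * f t) s r = c * taylor_coeff f s r"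
  using higher_deriv_cmult[OF assms(1,3,2)] by (simp add: taylor_coeff_def)

text \<open>Leibniz' rule; at n = 0 the truncated n - 1 is multiplied by 0.\<close>

lemma higher_deriv_linear_mult:
  assumes f: "f holomorphic_on S" and S: "open S" "z \<in> S"
  shows "(deriv ^^ n) (\<lambda>t. (t - c) * f t) z = (z - c) * (deriv ^^ n) f z + of_nat n * (deriv ^^ (n - 1)) f z"
  using S(2)
proof (induction n arbitrary: z)
  case (Suc n)
  have "(deriv ^^ Suc n) (\<lambda>t. (t - c) * f t) z = deriv (\<lambda>z. (z - c) * (deriv ^^ n) f z + of_nat n * (deriv ^^ (n - 1)) f z) z"
    using Suc S(1) by (auto intro!: deriv_cong_ev exI[of _ S] simp: eventually_nhds)
  also have "\<dots> = (z - c) * (deriv ^^ Suc n) f z + of_nat (Suc n) * (deriv ^^ (Suc n - 1)) f z"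
  proof (rule DERIV_imp_deriv)
    have D: "((deriv ^^ i) f has_field_derivative (deriv ^^ Suc i) f z) (at z)" for i
      using holomorphic_derivI[OF holomorphic_higher_deriv[OF f S(1)] S(1) Suc.prems] by simp
    have E: "((\<lambda>z. of_nat n * (deriv ^^ (n - 1)) f z) has_field_derivative of_nat n * (deriv ^^ n) f z) (at z)"
    proof (cases n)
      case (Suc i)
      then show ?thesis using DERIV_cmult[OF D[of i], of "of_nat n"] by simp
    qed simp
    have "((\<lambda>z. (z - c) * (deriv ^^ n) f z + of_nat n * (deriv ^^ (n - 1)) f z) has_field_derivative
       ((z - c) * (deriv ^^ Suc n) f z + (1 - 0) * (deriv ^^ n) f z) + of_nat n * (deriv ^^ n) f z) (at z)"
      by (intro DERIV_add DERIV_mult' DERIV_diff DERIV_ident DERIV_const D E)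
    then show "((\<lambda>z. (z - c) * (deriv ^^ n) f z + of_nat n * (deriv ^^ (n - 1)) f z) has_field_derivative
       (z - c) * (deriv ^^ Suc n) f z + of_nat (Suc n) * (deriv ^^ (Suc n - 1)) f z) (at z)"
      by (simp add: algebra_simps)
  qed
  finally show ?case .
qed simp

text \<open>Write t - c = (s - c) + (t - s); the second part shifts the expansion at s by
  one.\<close>

lemma taylor_coeff_linear_mult:
  assumes "f holomorphic_on S" "open S" "s \<in> S"
  shows "taylor_coeff (\<lambda>t. (t - c) * f t) s r = (s - c) * taylor_coeff f s r + taylor_coeff f s (r - 1)"
proof (cases "r > 0")
  case True
  then obtain n where n: "nat r = Suc n" "nat (r - 1) = n" by (metis gr0_conv_Suc nat_diff_distrib' zero_less_nat_eq nat_1 diff_Suc_1 One_nat_def less_imp_le zero_le_one)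
  have "(deriv ^^ nat r) (\<lambda>t. (t - c) * f t) s / fact (nat r) = (s - c) * ((deriv ^^ nat r) f s / fact (nat r)) + (deriv ^^ nat (r - 1)) f s / fact (nat (r - 1))"
  proof -
    have "of_nat (Suc n) * x / fact (Suc n) = x / fact n" for x :: complex
      by (simp add: fact_Suc del: of_nat_Suc)
    then show ?thesis
      unfolding n higher_deriv_linear_mult[OF assms] add_divide_distrib by simp
  qed
  then show ?thesis using True by (simp add: taylor_coeff_def)
next
  case False
  then show ?thesis using higher_deriv_linear_mult[OF assms, where n = 0 and c = c] by (auto simp: taylor_coeff_def)
qed

lemma higher_deriv_cnj_cnj:
  assumes f: "f holomorphic_on S" and S: "open S" "cnj z \<in> S"
  shows "(deriv ^^ n) (\<lambda>t. cnj (f (cnj t))) z = cnj ((deriv ^^ n) f (cnj z))"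
  using S(2)
proof (induction n arbitrary: z)
  case (Suc n)
  have op: "open (cnj -` S)" by (rule open_vimage[OF S(1)]) (intro continuous_intros)
  have "(deriv ^^ Suc n) (\<lambda>t. cnj (f (cnj t))) z = deriv (cnj \<circ> (deriv ^^ n) f \<circ> cnj) z"
    using Suc op by (auto intro!: deriv_cong_ev exI[of _ "cnj -` S"] simp: eventually_nhds)
  also have "\<dots> = cnj ((deriv ^^ Suc n) f (cnj z))"
    by (rule DERIV_imp_deriv, rule has_field_derivative_cnj_cnj)
      (use holomorphic_derivI[OF holomorphic_higher_deriv[OF f S(1)] S(1) Suc.prems] in simp)
  finally show ?case .
qed simp

lemma taylor_coeff_cnj:
  assumes "f holomorphic_on S" "open S" "cnj s \<in> S"
  shows "taylor_coeff (\<lambda>t. cnj (f (cnj t))) s r = cnj (taylor_coeff f (cnj s) r)"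
  using higher_deriv_cnj_cnj[OF assms] by (simp add: taylor_coeff_def)

lemma analytic_family_taylor_dx:
  assumes "analytic_family S p" "Im z > 0" "s \<in> S"
  shows "dx (\<lambda>w. taylor_coeff (p w) s r) z = taylor_coeff (\<lambda>t. dx (\<lambda>w. p w t) z) s r"
proof (cases "r < 0")
  case False
  have "((\<lambda>t. (deriv ^^ nat r) (p (Complex t (Im z))) s / fact (nat r)) has_vector_derivative
      (deriv ^^ nat r) (\<lambda>s. dx (\<lambda>w. p w s) z) s / fact (nat r)) (at (Re z))"
    by (rule has_vector_derivative_divide[OF analytic_family_higher_deriv_dx[OF assms]])
  then have "vector_derivative (\<lambda>t. taylor_coeff (p (Complex t (Im z))) s r) (at (Re z)) = taylor_coeff (\<lambda>t. dx (\<lambda>w. p w t) z) s r"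
    using False by (simp add: taylor_coeff_def vector_derivative_at)
  then show ?thesis by (simp only: dx_def)
qed (simp add: taylor_coeff_def dx_def)

lemma analytic_family_taylor_dy:
  assumes "analytic_family S p" "Im z > 0" "s \<in> S"
  shows "dy (\<lambda>w. taylor_coeff (p w) s r) z = taylor_coeff (\<lambda>t. dy (\<lambda>w. p w t) z) s r"
proof (cases "r < 0")
  case False
  have "((\<lambda>t. (deriv ^^ nat r) (p (Complex (Re z) t)) s / fact (nat r)) has_vector_derivative
      (deriv ^^ nat r) (\<lambda>s. dy (\<lambda>w. p w s) z) s / fact (nat r)) (at (Im z))"
    by (rule has_vector_derivative_divide[OF analytic_family_higher_deriv_dy[OF assms]])
  then have "vector_derivative (\<lambda>t. taylor_coeff (p (Complex (Re z) t)) s r) (at (Im z)) = taylor_coeff (\<lambda>t. dy (\<lambda>w. p w t) z) s r"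
    using False by (simp add: taylor_coeff_def vector_derivative_at)
  then show ?thesis by (simp only: dy_def)
qed (simp add: taylor_coeff_def dy_def)

lemma analytic_family_taylor_dzbar:
  assumes p: "analytic_family S p" and S: "open S" and z: "Im z > 0" and s: "s \<in> S"
  shows "dzbar (\<lambda>w. taylor_coeff (p w) s r) z = taylor_coeff (\<lambda>t. dzbar (\<lambda>w. p w t) z) s r"
proof -
  have h: "(\<lambda>t. dx (\<lambda>w. p w t) z) holomorphic_on S" "(\<lambda>t. dy (\<lambda>w. p w t) z) holomorphic_on S"
    using analytic_family_holomorphic[OF analytic_family_dx[OF p] z] analytic_family_holomorphic[OF analytic_family_dy[OF p] z] by auto
  have 1: "taylor_coeff (\<lambda>t. (1/2) * (dx (\<lambda>w. p w t) z + \<i> * dy (\<lambda>w. p w t) z)) s r =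
      (1/2) * taylor_coeff (\<lambda>t. dx (\<lambda>w. p w t) z + \<i> * dy (\<lambda>w. p w t) z) s r"
    by (rule taylor_coeff_cmult[OF _ S s]) (intro holomorphic_intros h)
  have 2: "taylor_coeff (\<lambda>t. dx (\<lambda>w. p w t) z + \<i> * dy (\<lambda>w. p w t) z) s r =
      taylor_coeff (\<lambda>t. dx (\<lambda>w. p w t) z) s r + taylor_coeff (\<lambda>t. \<i> * dy (\<lambda>w. p w t) z) s r"
    by (rule taylor_coeff_add[OF _ _ S s]) (intro holomorphic_intros h)+
  have 3: "(\<lambda>t. dzbar (\<lambda>w. p w t) z) = (\<lambda>t. (1/2) * (dx (\<lambda>w. p w t) z + \<i> * dy (\<lambda>w. p w t) z))"
    by (simp add: dzbar_def fun_eq_iff)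
  have R: "taylor_coeff (\<lambda>t. dzbar (\<lambda>w. p w t) z) s r = (1/2) *
      (taylor_coeff (\<lambda>t. dx (\<lambda>w. p w t) z) s r + \<i> * taylor_coeff (\<lambda>t. dy (\<lambda>w. p w t) z) s r)"
    unfolding 3 1 2 taylor_coeff_cmult[OF h(2) S s] ..
  have L: "dzbar (\<lambda>w. taylor_coeff (p w) s r) z =
      (taylor_coeff (\<lambda>t. dx (\<lambda>w. p w t) z) s r + \<i> * taylor_coeff (\<lambda>t. dy (\<lambda>w. p w t) z) s r) / 2"
    unfolding dzbar_def analytic_family_taylor_dx[OF p z s] analytic_family_taylor_dy[OF p z s] ..
  show ?thesis unfolding L R by simp
qed

lemma analytic_family_taylor_hyp_laplacian:
  assumes p: "analytic_family S p" and S: "open S" and z: "Im z > 0" and s: "s \<in> S"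
  shows "hyp_laplacian k (\<lambda>w. taylor_coeff (p w) s r) z = taylor_coeff (\<lambda>t. hyp_laplacian k (\<lambda>w. p w t) z) s r"
proof -
  let ?F = "\<lambda>w. taylor_coeff (p w) s r"
  have px: "analytic_family S (\<lambda>z t. dx (\<lambda>w. p w t) z)" and py: "analytic_family S (\<lambda>z t. dy (\<lambda>w. p w t) z)"
    by (rule analytic_family_dx[OF p], rule analytic_family_dy[OF p])
  have xx: "dx (dx ?F) z = taylor_coeff (\<lambda>t. dx (dx (\<lambda>w. p w t)) z) s r"
  proof -
    have "dx (dx ?F) z = dx (\<lambda>w. taylor_coeff (\<lambda>t. dx (\<lambda>v. p v t) w) s r) z"
      by (rule dx_cong[OF z]) (rule analytic_family_taylor_dx[OF p _ s])
    also have "\<dots> = taylor_coeff (\<lambda>t. dx (\<lambda>w. dx (\<lambda>v. p v t) w) z) s r" by (rule analytic_family_taylor_dx[OF px z s])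
    finally show ?thesis .
  qed
  have yy: "dy (dy ?F) z = taylor_coeff (\<lambda>t. dy (dy (\<lambda>w. p w t)) z) s r"
  proof -
    have "dy (dy ?F) z = dy (\<lambda>w. taylor_coeff (\<lambda>t. dy (\<lambda>v. p v t) w) s r) z"
      by (rule dy_cong[OF z]) (rule analytic_family_taylor_dy[OF p _ s])
    also have "\<dots> = taylor_coeff (\<lambda>t. dy (\<lambda>w. dy (\<lambda>v. p v t) w) z) s r" by (rule analytic_family_taylor_dy[OF py z s])
    finally show ?thesis .
  qed
  note h = analytic_family_holomorphic[OF px z] analytic_family_holomorphic[OF py z]
    analytic_family_holomorphic[OF analytic_family_dx[OF px] z] analytic_family_holomorphic[OF analytic_family_dy[OF py] z]
  let ?X = "\<lambda>t. dx (\<lambda>w. p w t) z" and ?Y = "\<lambda>t. dy (\<lambda>w. p w t) z"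
    and ?XX = "\<lambda>t. dx (dx (\<lambda>w. p w t)) z" and ?YY = "\<lambda>t. dy (dy (\<lambda>w. p w t)) z"
  define a where "a = - (complex_of_real (Im z))\<^sup>2"
  define b where "b = \<i> * of_int k * complex_of_real (Im z)"
  have h1: "(\<lambda>t. ?XX t + ?YY t) holomorphic_on S" "(\<lambda>t. ?X t + \<i> * ?Y t) holomorphic_on S" "(\<lambda>t. \<i> * ?Y t) holomorphic_on S"
    by (intro holomorphic_intros h)+
  have h2: "(\<lambda>t. a * (?XX t + ?YY t)) holomorphic_on S" "(\<lambda>t. b * (?X t + \<i> * ?Y t)) holomorphic_on S"
    by (intro holomorphic_intros h)+
  show ?thesis
    unfolding hyp_laplacian_def xx yy analytic_family_taylor_dx[OF p z s] analytic_family_taylor_dy[OF p z s]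
      a_def[symmetric] b_def[symmetric]
      taylor_coeff_add[OF h2 S s] taylor_coeff_cmult[OF h1(1) S s] taylor_coeff_cmult[OF h1(2) S s]
      taylor_coeff_add[OF h(3,4) S s] taylor_coeff_add[OF h(1) h1(3) S s] taylor_coeff_cmult[OF h(2) S s] ..
qed

section \<open>The continued series in all weights\<close>

definition continuation_domain :: "int \<Rightarrow> complex set" where
  "continuation_domain k = (if k = 0 \<or> k = 2 then {s. Re s > 15/16} else {s. Re s > 1})"

text \<open>In weight 2 the continuation is read off from weight 0, since \<open>\<xi>\<^sub>0 P\<^sub>0\<^sub>,\<^sub>m\<close> is a multiple of
  \<open>P\<^sub>2\<^sub>,\<^sub>-\<^sub>m\<close>.\<close>
definition continued_series :: "int \<Rightarrow> int \<Rightarrow> complex \<Rightarrow> complex \<Rightarrow> complex" where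
  "continued_series k m z s = (if k = 0 then continued_sum m z s
     else if k = 2 then cnj (dzbar (\<lambda>w. continued_sum (- m) w (cnj s)) z / (2 * of_real pi * \<i> * cnj s))
     else slash_sum k m z s)"

text \<open>Weights k and 2 - k share a domain since \<open>xi\<close> exchanges them. Closure under
  conjugation serves \<open>analytic_family_cnj\<close>, convexity the identity theorem.\<close>

lemma continuation_domain:
  "open (continuation_domain k)" "cnj ` continuation_domain k \<subseteq> continuation_domain k"
  "continuation_domain (2 - k) = continuation_domain k" "s \<in> continuation_domain k \<Longrightarrow> s \<noteq> 0"
  "s \<in> continuation_domain k \<Longrightarrow> cnj s \<in> continuation_domain k" "convex (continuation_domain k)"
  "Re s > 1 \<Longrightarrow> s \<in> continuation_domain k"
proof -
  show "open (continuation_domain k)" "convex (continuation_domain k)"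
    by (cases "k = 0 \<or> k = 2"; simp only: continuation_domain_def if_True if_False open_halfspace_Re_gt convex_halfspace_Re_gt)+
qed (auto simp: continuation_domain_def split: if_splits)

lemma analytic_family_continued_series:
  assumes m: "m \<noteq> 0"
  shows "analytic_family (continuation_domain k) (continued_series k m)"
proof (cases "k = 2")
  case True
  let ?S = "{s :: complex. Re s > 15/16}"
  have "- m \<noteq> 0" using m by simp
  note p = analytic_family_dzbar[OF analytic_family_continued_sum[OF this] open_halfspace_Re_gt]
  have "analytic_family ?S (\<lambda>z s. dzbar (\<lambda>w. continued_sum (- m) w s) z * (1 / (2 * of_real pi * \<i> * s)))"
    by (intro analytic_family_mult p analytic_family_param open_halfspace_Re_gt holomorphic_intros) auto
  then have "analytic_family ?S (\<lambda>z s. cnj (dzbar (\<lambda>w. continued_sum (- m) w (cnj s)) z * (1 / (2 * of_real pi * \<i> * cnj s))))"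
    by (rule analytic_family_cnj) auto
  then show ?thesis using True by (simp add: continued_series_def[abs_def] continuation_domain_def)
next
  case False
  then show ?thesis using analytic_family_continued_sum[OF m] analytic_family_slash_sum[OF m]
    by (cases "k = 0") (simp_all add: continued_series_def[abs_def] continuation_domain_def)
qed

lemma continued_series_eq:
  assumes z: "Im z > 0" and m: "m \<noteq> 0" and s: "Re s > 1"
  shows "continued_series k m z s = slash_sum k m z s"
proof (cases "k = 2")
  case True
  have m': "- m \<noteq> 0" and s': "Re (cnj s) > 1" using m s by auto
  have "dzbar (\<lambda>w. continued_sum (- m) w (cnj s)) z = dzbar (\<lambda>w. slash_sum 0 (- m) w (cnj s)) z"
    by (rule dzbar_cong[OF z]) (rule continued_sum_eq[OF _ m' s'])
  \<comment> \<open>At k = 0 the factor in \<open>dzbar_slash_sum\<close> is (i/2)(4 pi) times the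
    parameter; this is the divisor chosen in \<open>continued_series\<close>.\<close>
  also have "\<dots> = 2 * of_real pi * \<i> * cnj s * cnj (slash_sum 2 m z s)"
    unfolding dzbar_slash_sum[OF z m' s'] by simp
  finally show ?thesis using True s by (auto simp: continued_series_def)
next
  case False
  then show ?thesis using continued_sum_eq[OF z m s] by (auto simp: continued_series_def)
qed

text \<open>Both sides are holomorphic in s, the right one because conjugation occurs twice, and
  they agree where the series converges; the identity theorem does the rest. For k = 2 this says
  more than the definition of the continuation, which encodes the relation for k = 0.\<close>

lemma dzbar_continued_series:
  assumes z: "Im z > 0" and m: "m \<noteq> 0" and s: "s \<in> continuation_domain k"
  shows "dzbar (\<lambda>w. continued_series k m w s) z = \<i> / 2 * (4 * of_real pi) powi (1 - k) * of_real (Im z) powi (- k) * (s - of_int k/2) *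
     cnj (continued_series (2 - k) (- m) z (cnj s))"
proof -
  have m': "- m \<noteq> 0" using m by simp
  have big: "dzbar (\<lambda>w. continued_series k m w t) z = \<i> / 2 * (4 * of_real pi) powi (1 - k) * of_real (Im z) powi (- k) * (t - of_int k/2) *
     cnj (continued_series (2 - k) (- m) z (cnj t))" if t: "Re t > 1" for t
  proof -
    have "dzbar (\<lambda>w. continued_series k m w t) z = dzbar (\<lambda>w. slash_sum k m w t) z"
      by (rule dzbar_cong[OF z]) (rule continued_series_eq[OF _ m t])
    then show ?thesis using dzbar_slash_sum[OF z m t, of k] continued_series_eq[OF z m', of "cnj t" "2 - k"] t by simp
  qed
  show ?thesis
  proof (cases "k = 0 \<or> k = 2")
    case False
    then show ?thesis using big s by (simp add: continuation_domain_def)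
  next
    case True
    let ?S = "continuation_domain k"
    let ?L = "\<lambda>t. dzbar (\<lambda>w. continued_series k m w t) z"
    let ?R = "\<lambda>t. \<i> / 2 * (4 * of_real pi) powi (1 - k) * of_real (Im z) powi (- k) * (t - of_int k/2) * cnj (continued_series (2 - k) (- m) z (cnj t))"
    have fam: "analytic_family ?S (continued_series (2 - k) (- m))"
      using analytic_family_continued_series[OF m', of "2 - k"] by (simp add: continuation_domain)
    have L: "?L holomorphic_on ?S"
      by (rule analytic_family_holomorphic[OF analytic_family_dzbar[OF analytic_family_continued_series[OF m] continuation_domain(1)] z])
    have R: "?R holomorphic_on ?S"
      using analytic_family_holomorphic[OF analytic_family_cnj[OF fam continuation_domain(2)] z] by (intro holomorphic_intros) auto
    have "?L s - ?R s = 0"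
    proof (rule analytic_continuation[of "\<lambda>t. ?L t - ?R t" ?S "{t. Re t > 1}" 2])
      show "(\<lambda>t. ?L t - ?R t) holomorphic_on ?S" by (intro holomorphic_on_diff L R)
      show "open ?S" by (rule continuation_domain)
      show "connected ?S" by (rule convex_connected) (rule continuation_domain)
      show "{t. Re t > 1} \<subseteq> ?S" using continuation_domain(7) by auto
      show "2 \<in> ?S" by (rule continuation_domain) simp
      have "open {t. Re t > 1}" by (rule open_halfspace_Re_gt)
      then show "2 islimpt {t. Re t > 1}" by (intro interior_limit_point) (simp add: interior_open)
      show "?L t - ?R t = 0" if "t \<in> {t. Re t > 1}" for t using big[of t] that by simp
    qed (rule s)
    then show ?thesis by simp
  qed
qed

text \<open>The relation for weight k writes \<open>dzbar\<close> of the series as y^(-k) times a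
  conjugated series of weight 2 - k; the relation for weight 2 - k differentiates that once more.
  Differentiating y^(-k) yields a term that cancels the first order part of the Laplacian.\<close>

lemma hyp_laplacian_continued_series:
  assumes z: "Im z > 0" and m: "m \<noteq> 0" and s: "s \<in> continuation_domain k"
  shows "hyp_laplacian k (\<lambda>w. continued_series k m w s) z = - ((s - of_int k/2) * ((s - (1 - of_int k/2)) * continued_series k m z s))"
proof -
  let ?S = "continuation_domain k"
  define p where "p = continued_series k m"
  define q where "q = continued_series (2 - k) (- m)"
  define y where "y = complex_of_real (Im z)"
  have y: "y \<noteq> 0" using z by (simp add: y_def)
  have m': "- m \<noteq> 0" using m by simp
  have P: "analytic_family ?S p" unfolding p_def by (rule analytic_family_continued_series[OF m])
  have Q: "analytic_family ?S q"
    unfolding q_def using analytic_family_continued_series[OF m', of "2 - k"] by (simp add: continuation_domain)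
  have s': "cnj s \<in> ?S" using s by (rule continuation_domain)
  define \<kappa> where "\<kappa> = \<i> / 2 * (4 * of_real pi) powi (1 - k) * (s - of_int k/2)"
  define e where "e = (\<lambda>w. cnj (q w (cnj s)))"
  define D where "D = (\<lambda>w. dzbar (\<lambda>v. p v s) w)"
  have D: "D w = \<kappa> * of_real (Im w) powi (- k) * e w" if "Im w > 0" for w
    unfolding D_def p_def dzbar_continued_series[OF that m s] by (simp add: \<kappa>_def e_def q_def)
  have ex: "((\<lambda>t. e (Complex t (Im z))) has_vector_derivative cnj (dx (\<lambda>w. q w (cnj s)) z)) (at (Re z))"
    unfolding e_def by (rule has_vector_derivative_cnj[OF analytic_family_has_dx[OF Q z s']])
  have ey: "((\<lambda>t. e (Complex (Re z) t)) has_vector_derivative cnj (dy (\<lambda>w. q w (cnj s)) z)) (at (Im z))"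
    unfolding e_def by (rule has_vector_derivative_cnj[OF analytic_family_has_dy[OF Q z s']])
  have exy: "cnj (dx (\<lambda>w. q w (cnj s)) z) - \<i> * cnj (dy (\<lambda>w. q w (cnj s)) z) =
      - \<i> * (4 * of_real pi) powi (k - 1) * y powi (k - 2) * (s - (1 - of_int k/2)) * p z s"
  proof -
    have "cnj s \<in> continuation_domain (2 - k)" using s' by (simp add: continuation_domain)
    from dzbar_continued_series[OF z m' this]
    have E: "dzbar (\<lambda>w. q w (cnj s)) z = \<i> / 2 * (4 * of_real pi) powi (k - 1) * y powi (k - 2) * (cnj s - (1 - of_int k/2)) * cnj (p z s)"
      by (simp add: q_def p_def y_def diff_divide_distrib)
    have "dx (\<lambda>w. q w (cnj s)) z + \<i> * dy (\<lambda>w. q w (cnj s)) z = 2 * dzbar (\<lambda>w. q w (cnj s)) z"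
      by (simp add: dzbar_def)
    also have "\<dots> = \<i> * (4 * of_real pi) powi (k - 1) * y powi (k - 2) * (cnj s - (1 - of_int k/2)) * cnj (p z s)"
      unfolding E by simp
    finally have "dx (\<lambda>w. q w (cnj s)) z + \<i> * dy (\<lambda>w. q w (cnj s)) z =
        \<i> * (4 * of_real pi) powi (k - 1) * y powi (k - 2) * (cnj s - (1 - of_int k/2)) * cnj (p z s)" .
    from arg_cong[OF this, of cnj] show ?thesis by (simp add: y_def)
  qed
  have Dx: "dx D z = \<kappa> * y powi (- k) * cnj (dx (\<lambda>w. q w (cnj s)) z)"
  proof -
    have "dx D z = dx (\<lambda>w. \<kappa> * of_real (Im w) powi (- k) * e w) z" by (rule dx_cong[OF z D])
    also have "\<dots> = \<kappa> * y powi (- k) * cnj (dx (\<lambda>w. q w (cnj s)) z)"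
      unfolding dx_def[of "\<lambda>w. \<kappa> * of_real (Im w) powi (- k) * e w"] y_def
      by (rule vector_derivative_at) (use has_vector_derivative_mult_right[OF ex] in simp)
    finally show ?thesis .
  qed
  have Dy: "dy D z = \<kappa> * y powi (- k) * cnj (dy (\<lambda>w. q w (cnj s)) z) - \<kappa> * (of_int k * y powi (- k - 1)) * e z"
  proof -
    have "((\<lambda>w. w powi (- k)) has_field_derivative of_int (- k) * y powi (- k - 1) * 1) (at (complex_of_real (Im z)))"
      using y unfolding y_def by (auto intro!: derivative_eq_intros)
    then have 1: "((\<lambda>t. complex_of_real t powi (- k)) has_vector_derivative of_int (- k) * y powi (- k - 1) * 1) (at (Im z))"
      by (rule has_vector_derivative_real_field)
    have "dy D z = dy (\<lambda>w. \<kappa> * (of_real (Im w) powi (- k) * e w)) z" by (rule dy_cong[OF z]) (simp add: D mult.assoc)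
    also have "\<dots> = \<kappa> * (y powi (- k) * cnj (dy (\<lambda>w. q w (cnj s)) z) + of_int (- k) * y powi (- k - 1) * 1 * e z)"
      unfolding dy_def[of "\<lambda>w. \<kappa> * (of_real (Im w) powi (- k) * e w)"]
      by (rule vector_derivative_at) (use has_vector_derivative_mult_right[OF has_vector_derivative_mult[OF 1 ey], of \<kappa>] in \<open>simp add: y_def\<close>)
    finally show ?thesis by (simp add: algebra_simps)
  qed
  have Px: "analytic_family ?S (\<lambda>z s. dx (\<lambda>w. p w s) z)" and Py: "analytic_family ?S (\<lambda>z s. dy (\<lambda>w. p w s) z)"
    by (rule analytic_family_dx[OF P], rule analytic_family_dy[OF P])
  have Dx': "dx D z = (dx (\<lambda>w. dx (\<lambda>v. p v s) w) z + \<i> * dx (\<lambda>w. dy (\<lambda>v. p v s) w) z) / 2"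
    unfolding dx_def[of D] unfolding D_def dzbar_def
    by (rule vector_derivative_at)
      (intro has_vector_derivative_divide has_vector_derivative_add has_vector_derivative_mult_right
        analytic_family_has_dx[OF Px z s] analytic_family_has_dx[OF Py z s])
  have Dy': "dy D z = (dy (\<lambda>w. dx (\<lambda>v. p v s) w) z + \<i> * dy (\<lambda>w. dy (\<lambda>v. p v s) w) z) / 2"
    unfolding dy_def[of D] unfolding D_def dzbar_def
    by (rule vector_derivative_at)
      (intro has_vector_derivative_divide has_vector_derivative_add has_vector_derivative_mult_right
        analytic_family_has_dy[OF Px z s] analytic_family_has_dy[OF Py z s])
  \<comment> \<open>The Euclidean Laplacian factors as (dx - i dy)(dx + i dy); the mixed terms
    cancel by \<open>analytic_family_dx_dy\<close>.\<close>
  have lap: "dx (dx (\<lambda>v. p v s)) z + dy (dy (\<lambda>v. p v s)) z = 2 * (dx D z - \<i> * dy D z)"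
    using analytic_family_dx_dy[OF P z s] unfolding Dx' Dy' by (simp add: field_simps)
  have "dx D z - \<i> * dy D z = \<kappa> * y powi (- k) * (cnj (dx (\<lambda>w. q w (cnj s)) z) - \<i> * cnj (dy (\<lambda>w. q w (cnj s)) z))
      + \<i> * \<kappa> * (of_int k * y powi (- k - 1)) * e z"
    unfolding Dx Dy by (simp add: algebra_simps)
  then have L: "dx D z - \<i> * dy D z = - \<i> * \<kappa> * (4 * of_real pi) powi (k - 1) * (y powi (- k) * y powi (k - 2)) * (s - (1 - of_int k/2)) * p z s
      + \<i> * of_int k * \<kappa> * y powi (- k - 1) * e z"
    unfolding exy by (simp add: mult_ac)
  have pw: "y\<^sup>2 * (y powi (- k) * y powi (k - 2)) = 1" "y\<^sup>2 * y powi (- k - 1) = y * y powi (- k)"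
    using y by (simp_all add: power_int_diff power_int_minus power2_eq_square field_simps)
  have kap: "\<kappa> * (4 * of_real pi) powi (k - 1) = \<i> / 2 * (s - of_int k/2)"
  proof -
    have gen: "x powi (1 - k) * x powi (k - 1) = 1" if "x \<noteq> 0" for x :: complex
      using that by (simp flip: power_int_add)
    have "(4 * complex_of_real pi) powi (1 - k) * (4 * of_real pi) powi (k - 1) = 1"
      by (rule gen) simp
    then show ?thesis by (simp add: \<kappa>_def mult_ac)
  qed
  have "hyp_laplacian k (\<lambda>w. p w s) z = - y\<^sup>2 * (2 * (dx D z - \<i> * dy D z)) + \<i> * of_int k * y * (2 * D z)"
    unfolding hyp_laplacian_def lap y_def[symmetric] by (simp add: D_def dzbar_def)
  also have "\<dots> = 2 * \<i> * (\<kappa> * (4 * of_real pi) powi (k - 1)) * (y\<^sup>2 * (y powi (- k) * y powi (k - 2))) * (s - (1 - of_int k/2)) * p z s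
      - 2 * \<i> * of_int k * \<kappa> * (y\<^sup>2 * y powi (- k - 1)) * e z + 2 * \<i> * of_int k * \<kappa> * (y * y powi (- k)) * e z"
    unfolding L D[OF z] y_def[symmetric] by (simp add: algebra_simps)
  also have "\<dots> = - ((s - of_int k/2) * ((s - (1 - of_int k/2)) * p z s))"
    unfolding pw kap by (simp add: field_simps)
  finally show ?thesis by (simp add: p_def)
qed

lemma continues_to_one_continued_series:
  assumes k: "k = 0 \<or> k = 2" and z: "Im z > 0" and m: "m \<noteq> 0"
  shows "continues_to_one (poincare_series k m z) (continued_series k m z)"
  unfolding continues_to_one_def
\<comment> \<open>1/16 is the distance from 1 to the line Re s = 15/16.\<close>
proof (intro conjI exI[of _ "1/16"] allI impI)
  have "ball 1 (1/16) \<subseteq> {s. Re s > 15/16}"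
  proof
    fix s assume "s \<in> ball (1::complex) (1/16)"
    then have "norm (1 - s) < 1/16" by (simp add: dist_norm)
    then have "\<bar>Re (1 - s)\<bar> < 1/16" using abs_Re_le_cmod le_less_trans by blast
    then have "\<bar>1 - Re s\<bar> < 1/16" by simp
    then have "15/16 < Re s" by linarith
    then show "s \<in> {s. Re s > 15/16}" by simp
  qed
  moreover have "continuation_domain k = {s. Re s > 15/16}" using k by (simp add: continuation_domain_def)
  ultimately have sub: "{s. 1 < Re s} \<union> ball 1 (1/16) \<subseteq> continuation_domain k" by auto
  show "continued_series k m z holomorphic_on {s. 1 < Re s} \<union> ball 1 (1/16)"
    by (rule holomorphic_on_subset[OF analytic_family_holomorphic[OF analytic_family_continued_series[OF m] z] sub])
  fix s assume "1 < Re s"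
  moreover have "even k" using k by auto
  ultimately show "continued_series k m z s = poincare_series k m z s"
    using continued_series_eq[OF z m, of s k] poincare_series_rows[OF _ z, of k m s] by (simp add: slash_sum_def)
qed simp

text \<open>In weights 0 and 2 the continuation picked by \<open>maass_poincare\<close> is compared
  with \<open>continued_series\<close> near 1, by \<open>continues_to_one_unique\<close>; hence the
  restriction on s. In the other weights the two functions coincide.\<close>

lemma taylor_coeff_maass_poincare:
  assumes k: "even k" and z: "Im z > 0" and m: "m \<noteq> 0" and s: "k = 0 \<or> k = 2 \<Longrightarrow> s = 1"
  shows "taylor_coeff (maass_poincare k m z) s r = taylor_coeff (continued_series k m z) s r"
proof (rule taylor_coeff_cong)
  show "\<forall>\<^sub>F t in nhds s. maass_poincare k m z t = continued_series k m z t"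
  proof (cases "k = 0 \<or> k = 2")
    case True
    note c = continues_to_one_continued_series[OF True z m]
    have "continues_to_one (poincare_series k m z) (maass_poincare k m z)"
      using someI[of "continues_to_one (poincare_series k m z)", OF c] True by (simp add: maass_poincare_def)
    then show ?thesis using continues_to_one_unique[OF _ c] s[OF True] by simp
  next
    case False
    then have "maass_poincare k m z = continued_series k m z"
      using poincare_series_rows[OF k z] by (auto simp: maass_poincare_def continued_series_def slash_sum_def)
    then show ?thesis by simp
  qed
qed

section \<open>Identities between Taylor coefficients\<close>

lemma F_coeff_eq:
  assumes "even k" "k \<le> 0" "Im z > 0" "m \<noteq> 0"
  shows "F_coeff k m r z = taylor_coeff (continued_series k m z) (1 - of_int k / 2) r"
  using taylor_coeff_maass_poincare[OF assms(1,3,4), of "1 - of_int k / 2" r] assms(2)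
  by (auto simp: F_coeff_def taylor_coeff_def fps_expansion_def)

lemma G_coeff_eq:
  assumes "even k" "k \<ge> 2" "Im z > 0" "m \<noteq> 0"
  shows "G_coeff k m r z = taylor_coeff (continued_series k m z) (of_int k / 2) r"
  using taylor_coeff_maass_poincare[OF assms(1,3,4), of "of_int k / 2" r] assms(2)
  by (auto simp: G_coeff_def taylor_coeff_def fps_expansion_def)

lemma xi_cong: "Im z > 0 \<Longrightarrow> (\<And>w. Im w > 0 \<Longrightarrow> f w = g w) \<Longrightarrow> xi k f z = xi k g z"
  unfolding xi_def using dzbar_cong[of z f g] by simp

text \<open>The centre is real, so conjugating the parameter does not move it and conjugating the
  function conjugates its coefficients, which \<open>xi\<close> undoes. The factor s - k/2 splits
  into its value at the centre and an index shift.\<close>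

lemma xi_taylor_continued_series:
  assumes z: "Im z > 0" and m: "m \<noteq> 0" and s: "of_real \<sigma> \<in> continuation_domain k"
  shows "xi k (\<lambda>w. taylor_coeff (continued_series k m w) (of_real \<sigma>) r) z = (4 * of_real pi) powi (1 - k) *
     ((of_real \<sigma> - of_int k/2) * taylor_coeff (continued_series (2 - k) (- m) z) (of_real \<sigma>) r +
       taylor_coeff (continued_series (2 - k) (- m) z) (of_real \<sigma>) (r - 1))"
proof -
  let ?S = "continuation_domain k"
  have m': "- m \<noteq> 0" using m by simp
  have fam: "analytic_family ?S (continued_series (2 - k) (- m))"
    using analytic_family_continued_series[OF m', of "2 - k"] by (simp add: continuation_domain)
  define q where "q = continued_series (2 - k) (- m) z"
  define \<kappa> where "\<kappa> = \<i> / 2 * (4 * of_real pi) powi (1 - k) * complex_of_real (Im z) powi (- k)"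
  have q: "q holomorphic_on ?S" unfolding q_def by (rule analytic_family_holomorphic[OF fam z])
  have qc: "(\<lambda>t. cnj (q (cnj t))) holomorphic_on ?S"
    unfolding q_def by (rule analytic_family_holomorphic[OF analytic_family_cnj[OF fam continuation_domain(2)] z])
  have lc: "(\<lambda>t. (t - of_int k/2) * cnj (q (cnj t))) holomorphic_on ?S" by (intro holomorphic_intros qc)
  note op = continuation_domain(1)[of k]
  have "dzbar (\<lambda>w. taylor_coeff (continued_series k m w) (of_real \<sigma>) r) z =
     taylor_coeff (\<lambda>t. dzbar (\<lambda>w. continued_series k m w t) z) (of_real \<sigma>) r"
    by (rule analytic_family_taylor_dzbar[OF analytic_family_continued_series[OF m] op z s])
  also have "\<dots> = taylor_coeff (\<lambda>t. \<kappa> * ((t - of_int k/2) * cnj (q (cnj t)))) (of_real \<sigma>) r"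
    by (rule taylor_coeff_cong_on[OF op s]) (simp add: dzbar_continued_series[OF z m] \<kappa>_def q_def mult_ac)
  also have "\<dots> = \<kappa> * ((of_real \<sigma> - of_int k/2) * cnj (taylor_coeff q (of_real \<sigma>) r) + cnj (taylor_coeff q (of_real \<sigma>) (r - 1)))"
    unfolding taylor_coeff_cmult[OF lc op s] taylor_coeff_linear_mult[OF qc op s]
    using taylor_coeff_cnj[OF q op, of "of_real \<sigma>"] s by simp
  finally have D: "dzbar (\<lambda>w. taylor_coeff (continued_series k m w) (of_real \<sigma>) r) z = \<dots>" .
  have g: "2 * \<i> * Y * (- \<i> / 2 * P * Z) = P * (Y * Z)" for Y P Z :: complex by (simp add: algebra_simps)
  have "complex_of_real (Im z) powi k * complex_of_real (Im z) powi (- k) = 1"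
    using z by (simp add: power_int_minus)
  moreover have "cnj \<kappa> = - \<i> / 2 * (4 * of_real pi) powi (1 - k) * complex_of_real (Im z) powi (- k)"
    by (simp add: \<kappa>_def)
  ultimately have "2 * \<i> * of_real (Im z) powi k * cnj \<kappa> = (4 * of_real pi) powi (1 - k)"
    by (simp only: g mult_1_right)
  then show ?thesis unfolding xi_def D q_def[symmetric] by (simp add: mult.assoc[symmetric])
qed

text \<open>The eigenvalue has two linear factors in s; each contributes its value at the centre and
  a shift, so the indices r, r - 1 and r - 2 occur.\<close>

lemma hyp_laplacian_taylor_continued_series:
  assumes z: "Im z > 0" and m: "m \<noteq> 0" and s: "s \<in> continuation_domain k"
  defines "c \<equiv> (\<lambda>r. taylor_coeff (continued_series k m z) s r)"
  shows "hyp_laplacian k (\<lambda>w. taylor_coeff (continued_series k m w) s r) z =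
     - ((s - of_int k/2) * ((s - (1 - of_int k/2)) * c r + c (r - 1)) + ((s - (1 - of_int k/2)) * c (r - 1) + c (r - 2)))"
proof -
  let ?S = "continuation_domain k"
  let ?P = "continued_series k m z"
  note op = continuation_domain(1)[of k]
  have P: "?P holomorphic_on ?S" by (rule analytic_family_holomorphic[OF analytic_family_continued_series[OF m] z])
  have P1: "(\<lambda>t. (t - (1 - of_int k/2)) * ?P t) holomorphic_on ?S" by (intro holomorphic_intros P)
  have P2: "(\<lambda>t. (t - of_int k/2) * ((t - (1 - of_int k/2)) * ?P t)) holomorphic_on ?S" by (intro holomorphic_intros P)
  have "hyp_laplacian k (\<lambda>w. taylor_coeff (continued_series k m w) s r) z =
     taylor_coeff (\<lambda>t. hyp_laplacian k (\<lambda>w. continued_series k m w t) z) s r"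
    by (rule analytic_family_taylor_hyp_laplacian[OF analytic_family_continued_series[OF m] op z s])
  also have "\<dots> = taylor_coeff (\<lambda>t. (- 1) * ((t - of_int k/2) * ((t - (1 - of_int k/2)) * ?P t))) s r"
    by (rule taylor_coeff_cong_on[OF op s]) (simp add: hyp_laplacian_continued_series[OF z m])
  also have "\<dots> = (- 1) * ((s - of_int k/2) * ((s - (1 - of_int k/2)) * c r + c (r - 1)) + ((s - (1 - of_int k/2)) * c (r - 1) + c (r - 1 - 1)))"
    unfolding taylor_coeff_cmult[OF P2 op s] taylor_coeff_linear_mult[OF P1 op s] taylor_coeff_linear_mult[OF P op s] c_def ..
  finally show ?thesis by simp
qed

text \<open>At s = 1 - k/2 the factor s - (1 - k/2) of the eigenvalue vanishes and s - k/2 equals 1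
  - k; at s = k/2 the roles are exchanged and the surviving factor is k - 1. The index r therefore
  drops out of the Laplacian, and for k >= 2 also out of \<open>xi\<close>.\<close>

theorem theorem1p3:
  fixes k m r :: int and z :: complex
  assumes "even k" and "m \<noteq> 0" and "r \<ge> 0" and "Im z > 0"
  shows "(k \<le> 0 \<longrightarrow>
            xi k (F_coeff k m r) z =
              (4 * of_real pi) powi (1 - k) *
              ((1 - of_int k) * G_coeff (2 - k) (- m) r z + G_coeff (2 - k) (- m) (r - 1) z) \<and>
            hyp_laplacian k (F_coeff k m r) z =
              (of_int k - 1) * F_coeff k m (r - 1) z - F_coeff k m (r - 2) z) \<and>
         (k \<ge> 2 \<longrightarrow>
            xi k (G_coeff k m r) z =
              (4 * of_real pi) powi (1 - k) * F_coeff (2 - k) (- m) (r - 1) z \<and>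
            hyp_laplacian k (G_coeff k m r) z =
              (1 - of_int k) * G_coeff k m (r - 1) z - G_coeff k m (r - 2) z)"
proof (intro conjI impI)
  have m': "- m \<noteq> 0" and k': "even (2 - k)" using assms by auto
  note z = \<open>Im z > 0\<close>
  {
    assume k: "k \<le> 0"
    define \<sigma> where "\<sigma> = 1 - real_of_int k / 2"
    have \<sigma>: "complex_of_real \<sigma> = 1 - of_int k / 2" by (simp add: \<sigma>_def)
    have dom: "complex_of_real \<sigma> \<in> continuation_domain k" using k by (auto simp: continuation_domain_def \<sigma>_def)
    have F: "F_coeff k m r w = taylor_coeff (continued_series k m w) (of_real \<sigma>) r" if "Im w > 0" for w r
      unfolding \<sigma> by (rule F_coeff_eq[OF assms(1) k that assms(2)])
    have G: "G_coeff (2 - k) (- m) r z = taylor_coeff (continued_series (2 - k) (- m) z) (of_real \<sigma>) r" for r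
      using G_coeff_eq[OF k' _ z m'] k by (simp add: \<sigma> diff_divide_distrib)
    show "xi k (F_coeff k m r) z = (4 * of_real pi) powi (1 - k) *
        ((1 - of_int k) * G_coeff (2 - k) (- m) r z + G_coeff (2 - k) (- m) (r - 1) z)"
      using xi_cong[OF z, of "F_coeff k m r" _ k, OF F] xi_taylor_continued_series[OF z assms(2) dom, of r]
      by (simp add: G) (simp add: \<sigma>)
    show "hyp_laplacian k (F_coeff k m r) z = (of_int k - 1) * F_coeff k m (r - 1) z - F_coeff k m (r - 2) z"
      using hyp_laplacian_cong[OF z, of "F_coeff k m r" _ k, OF F] hyp_laplacian_taylor_continued_series[OF z assms(2) dom, of r]
      by (simp add: F[OF z]) (simp add: \<sigma> algebra_simps)
  }
  {
    assume k: "k \<ge> 2"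
    define \<sigma> where "\<sigma> = real_of_int k / 2"
    have \<sigma>: "complex_of_real \<sigma> = of_int k / 2" by (simp add: \<sigma>_def)
    have dom: "complex_of_real \<sigma> \<in> continuation_domain k" using k by (auto simp: continuation_domain_def \<sigma>_def)
    have G: "G_coeff k m r w = taylor_coeff (continued_series k m w) (of_real \<sigma>) r" if "Im w > 0" for w r
      unfolding \<sigma> by (rule G_coeff_eq[OF assms(1) k that assms(2)])
    have F: "F_coeff (2 - k) (- m) r z = taylor_coeff (continued_series (2 - k) (- m) z) (of_real \<sigma>) r" for r
      using F_coeff_eq[OF k' _ z m'] k by (simp add: \<sigma> diff_divide_distrib)
    show "xi k (G_coeff k m r) z = (4 * of_real pi) powi (1 - k) * F_coeff (2 - k) (- m) (r - 1) z"
      using xi_cong[OF z, of "G_coeff k m r" _ k, OF G] xi_taylor_continued_series[OF z assms(2) dom, of r]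
      by (simp add: F) (simp add: \<sigma>)
    show "hyp_laplacian k (G_coeff k m r) z = (1 - of_int k) * G_coeff k m (r - 1) z - G_coeff k m (r - 2) z"
      using hyp_laplacian_cong[OF z, of "G_coeff k m r" _ k, OF G] hyp_laplacian_taylor_continued_series[OF z assms(2) dom, of r]
      by (simp add: G[OF z]) (simp add: \<sigma> algebra_simps)
  }
qed

end
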